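(* Let $n\ge1$, $\alpha>0$, $T>0$. Let $\Omega\subset\mathbb{R}^n$ be a convex open domain and $u_0:\Omega\to\mathbb{R}$ a function whose graph $\Sigma_0=\{(x,u_0(x)):x\in\Omega\}$ is a smooth, locally uniformly convex hypersurface, and suppose that (i) $u_0$ attains its minimum in $\Omega$ and $\inf_\Omega u_0\ge0$; (ii) if $\Omega\neq\mathbb{R}^n$, then $\lim_{x\to x_0}u_0(x)=+\infty$ for all $x_0\in\partial\Omega$; (iii) if $\Omega$ is unbounded, then $\lim_{R\to+\infty}(\inf_{\Omega\setminus B_R(0)}u_0)=+\infty$. Let $\Sigma_t=F(M^n,t)$ be a complete strictly convex smooth graph solution of the $\alpha$-Gauss curvature flow starting from $\Sigma_0$, defined on $M^n\times[0,T)$. Then, given a constant $M\ge1$, for all $p\in M^n$ and $t\in[0,T)$, $$\Big(\frac{t}{1+t}\Big)\big(\psi^2K^{\frac1n}\big)(p,t)\ \le\ (4n\alpha+1)^2(2\theta)^{1+\frac{1}{2n\alpha}}\,(\theta\Lambda+M^2),$$ where $\theta$ and $\Lambda$ are the constants (depending on $t$ and $M$) $$\theta=\sup\{\upsilon^2(q,s):\bar u(q,s)<M,\ s\in[0,t]\},\qquad \Lambda=\sup\{\lambda_{\min}^{-1}(q,s):\bar u(q,s)<M,\ s\in[0,t]\}.$$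
   Context: **Flow.** A complete strictly convex smooth graph solution of the $\alpha$-Gauss curvature flow on $M^n\times[0,T)$ is a smooth family of immersions $F(\cdot,t):M^n\to\mathbb{R}^{n+1}$, $t\in[0,T)$, such that each image $\Sigma_t=F(M^n,t)$ is a complete, strictly convex (all principal curvatures positive), smooth embedded hypersurface which is a graph over a domain in $\mathbb{R}^n$ (in the direction $\vec e_{n+1}$), $F(M^n,0)=\Sigma_0$, and $\partial_tF=K^\alpha\vec n$, where $K$ is the Gauss curvature and $\vec n$ the interior unit normal of $\Sigma_t$ at $F(p,t)$. A smooth convex hypersurface is locally uniformly convex if on each compact subset of $\mathbb{R}^{n+1}$ its smallest principal curvature is bounded below by a positive constant. **Notation.** $\lambda_{\min}(p,t)$ is the smallest principal curvature of $\Sigma_t$ at $F(p,t)$; $\bar u(p,t)=\langle F(p,t),\vec e_{n+1}\rangle$ is the height function; $\psi(p,t)=\max\{M-\bar u(p,t),0\}$ is the cut-off function; $\upsilon(p,t)=\langle\vec n(p,t),\vec e_{n+1}\rangle^{-1}$ is the gradient function. *)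

theory Defs
  imports "HOL-Analysis.Analysis"
begin

subsection \<open>Smooth maps and smooth manifolds\<close>

(* C^k through the directional derivatives of order at most k. Derivatives are taken within S, so
   that S may have boundary points: below S is open, or U x [0,T) with U open. In both cases the
   derivative within S is unique. *)
primrec Ck_on :: "nat \<Rightarrow> 'a::euclidean_space set \<Rightarrow> ('a \<Rightarrow> 'b::real_normed_vector) \<Rightarrow> bool" where
  "Ck_on 0 S f \<longleftrightarrow> continuous_on S f"
| "Ck_on (Suc k) S f \<longleftrightarrow>
     (\<exists>f'. (\<forall>x\<in>S. (f has_derivative f' x) (at x within S)) \<and> (\<forall>v. Ck_on k S (\<lambda>x. f' x v)))"

definition smooth_on :: "'a::euclidean_space set \<Rightarrow> ('a \<Rightarrow> 'b::real_normed_vector) \<Rightarrow> bool" where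
  "smooth_on S f \<longleftrightarrow> (\<forall>k. Ck_on k S f)"

(* A chart is a pair (U, c) where only the values of c on U matter. The Hausdorff and second
   countability axioms of a manifold are the type class constraints on 'm; the dimension is
   CARD('n). *)
type_synonym ('m, 'n) chart = "'m set \<times> ('m \<Rightarrow> real ^ 'n)"

definition smooth_atlas ::
  "('m::{second_countable_topology, t2_space}, 'n::finite) chart set \<Rightarrow> bool" where
  "smooth_atlas A \<longleftrightarrow>
     (\<Union>(U, c)\<in>A. U) = UNIV \<and>
     (\<forall>(U, c)\<in>A. open U \<and> open (c ` U) \<and> homeomorphism U (c ` U) c (inv_into U c)) \<and>
     (\<forall>(U, c)\<in>A. \<forall>(V, d)\<in>A. smooth_on (c ` (U \<inter> V)) (\<lambda>x. d (inv_into U c x)))"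

subsection \<open>Embedded hypersurfaces\<close>

(* R^(n+1) is R^n x R with its Euclidean inner product. *)
type_synonym 'n space = "(real ^ 'n) \<times> real"

definition e_vert :: "'n::finite space" where
  "e_vert = (0, 1)"

definition graph_over :: "(real ^ 'n) set \<Rightarrow> (real ^ 'n \<Rightarrow> real) \<Rightarrow> 'n::finite space set" where
  "graph_over D u = {(x, u x) | x. x \<in> D}"

definition local_param ::
  "'n::finite space set \<Rightarrow> (real ^ 'n) set \<Rightarrow> (real ^ 'n \<Rightarrow> 'n space) \<Rightarrow> bool" where
  "local_param \<Sigma> U X \<longleftrightarrow>
     open U \<and> smooth_on U X \<and> (\<forall>x\<in>U. inj (frechet_derivative X (at x))) \<and>
     openin (top_of_set \<Sigma>) (X ` U) \<and> (\<exists>Y. homeomorphism U (X ` U) X Y)"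

definition smooth_hypersurface :: "'n::finite space set \<Rightarrow> bool" where
  "smooth_hypersurface \<Sigma> \<longleftrightarrow> (\<forall>P\<in>\<Sigma>. \<exists>U X. local_param \<Sigma> U X \<and> P \<in> X ` U)"

definition tangent_space :: "'n::finite space set \<Rightarrow> 'n space \<Rightarrow> 'n space set" where
  "tangent_space \<Sigma> P =
     {frechet_derivative X (at x) v | U X x v. local_param \<Sigma> U X \<and> x \<in> U \<and> X x = P}"

subsection \<open>Interior normal and curvature\<close>

(* A complete strictly convex hypersurface bounds its convex hull, and the interior unit normal
   points into the interior of that hull. *)
definition is_interior_normal :: "'n::finite space set \<Rightarrow> 'n space \<Rightarrow> 'n space \<Rightarrow> bool" where
  "is_interior_normal \<Sigma> P \<nu> \<longleftrightarrow>
     norm \<nu> = 1 \<and> (\<forall>w\<in>tangent_space \<Sigma> P. w \<bullet> \<nu> = 0) \<and>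
     (\<exists>\<epsilon>>0. \<forall>s\<in>{0<..<\<epsilon>}. P + s *\<^sub>R \<nu> \<in> interior (convex hull \<Sigma>))"

definition interior_normal :: "'n::finite space set \<Rightarrow> 'n space \<Rightarrow> 'n space" where
  "interior_normal \<Sigma> P = (THE \<nu>. is_interior_normal \<Sigma> P \<nu>)"

definition pd :: "'n::finite \<Rightarrow> (real ^ 'n \<Rightarrow> 'n space) \<Rightarrow> real ^ 'n \<Rightarrow> 'n space" where
  "pd i X x = frechet_derivative X (at x) (axis i 1)"

definition first_form :: "(real ^ 'n \<Rightarrow> 'n space) \<Rightarrow> real ^ 'n \<Rightarrow> real ^ 'n ^ 'n::finite" where
  "first_form X x = (\<chi> i j. pd i X x \<bullet> pd j X x)"

definition second_form ::
  "(real ^ 'n \<Rightarrow> 'n space) \<Rightarrow> 'n space \<Rightarrow> real ^ 'n \<Rightarrow> real ^ 'n ^ 'n::finite" where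
  "second_form X \<nu> x = (\<chi> i j. pd i (pd j X) x \<bullet> \<nu>)"

(* The matrix of the shape operator in the coordinates X. With the interior normal, round spheres
   have positive curvature. *)
definition shape_matrix ::
  "(real ^ 'n \<Rightarrow> 'n space) \<Rightarrow> 'n space \<Rightarrow> real ^ 'n \<Rightarrow> real ^ 'n ^ 'n::finite" where
  "shape_matrix X \<nu> x = matrix_inv (first_form X x) ** second_form X \<nu> x"

(* Neither the eigenvalues nor the determinant of the shape matrix depend on the local
   parametrization. *)
definition principal_curvatures :: "'n::finite space set \<Rightarrow> 'n space \<Rightarrow> real set" where
  "principal_curvatures \<Sigma> P =
     {\<kappa>. \<exists>U X x v. local_param \<Sigma> U X \<and> x \<in> U \<and> X x = P \<and> v \<noteq> 0 \<and>
          shape_matrix X (interior_normal \<Sigma> P) x *v v = \<kappa> *\<^sub>R v}"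

definition lambda_min :: "'n::finite space set \<Rightarrow> 'n space \<Rightarrow> real" where
  "lambda_min \<Sigma> P = Min (principal_curvatures \<Sigma> P)"

definition gauss_curvature :: "'n::finite space set \<Rightarrow> 'n space \<Rightarrow> real" where
  "gauss_curvature \<Sigma> P =
     (THE K. \<exists>U X x. local_param \<Sigma> U X \<and> x \<in> U \<and> X x = P \<and>
          K = det (shape_matrix X (interior_normal \<Sigma> P) x))"

(* The condition on the interior normal makes the sign of the principal curvatures meaningful; it
   holds automatically for a graph of a function with definite Hessian over a convex domain. *)
definition strictly_convex_hypersurface :: "'n::finite space set \<Rightarrow> bool" where
  "strictly_convex_hypersurface \<Sigma> \<longleftrightarrow>
     smooth_hypersurface \<Sigma> \<and>
     (\<forall>P\<in>\<Sigma>. (\<exists>!\<nu>. is_interior_normal \<Sigma> P \<nu>) \<and> (\<forall>\<kappa>\<in>principal_curvatures \<Sigma> P. 0 < \<kappa>))"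

definition locally_uniformly_convex :: "'n::finite space set \<Rightarrow> bool" where
  "locally_uniformly_convex \<Sigma> \<longleftrightarrow>
     strictly_convex_hypersurface \<Sigma> \<and>
     (\<forall>C. compact C \<longrightarrow> (\<exists>c>0. \<forall>P\<in>\<Sigma> \<inter> C. c \<le> lambda_min \<Sigma> P))"

subsection \<open>Completeness\<close>

(* Requiring an actual integral, and not just the value of the operator integral, excludes curves
   of infinite length. *)
definition intrinsic_dist :: "'n::finite space set \<Rightarrow> 'n space \<Rightarrow> 'n space \<Rightarrow> real" where
  "intrinsic_dist \<Sigma> P Q =
     Inf {L. \<exists>\<gamma>. \<gamma> piecewise_C1_differentiable_on {0..1} \<and> \<gamma> ` {0..1} \<subseteq> \<Sigma> \<and>
             \<gamma> 0 = P \<and> \<gamma> 1 = Q \<and>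
             ((\<lambda>s. norm (vector_derivative \<gamma> (at s))) has_integral L) {0..1}}"

definition complete_hypersurface :: "'n::finite space set \<Rightarrow> bool" where
  "complete_hypersurface \<Sigma> \<longleftrightarrow>
     (\<forall>X::nat \<Rightarrow> 'n space. range X \<subseteq> \<Sigma> \<longrightarrow>
        (\<forall>\<epsilon>>0. \<exists>N. \<forall>i\<ge>N. \<forall>j\<ge>N. intrinsic_dist \<Sigma> (X i) (X j) < \<epsilon>) \<longrightarrow>
        (\<exists>P\<in>\<Sigma>. (\<lambda>i. intrinsic_dist \<Sigma> (X i) P) \<longlonglongrightarrow> 0))"

subsection \<open>The flow\<close>

definition smooth_family_of_immersions ::
  "('m::{second_countable_topology, t2_space}, 'n::finite) chart set \<Rightarrow> real \<Rightarrow>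
   ('m \<Rightarrow> real \<Rightarrow> 'n space) \<Rightarrow> bool" where
  "smooth_family_of_immersions A T F \<longleftrightarrow>
     (\<forall>(U, c)\<in>A.
        smooth_on (c ` U \<times> {0..<T}) (\<lambda>(x, t). F (inv_into U c x) t) \<and>
        (\<forall>t\<in>{0..<T}. \<forall>x\<in>c ` U. inj (frechet_derivative (\<lambda>y. F (inv_into U c y) t) (at x))))"

definition slice :: "('m \<Rightarrow> real \<Rightarrow> 'n::finite space) \<Rightarrow> real \<Rightarrow> 'n space set" where
  "slice F t = range (\<lambda>p. F p t)"

definition gcf_graph_solution ::
  "('m::{second_countable_topology, t2_space}, 'n::finite) chart set \<Rightarrow> real \<Rightarrow> real \<Rightarrow>
   'n space set \<Rightarrow> ('m \<Rightarrow> real \<Rightarrow> 'n space) \<Rightarrow> bool" where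
  "gcf_graph_solution A \<alpha> T \<Sigma>0 F \<longleftrightarrow>
     smooth_family_of_immersions A T F \<and>
     (\<forall>t\<in>{0..<T}.
        complete_hypersurface (slice F t) \<and>
        strictly_convex_hypersurface (slice F t) \<and>
        (\<exists>D u. open D \<and> connected D \<and> slice F t = graph_over D u)) \<and>
     slice F 0 = \<Sigma>0 \<and>
     (\<forall>p. \<forall>t\<in>{0..<T}.
        ((\<lambda>s. F p s) has_vector_derivative
           (gauss_curvature (slice F t) (F p t) powr \<alpha>) *\<^sub>R interior_normal (slice F t) (F p t))
          (at t within {0..<T}))"

definition height :: "('m \<Rightarrow> real \<Rightarrow> 'n::finite space) \<Rightarrow> 'm \<Rightarrow> real \<Rightarrow> real" where
  "height F p t = F p t \<bullet> e_vert"

definition cutoff :: "real \<Rightarrow> ('m \<Rightarrow> real \<Rightarrow> 'n::finite space) \<Rightarrow> 'm \<Rightarrow> real \<Rightarrow> real" where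
  "cutoff M F p t = max (M - height F p t) 0"

definition gradient_fn :: "('m \<Rightarrow> real \<Rightarrow> 'n::finite space) \<Rightarrow> 'm \<Rightarrow> real \<Rightarrow> real" where
  "gradient_fn F p t = inverse (interior_normal (slice F t) (F p t) \<bullet> e_vert)"

(* Suprema over the reals. For a solution as in the theorem the height is nondecreasing in time and
   the initial sublevel sets are compact, so both sets are bounded above. If they are empty, then
   the cutoff vanishes on [0,t]. *)
definition theta_const :: "real \<Rightarrow> ('m \<Rightarrow> real \<Rightarrow> 'n::finite space) \<Rightarrow> real \<Rightarrow> real" where
  "theta_const M F t =
     Sup {(gradient_fn F q s)\<^sup>2 | q s. height F q s < M \<and> s \<in> {0..t}}"

definition Lambda_const :: "real \<Rightarrow> ('m \<Rightarrow> real \<Rightarrow> 'n::finite space) \<Rightarrow> real \<Rightarrow> real" where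
  "Lambda_const M F t =
     Sup {inverse (lambda_min (slice F s) (F q s)) | q s. height F q s < M \<and> s \<in> {0..t}}"

end

theory Submission
  imports Defs
begin

text \<open>In graph coordinates the flow is \<open>ln u\<^sub>t = \<alpha> ln det D\<^sup>2u + G(Du)\<close> with \<open>u\<^sub>t = \<upsilon> K\<^sup>\<alpha>\<close>. Differentiating
  this equation in time and in space shows that \<open>u\<^sub>t\<close> and all components of \<open>Du\<close> are annihilated by one and
  the same linear parabolic operator, so that no identities for the second fundamental form are needed. With
  \<open>\<phi> = \<upsilon>\<^sup>2 / (2\<theta> - \<upsilon>\<^sup>2)\<close>, the test function \<open>t/(1+t) \<psi>\<^sup>2 K^(1/n) \<phi>^(1/(2n\<alpha>))\<close> has the logarithm
  \<open>ln(t/(1+t)) + 2 ln(M - u) + (ln u\<^sub>t - ln(2\<theta> - 1 - |Du|\<^sup>2)/2) / (n\<alpha>)\<close>. At an interior maximum the convexity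
  of \<open>- ln(2\<theta> - 1 - |y|\<^sup>2)\<close> and the inequality between trace and determinant of \<open>D\<^sup>2u\<close> produce the good term
  \<open>K^(\<alpha>+1/n) \<phi>\<close>, which dominates everything else.

  The manifold need be neither connected nor embedded by the flow, so compactness comes from the graphs
  alone. Uniqueness of the interior normal puts every slice on the boundary of its convex hull, and
  completeness makes the graph function unbounded towards the boundary of its domain. Hence a limit of points
  of bounded height on the slices lies on the limit slice. Since heights increase in time, the sublevel sets at
  later times lie over those at time \<open>0\<close>, which are bounded.\<close>

subsection \<open>Calculus of the classes C^k\<close>

text \<open>The exponents of the test function are forced: as \<phi>^(1/2) = \<upsilon> / (2\<theta>
  - \<upsilon>^2)^(1/2) and u_t = \<upsilon> K^\<alpha>, the factor K^(1/n) \<phi>^(1/(2n\<alpha>))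
  is (u_t / (2\<theta> - \<upsilon>^2)^(1/2))^(1/(n\<alpha>)), in which no curvature is visible.
  Since 1 \<le> \<upsilon>^2 \<le> \<theta>, also 1/(2\<theta>) \<le> \<phi> \<le> 1; comparing the
  maximum with the given point therefore costs (2\<theta>)^(1/(2n\<alpha>)), and the remaining
  2\<theta> bounds the denominator of the good term. The constant (4n\<alpha> + 1)^2 is a common
  bound for the coefficients 1 + 2n\<alpha> and 2\<alpha>(1 + 4n\<alpha>) of M^2 and \<Lambda>. Two
  obstacles precede the computation. The graph functions are given for each time separately, so
  their joint smoothness must be extracted from the charts of the flow. And the definition of a
  solution does not exclude concave graphs; it is the minimum of the initial function that fixes the
  sign of the normal.\<close>

lemma Ck_on_cong:
  assumes "Ck_on k S f" and "\<And>x. x \<in> S \<Longrightarrow> f x = g x"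
  shows "Ck_on k S g"
proof (cases k)
  case 0
  then show ?thesis using assms by (simp cong: continuous_on_cong)
next
  case (Suc j)
  then obtain f' where f': "\<forall>x\<in>S. (f has_derivative f' x) (at x within S)"
      "\<forall>v. Ck_on j S (\<lambda>x. f' x v)"
    using assms by auto
  have "(g has_derivative f' x) (at x within S)" if "x \<in> S" for x
    by (rule has_derivative_transform[OF that _ f'(1)[rule_format, OF that]])
      (simp add: assms(2))
  then show ?thesis using Suc f' by auto
qed

lemma Ck_on_SucD: "Ck_on (Suc k) S f \<Longrightarrow> Ck_on k S f"
proof (induction k arbitrary: f)
  case 0
  then show ?case
    by (auto simp: continuous_on_eq_continuous_within intro: has_derivative_continuous)
next
  case (Suc k)
  then obtain f' where f': "\<forall>x\<in>S. (f has_derivative f' x) (at x within S)"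
      "\<forall>v. Ck_on (Suc k) S (\<lambda>x. f' x v)"
    by (auto simp del: Ck_on.simps simp: Ck_on.simps(2)[of "Suc k" S f])
  then show ?case using Suc.IH by auto
qed

lemma Ck_on_le: "Ck_on k S f \<Longrightarrow> j \<le> k \<Longrightarrow> Ck_on j S f"
proof (induction k)
  case (Suc k)
  then show ?case using Ck_on_SucD by (cases "j = Suc k") auto
qed simp

lemma Ck_on_imp_continuous_on: "Ck_on k S f \<Longrightarrow> continuous_on S f"
  using Ck_on_le[of k S f 0] by simp

lemma Ck_on_subset: "Ck_on k S f \<Longrightarrow> R \<subseteq> S \<Longrightarrow> Ck_on k R f"
proof (induction k arbitrary: f)
  case 0
  then show ?case by (auto intro: continuous_on_subset)
next
  case (Suc k)
  then obtain f' where f': "\<forall>x\<in>S. (f has_derivative f' x) (at x within S)"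
      "\<forall>v. Ck_on k S (\<lambda>x. f' x v)"
    by auto
  then have "\<forall>x\<in>R. (f has_derivative f' x) (at x within R)"
    using Suc.prems(2) has_derivative_subset by blast
  then show ?case using f' Suc by auto
qed

lemma Ck_on_const: "Ck_on k S (\<lambda>x. c)"
proof (induction k arbitrary: c)
  case (Suc k)
  then show ?case
    unfolding Ck_on.simps by (intro exI[of _ "\<lambda>_ _. 0"]) auto
qed auto

lemma Ck_on_linear: "bounded_linear f \<Longrightarrow> Ck_on k S f"
proof (cases k)
  case 0
  assume "bounded_linear f"
  then show ?thesis using 0 by (auto intro: bounded_linear.continuous_on[OF _ continuous_on_id])
next
  case (Suc j)
  assume "bounded_linear f"
  then show ?thesis using Suc
    by (auto intro!: exI[of _ "\<lambda>_. f"] bounded_linear_imp_has_derivative Ck_on_const)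
qed

lemma Ck_on_add:
  "Ck_on k S f \<Longrightarrow> Ck_on k S g \<Longrightarrow> Ck_on k S (\<lambda>x. f x + g x)"
proof (induction k arbitrary: f g)
  case 0
  then show ?case by (auto intro: continuous_intros)
next
  case (Suc k)
  then obtain f' g' where "\<forall>x\<in>S. (f has_derivative f' x) (at x within S)"
      "\<forall>v. Ck_on k S (\<lambda>x. f' x v)" "\<forall>x\<in>S. (g has_derivative g' x) (at x within S)"
      "\<forall>v. Ck_on k S (\<lambda>x. g' x v)"
    by auto
  then show ?case unfolding Ck_on.simps using Suc.IH
    by (intro exI[of _ "\<lambda>x v. f' x v + g' x v"]) (auto intro: has_derivative_add)
qed

text \<open>One induction over the Leibniz rule serves scalar multiples, products and inner products
  alike.\<close>

lemma (in bounded_bilinear) Ck_on_bilinear: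
  fixes f :: "'d::euclidean_space \<Rightarrow> 'a" and g :: "'d \<Rightarrow> 'b"
  shows "Ck_on k S f \<Longrightarrow> Ck_on k S g \<Longrightarrow> Ck_on k S (\<lambda>x. prod (f x) (g x))"
proof (induction k arbitrary: f g)
  case 0
  then show ?case by (auto intro: continuous_on)
next
  case (Suc k)
  then obtain f' g' where fg: "\<forall>x\<in>S. (f has_derivative f' x) (at x within S)"
      "\<forall>v. Ck_on k S (\<lambda>x. f' x v)" "\<forall>x\<in>S. (g has_derivative g' x) (at x within S)"
      "\<forall>v. Ck_on k S (\<lambda>x. g' x v)"
    by auto
  have "Ck_on k S f" "Ck_on k S g"
    using Suc.prems Ck_on_SucD by blast+
  then have "Ck_on k S (\<lambda>x. prod (f x) (g' x v) + prod (f' x v) (g x))" for v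
    using fg by (intro Ck_on_add Suc.IH) auto
  then show ?case unfolding Ck_on.simps using fg
    by (intro exI[of _ "\<lambda>x v. prod (f x) (g' x v) + prod (f' x v) (g x)"]) (auto intro: FDERIV)
qed

lemmas Ck_on_scaleR = bounded_bilinear.Ck_on_bilinear[OF bounded_bilinear_scaleR]
lemmas Ck_on_mult = bounded_bilinear.Ck_on_bilinear[OF bounded_bilinear_mult]
lemmas Ck_on_inner = bounded_bilinear.Ck_on_bilinear[OF bounded_bilinear_inner]

lemma Ck_on_sum:
  "(\<And>i. i \<in> I \<Longrightarrow> Ck_on k S (f i)) \<Longrightarrow> Ck_on k S (\<lambda>x. \<Sum>i\<in>I. f i x)"
  by (induction I rule: infinite_finite_induct) (auto intro: Ck_on_const Ck_on_add)

lemma Ck_on_prod: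
  fixes f :: "'i \<Rightarrow> 'a::euclidean_space \<Rightarrow> real"
  shows "(\<And>i. i \<in> I \<Longrightarrow> Ck_on k S (f i)) \<Longrightarrow> Ck_on k S (\<lambda>x. \<Prod>i\<in>I. f i x)"
  by (induction I rule: infinite_finite_induct) (auto intro: Ck_on_const Ck_on_mult)

text \<open>In the chain rule f' (g x) (g' x v) the direction g' x v moves with x, while
  \<open>Ck_on\<close> controls f' only in fixed directions. Expanding the moving direction in
  \<open>Basis\<close> turns the derivative into a finite sum of products to which the induction
  hypothesis applies.\<close>

lemma Ck_on_compose:
  fixes f :: "'b::euclidean_space \<Rightarrow> 'c::real_normed_vector"
    and g :: "'a::euclidean_space \<Rightarrow> 'b"
  shows "Ck_on k R f \<Longrightarrow> Ck_on k S g \<Longrightarrow> g ` S \<subseteq> R \<Longrightarrow> Ck_on k S (\<lambda>x. f (g x))"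
proof (induction k arbitrary: f g)
  case 0
  then show ?case by (auto intro: continuous_on_compose2)
next
  case (Suc k)
  then obtain f' g' where fg: "\<forall>x\<in>R. (f has_derivative f' x) (at x within R)"
      "\<forall>v. Ck_on k R (\<lambda>x. f' x v)" "\<forall>x\<in>S. (g has_derivative g' x) (at x within S)"
      "\<forall>v. Ck_on k S (\<lambda>x. g' x v)"
    by auto
  have gk: "Ck_on k S g"
    using Suc.prems Ck_on_SucD by blast
  have "Ck_on k S (\<lambda>x. \<Sum>b\<in>Basis. (g' x v \<bullet> b) *\<^sub>R f' (g x) b)" for v
    using fg gk Suc.prems(3)
    by (intro Ck_on_sum Ck_on_scaleR Ck_on_inner Ck_on_const Suc.IH[of "\<lambda>y. f' y _" g]) auto
  moreover have "(\<Sum>b\<in>Basis. (g' x v \<bullet> b) *\<^sub>R f' (g x) b) = f' (g x) (g' x v)" if "x \<in> S" for x v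
  proof -
    have "linear (f' (g x))"
      using fg(1) Suc.prems(3) that has_derivative_linear by blast
    then have "f' (g x) (\<Sum>b\<in>Basis. (g' x v \<bullet> b) *\<^sub>R b)
        = (\<Sum>b\<in>Basis. (g' x v \<bullet> b) *\<^sub>R f' (g x) b)"
      by (simp add: linear_sum linear_scale)
    then show ?thesis by (simp add: euclidean_representation)
  qed
  ultimately have "Ck_on k S (\<lambda>x. f' (g x) (g' x v))" for v
    by (rule Ck_on_cong)
  moreover have "((\<lambda>x. f (g x)) has_derivative (\<lambda>v. f' (g x) (g' x v))) (at x within S)"
    if "x \<in> S" for x
  proof (rule has_derivative_in_compose[where f = g and g = f])
    show "(g has_derivative g' x) (at x within S)" using fg that by auto
    show "(f has_derivative f' (g x)) (at (g x) within g ` S)"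
      using fg(1) Suc.prems(3) that by (meson has_derivative_subset image_subset_iff)
  qed
  ultimately show ?case unfolding Ck_on.simps
    by (intro exI[of _ "\<lambda>x v. f' (g x) (g' x v)"]) blast
qed

lemma Ck_on_linear_compose:
  fixes f :: "'b::euclidean_space \<Rightarrow> 'c::real_normed_vector"
  shows "bounded_linear f \<Longrightarrow> Ck_on k S g \<Longrightarrow> Ck_on k S (\<lambda>x. f (g x))"
  by (rule Ck_on_compose[where R = UNIV]) (auto intro: Ck_on_linear)

lemma Ck_on_Pair:
  assumes "Ck_on k S f" "Ck_on k S g"
  shows "Ck_on k S (\<lambda>x. (f x :: 'b::euclidean_space, g x :: 'c::euclidean_space))"
proof -
  have "bounded_linear (\<lambda>y::'b. (y, 0::'c))" "bounded_linear (\<lambda>y::'c. (0::'b, y))"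
    by (auto intro!: bounded_linear_intros)
  then have "Ck_on k S (\<lambda>x. (f x, 0::'c) + (0::'b, g x))"
    using assms by (intro Ck_on_add Ck_on_linear_compose[where f = "\<lambda>y. (y, 0)"]
        Ck_on_linear_compose[where f = "\<lambda>y. (0, y)"])
  then show ?thesis by simp
qed

text \<open>The derivative of 1/f is a product of f' and copies of 1/f itself, which is C^k by the
  induction hypothesis.\<close>

lemma Ck_on_inverse:
  fixes f :: "'a::euclidean_space \<Rightarrow> real"
  shows "Ck_on k S f \<Longrightarrow> (\<And>x. x \<in> S \<Longrightarrow> f x \<noteq> 0) \<Longrightarrow> Ck_on k S (\<lambda>x. inverse (f x))"
proof (induction k arbitrary: f)
  case 0
  then show ?case by (auto intro: continuous_on_inverse)
next
  case (Suc k)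
  then obtain f' where f': "\<forall>x\<in>S. (f has_derivative f' x) (at x within S)"
      "\<forall>v. Ck_on k S (\<lambda>x. f' x v)"
    by auto
  have inv: "Ck_on k S (\<lambda>x. inverse (f x))"
    using Suc Ck_on_SucD by blast
  have "Ck_on k S (\<lambda>x. (-1) * (inverse (f x) * f' x v * inverse (f x)))" for v
    using f' by (intro Ck_on_mult inv Ck_on_const) auto
  moreover have "((\<lambda>x. inverse (f x)) has_derivative
      (\<lambda>v. (-1) * (inverse (f x) * f' x v * inverse (f x)))) (at x within S)" if "x \<in> S" for x
    using f'(1)[rule_format, OF that] Suc.prems(2)[OF that]
    by (auto intro!: derivative_eq_intros)
  ultimately show ?case unfolding Ck_on.simps
    by (intro exI[of _ "\<lambda>x v. (-1) * (inverse (f x) * f' x v * inverse (f x))"]) blast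
qed

lemma Ck_on_divide:
  fixes f g :: "'a::euclidean_space \<Rightarrow> real"
  assumes "Ck_on k S f" "Ck_on k S g" "\<And>x. x \<in> S \<Longrightarrow> g x \<noteq> 0"
  shows "Ck_on k S (\<lambda>x. f x / g x)"
  using Ck_on_mult[OF assms(1) Ck_on_inverse[OF assms(2,3)]] by (simp add: divide_inverse)

lemma Ck_on_det:
  fixes A :: "'a::euclidean_space \<Rightarrow> real^'n::finite^'n"
  assumes "\<And>i j. Ck_on k S (\<lambda>x. A x $ i $ j)"
  shows "Ck_on k S (\<lambda>x. det (A x))"
  unfolding det_def by (intro Ck_on_sum Ck_on_mult Ck_on_const Ck_on_prod assms)

lemma Ck_on_vec:
  fixes f :: "'a::euclidean_space \<Rightarrow> real^'n::finite"
  assumes "\<And>i. Ck_on k S (\<lambda>x. f x $ i)"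
  shows "Ck_on k S f"
proof -
  have "Ck_on k S (\<lambda>x. \<Sum>i\<in>UNIV. (f x $ i) *\<^sub>R axis i 1)"
    by (intro Ck_on_sum Ck_on_scaleR assms Ck_on_const)
  moreover have "(\<Sum>i\<in>UNIV. (y $ i) *\<^sub>R axis i 1) = y" for y :: "real^'n"
    using basis_expansion[of y] by (simp add: scalar_mult_eq_scaleR)
  ultimately show ?thesis by (auto intro: Ck_on_cong)
qed

text \<open>Cramer's rule writes the components of the solution as quotients of determinants in the
  data. No regularity of \<open>y\<close> is presupposed, so it may be any expression that solves
  the system, in particular one built from \<open>matrix_inv\<close>.\<close>

lemma Ck_on_solve:
  fixes A :: "'a::euclidean_space \<Rightarrow> real^'n::finite^'n"
  assumes "\<And>i j. Ck_on k S (\<lambda>x. A x $ i $ j)" "\<And>i. Ck_on k S (\<lambda>x. b x $ i)"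
    and det: "\<And>x. x \<in> S \<Longrightarrow> det (A x) \<noteq> 0" and sol: "\<And>x. x \<in> S \<Longrightarrow> A x *v y x = b x"
  shows "Ck_on k S y"
proof (rule Ck_on_vec)
  fix m
  have "Ck_on k S (\<lambda>x. det (\<chi> i j. if j = m then b x $ i else A x $ i $ j) / det (A x))"
    proof (intro Ck_on_divide Ck_on_det)
    show "Ck_on k S (\<lambda>x. (\<chi> i j. if j = m then b x $ i else A x $ i $ j) $ i $ j)" for i j
      using assms(1,2) by (cases "j = m") auto
  qed (use assms(1) det in auto)
  moreover have "y x $ m = det (\<chi> i j. if j = m then b x $ i else A x $ i $ j) / det (A x)"
    if "x \<in> S" for x
    using cramer[OF det[OF that], of "y x" "b x"] sol[OF that] by simp
  ultimately show "Ck_on k S (\<lambda>x. y x $ m)"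
    by (auto intro: Ck_on_cong)
qed

subsection \<open>Derivatives within a set and localization\<close>

text \<open>Derivatives within a thick set are unique.\<close>

definition thick :: "'a::euclidean_space set \<Rightarrow> bool" where
  "thick S \<longleftrightarrow> (\<forall>x\<in>S. \<forall>i\<in>Basis. \<forall>e>0. \<exists>d. 0 < \<bar>d\<bar> \<and> \<bar>d\<bar> < e \<and> x + d *\<^sub>R i \<in> S)"

definition pder :: "'a::euclidean_space set \<Rightarrow> 'a \<Rightarrow> ('a \<Rightarrow> 'b::real_normed_vector) \<Rightarrow> 'a \<Rightarrow> 'b" where
  "pder S v f x = frechet_derivative f (at x within S) v"

lemma thick_open:
  fixes S :: "'a::euclidean_space set"
  assumes "open S" shows "thick S"
  unfolding thick_def
proof (intro ballI allI impI)
  fix x i :: 'a and e :: real assume "x \<in> S" and i: "i \<in> Basis" and "0 < e"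
  then obtain r where r: "r > 0" "ball x r \<subseteq> S"
    using assms open_contains_ball by blast
  define d where "d = min e r / 2"
  have "x + d *\<^sub>R i \<in> ball x r"
    using i r \<open>0 < e\<close> by (simp add: dist_norm d_def)
  then show "\<exists>d. 0 < \<bar>d\<bar> \<and> \<bar>d\<bar> < e \<and> x + d *\<^sub>R i \<in> S"
    using r \<open>0 < e\<close> by (intro exI[of _ d]) (auto simp: d_def)
qed

lemma thick_unique:
  assumes "thick S" "x \<in> S" "(f has_derivative f') (at x within S)"
    "(f has_derivative f'') (at x within S)"
  shows "f' = f''"
  using assms by (intro frechet_derivative_unique_within[OF assms(3,4)]) (auto simp: thick_def)

lemma thick_frechet:
  assumes "thick S" "x \<in> S" "(f has_derivative f') (at x within S)"
  shows "frechet_derivative f (at x within S) = f'"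
  using assms thick_unique frechet_derivative_works by (metis differentiableI)

lemma pder_eq:
  assumes "thick S" "x \<in> S" "(f has_derivative f') (at x within S)"
  shows "pder S v f x = f' v"
  using thick_frechet[OF assms] by (simp add: pder_def)

text \<open>Replaces the existential derivative in \<open>Ck_on\<close> by the canonical
  \<open>pder\<close>, which can be iterated and commuted; the two agree because derivatives within
  a thick set are unique.\<close>

lemma Ck_on_pder:
  assumes "thick S" "Ck_on (Suc k) S f"
  shows "Ck_on k S (pder S v f)"
    and "x \<in> S \<Longrightarrow> (f has_derivative (\<lambda>v. pder S v f x)) (at x within S)"
proof -
  obtain f' where f': "\<forall>x\<in>S. (f has_derivative f' x) (at x within S)"
      "\<forall>v. Ck_on k S (\<lambda>x. f' x v)"
    using assms by auto
  have eq: "f' x v = pder S v f x" if "x \<in> S" for x v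
    using pder_eq[OF assms(1) that] f' that by metis
  then show "Ck_on k S (pder S v f)"
    using Ck_on_cong[OF f'(2)[rule_format, of v]] by auto
  show "(f has_derivative (\<lambda>v. pder S v f x)) (at x within S)" if "x \<in> S"
    using f'(1) that eq[OF that] by (metis (full_types) ext)
qed

lemma at_within_Int_openin:
  assumes "open V" "x \<in> V"
  shows "at x within (S \<inter> V) = at x within S"
  by (rule at_within_nhd[OF assms(2,1)]) auto

lemma thick_Int_open:
  fixes S :: "'a::euclidean_space set"
  assumes "thick S" "open V" shows "thick (S \<inter> V)"
  unfolding thick_def
proof (intro ballI allI impI)
  fix x i :: 'a and e :: real assume x: "x \<in> S \<inter> V" and i: "i \<in> Basis" and "0 < e"
  then obtain r where r: "r > 0" "ball x r \<subseteq> V"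
    using assms(2) open_contains_ball by blast
  then obtain d where d: "0 < \<bar>d\<bar>" "\<bar>d\<bar> < min e r" "x + d *\<^sub>R i \<in> S"
    using assms(1) x i \<open>0 < e\<close> unfolding thick_def by (metis IntE min_less_iff_conj)
  then have "x + d *\<^sub>R i \<in> ball x r"
    using i by (simp add: dist_norm)
  then show "\<exists>d. 0 < \<bar>d\<bar> \<and> \<bar>d\<bar> < e \<and> x + d *\<^sub>R i \<in> S \<inter> V"
    using d r by auto
qed

lemma pder_Int_open:
  assumes "open V" "x \<in> V"
  shows "pder (S \<inter> V) v f x = pder S v f x"
  unfolding pder_def at_within_Int_openin[OF assms] ..

text \<open>Derivatives computed within different neighbourhoods agree by
  \<open>pder_Int_open\<close>, so they glue to one global \<open>pder\<close>, to which the
  induction hypothesis applies.\<close>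

lemma Ck_on_local:
  assumes "thick S" "\<And>x. x \<in> S \<Longrightarrow> \<exists>V. open V \<and> x \<in> V \<and> Ck_on k (S \<inter> V) f"
  shows "Ck_on k S f"
  using assms(2)
proof (induction k arbitrary: f)
  case 0
  have "continuous (at x within S) f" if x: "x \<in> S" for x
  proof -
    obtain V where V: "open V" "x \<in> V" "continuous_on (S \<inter> V) f"
      using 0 x by auto
    then have "continuous (at x within (S \<inter> V)) f"
      using x by (auto simp: continuous_on_eq_continuous_within)
    then show ?thesis
      using at_within_Int_openin[OF V(1,2), of S] by simp
  qed
  then show ?case by (simp add: continuous_on_eq_continuous_within)
next
  case (Suc k)
  have der: "(f has_derivative (\<lambda>v. pder S v f x)) (at x within S)" if "x \<in> S" for x
  proof -
    obtain V where V: "open V" "x \<in> V" "Ck_on (Suc k) (S \<inter> V) f"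
      using Suc.prems \<open>x \<in> S\<close> by blast
    have "(f has_derivative (\<lambda>v. pder (S \<inter> V) v f x)) (at x within S \<inter> V)"
      using Ck_on_pder(2)[OF thick_Int_open[OF assms(1) V(1)] V(3)] V \<open>x \<in> S\<close> by auto
    then show ?thesis
      by (simp add: pder_Int_open[OF V(1,2)] at_within_Int_openin[OF V(1,2)])
  qed
  have "Ck_on k S (\<lambda>x. pder S v f x)" for v
  proof (rule Suc.IH)
    fix x assume x: "x \<in> S"
    then obtain V where V: "open V" "x \<in> V" "Ck_on (Suc k) (S \<inter> V) f"
      using Suc.prems by blast
    then have "Ck_on k (S \<inter> V) (pder (S \<inter> V) v f)"
      using Ck_on_pder(1)[OF thick_Int_open[OF assms(1) V(1)] V(3)] by auto
    then have "Ck_on k (S \<inter> V) (\<lambda>x. pder S v f x)"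
      using pder_Int_open[OF V(1), of _ S v f] by (auto intro: Ck_on_cong)
    then show "\<exists>V. open V \<and> x \<in> V \<and> Ck_on k (S \<inter> V) (\<lambda>x. pder S v f x)"
      using V by blast
  qed
  then show ?case using der unfolding Ck_on.simps
    by (intro exI[of _ "\<lambda>x v. pder S v f x"]) blast
qed

section \<open>Derivatives along lines and symmetry of second derivatives\<close>

lemma line_deriv:
  assumes "(f has_derivative f') (at (x + s *\<^sub>R v))"
  shows "((\<lambda>s. f (x + s *\<^sub>R v)) has_vector_derivative f' v) (at s)"
proof -
  have "((\<lambda>s. f (x + s *\<^sub>R v)) has_derivative (\<lambda>h. f' (h *\<^sub>R v))) (at s)"
    by (rule has_derivative_compose[where f = "\<lambda>s. x + s *\<^sub>R v" and g = f, OF _ assms])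
      (auto intro!: derivative_eq_intros)
  moreover have "f' (h *\<^sub>R v) = h *\<^sub>R f' v" for h
    using has_derivative_linear[OF assms] by (simp add: linear_scale)
  ultimately show ?thesis by (simp add: has_vector_derivative_def)
qed

lemma line_deriv_pder:
  fixes f :: "'a::euclidean_space \<Rightarrow> real"
  assumes "open S" "Ck_on (Suc k) S f" "x + s *\<^sub>R v \<in> S"
  shows "((\<lambda>s. f (x + s *\<^sub>R v)) has_real_derivative pder S v f (x + s *\<^sub>R v)) (at s)"
proof -
  have "(f has_derivative (\<lambda>w. pder S w f (x + s *\<^sub>R v))) (at (x + s *\<^sub>R v))"
    using Ck_on_pder(2)[OF thick_open[OF assms(1)] assms(2,3)]
    unfolding at_within_open[OF assms(3,1)] .
  from line_deriv[OF this] show ?thesis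
    by (simp add: has_real_derivative_iff_has_vector_derivative)
qed

text \<open>The mean value theorem twice, once in each direction. The left-hand side is symmetric in
  \<open>v\<close> and \<open>w\<close> while the right-hand side is not, and this yields the
  symmetry of second derivatives.\<close>

lemma second_difference:
  fixes f :: "'a::euclidean_space \<Rightarrow> real"
  assumes S: "open S" and f: "Ck_on 2 S f" and h: "0 < h"
    and rect: "\<And>s r. 0 \<le> s \<Longrightarrow> s \<le> h \<Longrightarrow> 0 \<le> r \<Longrightarrow> r \<le> h \<Longrightarrow> x + s *\<^sub>R v + r *\<^sub>R w \<in> S"
  shows "\<exists>s r. 0 < s \<and> s < h \<and> 0 < r \<and> r < h \<and>
    f (x + h *\<^sub>R v + h *\<^sub>R w) - f (x + h *\<^sub>R v) - f (x + h *\<^sub>R w) + f x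
      = h\<^sup>2 * pder S w (pder S v f) (x + s *\<^sub>R v + r *\<^sub>R w)"
proof -
  have f2: "Ck_on (Suc (Suc 0)) S f" using f by (simp add: numeral_2_eq_2)
  define \<phi> where "\<phi> s = f (x + h *\<^sub>R w + s *\<^sub>R v) - f (x + s *\<^sub>R v)" for s
  have 1: "(\<phi> has_real_derivative
      (pder S v f (x + h *\<^sub>R w + s *\<^sub>R v) - pder S v f (x + s *\<^sub>R v))) (at s)"
    if "0 \<le> s" "s \<le> h" for s
    unfolding \<phi>_def using rect[of s h] rect[of s 0] that h
    by (intro DERIV_diff line_deriv_pder[OF S f2]) (auto simp: algebra_simps)
  obtain s where s: "0 < s" "s < h" "\<phi> h - \<phi> 0
      = (h - 0) * (pder S v f (x + h *\<^sub>R w + s *\<^sub>R v) - pder S v f (x + s *\<^sub>R v))"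
    using MVT2[OF h 1] by auto
  have 2: "((\<lambda>r. pder S v f (x + s *\<^sub>R v + r *\<^sub>R w)) has_real_derivative
      pder S w (pder S v f) (x + s *\<^sub>R v + r *\<^sub>R w)) (at r)" if "0 \<le> r" "r \<le> h" for r
    using rect[of s r] that s by (intro line_deriv_pder[OF S Ck_on_pder(1)[OF thick_open[OF S] f2]]) auto
  obtain r where r: "0 < r" "r < h" "pder S v f (x + s *\<^sub>R v + h *\<^sub>R w) - pder S v f (x + s *\<^sub>R v + 0 *\<^sub>R w)
      = (h - 0) * pder S w (pder S v f) (x + s *\<^sub>R v + r *\<^sub>R w)"
    using MVT2[OF h 2] by auto
  show ?thesis
    using s r by (intro exI[of _ s] exI[of _ r]) (auto simp: \<phi>_def algebra_simps power2_eq_square)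
qed

lemma pder_commute:
  fixes f :: "'a::euclidean_space \<Rightarrow> real"
  assumes S: "open S" and f: "Ck_on 2 S f" and x: "x \<in> S"
  shows "pder S v (pder S w f) x = pder S w (pder S v f) x"
proof (rule ccontr)
  let ?a = "pder S v (pder S w f)" and ?b = "pder S w (pder S v f)"
  assume ne: "?a x \<noteq> ?b x"
  define e where "e = \<bar>?a x - ?b x\<bar> / 2"
  have "e > 0" using ne by (simp add: e_def)
  have f2: "Ck_on (Suc (Suc 0)) S f" using f by (simp add: numeral_2_eq_2)
  have "continuous_on S ?a" "continuous_on S ?b"
    by (intro Ck_on_imp_continuous_on[of 0] Ck_on_pder(1)[OF thick_open[OF S]] f2)+
  then have "continuous (at x) ?a" "continuous (at x) ?b"
    using x S by (simp_all add: continuous_on_eq_continuous_at)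
  then obtain d1 d2 where d: "d1 > 0" "\<And>y. dist y x < d1 \<Longrightarrow> dist (?a y) (?a x) < e"
      "d2 > 0" "\<And>y. dist y x < d2 \<Longrightarrow> dist (?b y) (?b x) < e"
    using \<open>e > 0\<close> unfolding continuous_at_eps_delta by metis
  obtain d3 where d3: "d3 > 0" "ball x d3 \<subseteq> S"
    using S x open_contains_ball by blast
  define d0 where "d0 = min d1 (min d2 d3)"
  \<comment> \<open>Small enough that the whole parallelogram spanned by h v and h w lies within
    distance \<open>d0\<close> of \<open>x\<close>; the summand 1 keeps the denominator positive
    when both directions vanish.\<close>
  define h where "h = d0 / (2 * (norm v + norm w + 1))"
  have d0: "d0 > 0" using d d3 by (simp add: d0_def)
  have nv: "norm v + norm w + 1 > 0" by (simp add: add_nonneg_pos)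
  then have h: "h > 0" using d0 by (simp add: h_def)
  have near: "dist (x + s *\<^sub>R v + r *\<^sub>R w) x < d0" if "0 \<le> s" "s \<le> h" "0 \<le> r" "r \<le> h" for s r
  proof -
    have "dist (x + s *\<^sub>R v + r *\<^sub>R w) x = norm (s *\<^sub>R v + r *\<^sub>R w)"
      by (simp add: dist_norm)
    also have "\<dots> \<le> s * norm v + r * norm w"
      using norm_triangle_ineq[of "s *\<^sub>R v" "r *\<^sub>R w"] that by simp
    also have "\<dots> \<le> h * norm v + h * norm w"
      using that by (intro add_mono mult_right_mono) auto
    also have "\<dots> \<le> h * (norm v + norm w + 1)"
      using h by (simp add: algebra_simps)
    also have "\<dots> = d0 / 2" using nv by (simp add: h_def field_simps)
    also have "\<dots> < d0" using d0 by simp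
    finally show ?thesis .
  qed
  have "x + s *\<^sub>R v + r *\<^sub>R w \<in> S" if "0 \<le> s" "s \<le> h" "0 \<le> r" "r \<le> h" for s r
    using near[OF that] d3(2) by (auto simp: d0_def dist_commute)
  then obtain s r where 1: "0 < s" "s < h" "0 < r" "r < h"
    "f (x + h *\<^sub>R v + h *\<^sub>R w) - f (x + h *\<^sub>R v) - f (x + h *\<^sub>R w) + f x
      = h\<^sup>2 * ?b (x + s *\<^sub>R v + r *\<^sub>R w)"
    using second_difference[OF S f h, of x v w] by auto
  have "x + s *\<^sub>R w + r *\<^sub>R v \<in> S" if "0 \<le> s" "s \<le> h" "0 \<le> r" "r \<le> h" for s r
    using near[OF that(3,4,1,2)] d3(2) by (auto simp: d0_def dist_commute algebra_simps)
  then obtain s' r' where 2: "0 < s'" "s' < h" "0 < r'" "r' < h"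
    "f (x + h *\<^sub>R w + h *\<^sub>R v) - f (x + h *\<^sub>R w) - f (x + h *\<^sub>R v) + f x
      = h\<^sup>2 * ?a (x + s' *\<^sub>R w + r' *\<^sub>R v)"
    using second_difference[OF S f h, of x w v] by auto
  have "h\<^sup>2 * ?b (x + s *\<^sub>R v + r *\<^sub>R w) = h\<^sup>2 * ?a (x + s' *\<^sub>R w + r' *\<^sub>R v)"
    using 1(5) 2(5) by (simp add: algebra_simps)
  then have "?b (x + s *\<^sub>R v + r *\<^sub>R w) = ?a (x + s' *\<^sub>R w + r' *\<^sub>R v)"
    using h by simp
  moreover have "dist (?b (x + s *\<^sub>R v + r *\<^sub>R w)) (?b x) < e"
    using near[of s r] 1 by (intro d) (auto simp: d0_def)
  moreover have "dist (?a (x + s' *\<^sub>R w + r' *\<^sub>R v)) (?a x) < e"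
    using near[of r' s'] 2 by (intro d) (auto simp: d0_def algebra_simps)
  ultimately show False
    unfolding e_def dist_real_def by argo
qed

subsection \<open>Inverse maps\<close>

text \<open>The image of \<open>S\<close> need not be open. Continuity of \<open>g\<close> brings
  nearby values back to nearby points, and the left inverse \<open>g'\<close> of the derivative
  bounds the increment of the argument by that of the value.\<close>

lemma has_derivative_inverse_within:
  fixes f :: "'a::real_normed_vector \<Rightarrow> 'b::real_normed_vector"
  assumes f: "(f has_derivative f') (at x within S)" and x: "x \<in> S"
    and gf: "\<And>z. z \<in> S \<Longrightarrow> g (f z) = z"
    and g: "continuous (at (f x) within f ` S) g"
    and g': "bounded_linear g'" "\<And>v. g' (f' v) = v"
  shows "(g has_derivative g') (at (f x) within f ` S)"
  unfolding has_derivative_within_alt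
proof (intro conjI allI impI)
  show "bounded_linear g'" by fact
  fix e :: real assume e: "e > 0"
  obtain B where B: "B > 0" "\<And>v. norm (g' v) \<le> norm v * B"
    using bounded_linear.pos_bounded[OF g'(1)] by blast
  \<comment> \<open>The first bound makes B e1 \<le> 1/2, so the remainder can be absorbed to give
    |z - x| \<le> 2 B |f z - f x|; the second turns this into the error e.\<close>
  define e1 where "e1 = min (1 / (2 * B)) (e / (2 * B\<^sup>2))"
  have e1: "e1 > 0" "B * e1 \<le> 1/2" "2 * B\<^sup>2 * e1 \<le> e"
    using B e by (auto simp: e1_def min_def field_simps power2_eq_square)
  obtain d1 where d1: "d1 > 0" "\<And>z. z \<in> S \<Longrightarrow> norm (z - x) < d1 \<Longrightarrow>
      norm (f z - f x - f' (z - x)) \<le> e1 * norm (z - x)"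
    using f e1(1) unfolding has_derivative_within_alt by blast
  obtain d where d: "d > 0" "\<And>y. y \<in> f ` S \<Longrightarrow> dist y (f x) < d \<Longrightarrow> dist (g y) (g (f x)) < d1"
    using g d1(1) unfolding continuous_within_eps_delta by blast
  show "\<exists>d>0. \<forall>y\<in>f ` S. norm (y - f x) < d \<longrightarrow>
      norm (g y - g (f x) - g' (y - f x)) \<le> e * norm (y - f x)"
  proof (intro exI[of _ d] conjI d(1) ballI impI)
    fix y assume y: "y \<in> f ` S" "norm (y - f x) < d"
    then obtain z where z: "z \<in> S" "y = f z" by blast
    have zx: "norm (z - x) < d1"
      using d(2)[OF y(1)] y(2) z gf x by (simp add: dist_norm)
    let ?r = "f z - f x - f' (z - x)"
    have r: "norm ?r \<le> e1 * norm (z - x)" using d1(2)[OF z(1) zx] .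
    have lin: "g' ?r = g' (f z - f x) - (z - x)"
      using bounded_linear.linear[OF g'(1)] by (simp add: linear_diff g'(2))
    have br: "norm (g' ?r) \<le> e1 * norm (z - x) * B"
      using B(2)[of ?r] r B(1) by (meson mult_right_mono order_trans less_imp_le)
    have "norm (z - x) \<le> norm (g' (f z - f x)) + norm (g' ?r)"
      unfolding lin by (metis add_diff_cancel_right' diff_add_cancel norm_triangle_ineq4
          norm_minus_commute add_diff_cancel_left')
    also have "\<dots> \<le> norm (f z - f x) * B + (B * e1) * norm (z - x)"
      using B(2)[of "f z - f x"] br by (simp add: mult.commute mult.left_commute)
    also have "\<dots> \<le> norm (f z - f x) * B + (1/2) * norm (z - x)"
      using e1(2) by (intro add_left_mono mult_right_mono) auto
    finally have zb: "norm (z - x) \<le> 2 * B * norm (f z - f x)" by (simp add: algebra_simps)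
    have "norm (g y - g (f x) - g' (y - f x)) = norm (g' ?r)"
      unfolding lin z(2) gf[OF z(1)] gf[OF x] by (rule norm_minus_commute)
    also have "\<dots> \<le> (e1 * B) * norm (z - x)" using br by (simp add: ac_simps)
    also have "\<dots> \<le> (e1 * B) * (2 * B * norm (f z - f x))"
      using zb e1(1) B(1) by (intro mult_left_mono) auto
    also have "\<dots> = (2 * B\<^sup>2 * e1) * norm (f z - f x)" by (simp add: power2_eq_square)
    also have "\<dots> \<le> e * norm (f z - f x)" using e1(3) by (intro mult_right_mono) auto
    finally show "norm (g y - g (f x) - g' (y - f x)) \<le> e * norm (y - f x)"
      using z by simp
  qed
qed

lemma matrix_inv_mult:
  fixes A :: "real^'n^'n::finite"
  assumes "det A \<noteq> 0"
  shows "A ** matrix_inv A = mat 1" and "matrix_inv A ** A = mat 1"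
proof -
  have "\<exists>A'. A ** A' = mat 1 \<and> A' ** A = mat 1"
    using assms by (simp add: invertible_det_nz flip: invertible_def)
  then have "A ** matrix_inv A = mat 1 \<and> matrix_inv A ** A = mat 1"
    unfolding matrix_inv_def by (rule someI_ex)
  then show "A ** matrix_inv A = mat 1" "matrix_inv A ** A = mat 1" by auto
qed

text \<open>Because time is a coordinate on both sides, only the spatial block of the derivative of
  \<open>a\<close> has to be invertible. The derivative of the inverse solves a linear system whose
  coefficients are derivatives of \<open>a\<close> at \<open>g y\<close>; hence C^j regularity of
  \<open>g\<close> passes to its derivative, and regularity climbs one order at a time.\<close>

lemma Ck_on_inverse_fibred:
  fixes a :: "(real^'n::finite) \<times> real \<Rightarrow> real^'n" and S :: "((real^'n) \<times> real) set"
  defines "\<Phi> \<equiv> \<lambda>z. (a z, snd z)"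
  assumes a: "Ck_on k S a" and k: "k \<ge> 1"
    and a': "\<And>z. z \<in> S \<Longrightarrow> (a has_derivative a' z) (at z within S)"
    and a'C: "\<And>v. k \<ge> 1 \<Longrightarrow> Ck_on (k - 1) S (\<lambda>z. a' z v)"
    and inj: "\<And>z v. z \<in> S \<Longrightarrow> a' z (v, 0) = 0 \<Longrightarrow> v = 0"
    and g: "\<And>z. z \<in> S \<Longrightarrow> g (\<Phi> z) = z" "continuous_on (\<Phi> ` S) g"
  shows "Ck_on k (\<Phi> ` S) g"
proof -
  define A where "A z = matrix (\<lambda>v. a' z (v, 0))" for z
  have lin: "linear (a' z)" if "z \<in> S" for z
    using a'[OF that] has_derivative_linear by blast
  have lin0: "linear (\<lambda>v. a' z (v, 0))" if "z \<in> S" for z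
  proof -
    have "linear (\<lambda>v::real^'n. (v, 0::real))"
      by (auto intro!: linearI)
    from linear_compose[OF this lin[OF that]] show ?thesis by (simp add: o_def)
  qed
  have Av: "A z *v v = a' z (v, 0)" if "z \<in> S" for z v
    unfolding A_def
    by (rule matrix_works) (simp add: linear_matrix_vector_mul_eq lin0[OF that])
  have detA: "det (A z) \<noteq> 0" if "z \<in> S" for z
  proof -
    have "inj ((*v) (A z))"
      using inj[OF that] Av[OF that] by (auto simp: linear_injective_0)
    then show ?thesis
      using det_nz_iff_inj[OF matrix_vector_mul_linear[of "A z"]] by simp
  qed
  \<comment> \<open>The block-triangular inverse: time is copied, and the spatial part solves a
    system with matrix A after the contribution of the time component has been subtracted.\<close>
  define h where "h y w = (matrix_inv (A (g y)) *v (fst w - a' (g y) (0, snd w)), snd w)"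
    for y w
  have invA: "matrix_inv (A z) ** A z = mat 1" "A z ** matrix_inv (A z) = mat 1" if "z \<in> S" for z
    using matrix_inv_mult[OF detA[OF that]] by auto
  have \<Phi>': "(\<Phi> has_derivative (\<lambda>v. (a' z v, snd v))) (at z within S)" if "z \<in> S" for z
    unfolding \<Phi>_def using a'[OF that] by (auto intro!: derivative_eq_intros)
  have hlin: "bounded_linear (h (\<Phi> z))" if "z \<in> S" for z
  proof -
    have 1: "bounded_linear (\<lambda>w. (0::real^'n, snd w)::(real^'n) \<times> real)"
      by (intro bounded_linear_Pair bounded_linear_zero bounded_linear_snd)
    have "bounded_linear (\<lambda>w. a' z (0, snd w))"
      using bounded_linear_compose[OF has_derivative_bounded_linear[OF a'[OF that]] 1] .
    then have "bounded_linear (\<lambda>w. fst w - a' z (0, snd w))"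
      by (rule bounded_linear_sub[OF bounded_linear_fst])
    from bounded_linear_Pair[OF bounded_linear_compose[OF matrix_vector_mul_bounded_linear this]
        bounded_linear_snd]
    show ?thesis unfolding h_def g(1)[OF that] .
  qed
  have split: "a' z v = a' z (fst v, 0) + a' z (0, snd v)" if "z \<in> S" for z v
    using linear_add[OF lin[OF that], of "(fst v, 0)" "(0, snd v)"] by simp
  have der: "(g has_derivative h (\<Phi> z)) (at (\<Phi> z) within \<Phi> ` S)" if "z \<in> S" for z
  proof (rule has_derivative_inverse_within[OF \<Phi>'[OF that] that g(1)])
    show "continuous (at (\<Phi> z) within \<Phi> ` S) g"
      using g(2) that by (auto simp: continuous_on_eq_continuous_within)
    show "bounded_linear (h (\<Phi> z))"
      using hlin[OF that] .
    show "h (\<Phi> z) (a' z v, snd v) = v" for v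
    proof -
      have "matrix_inv (A z) *v a' z (fst v, 0) = fst v"
        unfolding Av[OF that, symmetric] by (simp add: invA(1)[OF that] matrix_vector_mul_assoc)
      then show ?thesis
        unfolding h_def g(1)[OF that] using split[OF that, of v] by simp
    qed
  qed
  have "Ck_on j (\<Phi> ` S) g" if "j \<le> k" for j
    using that
  proof (induction j)
    case 0
    then show ?case using g(2) by simp
  next
    case (Suc j)
    have gj: "Ck_on j (\<Phi> ` S) g" using Suc by simp
    have aj: "Ck_on j (\<Phi> ` S) (\<lambda>y. a' (g y) v)" for v
      using Suc.prems k
      by (intro Ck_on_compose[OF Ck_on_le[OF a'C] gj]) (auto simp: g(1))
    have ent: "Ck_on j (\<Phi> ` S) (\<lambda>y. A (g y) $ i $ l)" for i l
      unfolding A_def matrix_def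
      using Ck_on_linear_compose[OF bounded_linear_vec_nth[of i] aj[of "(axis l 1, 0)"]] by simp
    have "Ck_on j (\<Phi> ` S) (\<lambda>y. h y w)" for w
      unfolding h_def
    proof (rule Ck_on_Pair[OF Ck_on_solve[OF ent] Ck_on_const])
      show "Ck_on j (\<Phi> ` S) (\<lambda>y. (fst w - a' (g y) (0, snd w)) $ i)" for i
      proof -
        have "Ck_on j (\<Phi> ` S) (\<lambda>y. fst w + (-1) *\<^sub>R a' (g y) (0, snd w))"
          by (intro Ck_on_add Ck_on_const Ck_on_scaleR aj)
        from Ck_on_linear_compose[OF bounded_linear_vec_nth[of i] this]
        show ?thesis by simp
      qed
      show "det (A (g y)) \<noteq> 0" if "y \<in> \<Phi> ` S" for y
        using that detA g(1) by auto
      show "A (g y) *v (matrix_inv (A (g y)) *v (fst w - a' (g y) (0, snd w)))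
          = fst w - a' (g y) (0, snd w)" if "y \<in> \<Phi> ` S" for y
        using that by (auto simp: g(1) matrix_vector_mul_assoc invA(2))
    qed
    moreover have "\<forall>y\<in>\<Phi> ` S. (g has_derivative h y) (at y within \<Phi> ` S)"
      using der by blast
    ultimately show ?case unfolding Ck_on.simps by blast
  qed
  then show ?thesis by simp
qed

subsection \<open>Symmetric matrices\<close>

text \<open>For small s of the sign of c the linear term wins; s = c/b with b = |d| + 1 is small
  enough.\<close>

lemma quadratic_nonpos_imp_zero:
  fixes c d :: real
  assumes "\<And>s. 2 * s * c + s\<^sup>2 * d \<le> 0"
  shows "c = 0"
proof (rule ccontr)
  assume c: "c \<noteq> 0"
  define b where "b = \<bar>d\<bar> + 1"
  have b: "b > 0" "- d < b" by (auto simp: b_def)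
  have "2 * (c / b) * c + (c / b)\<^sup>2 * d = c\<^sup>2 / b\<^sup>2 * (2 * b + d)"
    using b(1) by (simp add: field_simps power2_eq_square)
  moreover have "c\<^sup>2 / b\<^sup>2 * (2 * b + d) > 0"
    using b c by (intro mult_pos_pos) auto
  ultimately show False using assms[of "c / b"] by linarith
qed

text \<open>A null vector minimizes the quadratic form on \<open>S\<close>, so the first variation
  in every direction \<open>w\<close> vanishes.\<close>

lemma semidefinite_null_vector:
  fixes f :: "'a::real_inner \<Rightarrow> 'a"
  assumes f: "linear f" and sym: "\<And>x y. x \<in> S \<Longrightarrow> y \<in> S \<Longrightarrow> f x \<bullet> y = x \<bullet> f y"
    and S: "subspace S" and nonneg: "\<And>x. x \<in> S \<Longrightarrow> f x \<bullet> x \<ge> 0"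
    and e: "e \<in> S" "f e \<bullet> e = 0" and w: "w \<in> S"
  shows "f e \<bullet> w = 0"
proof -
  have "2 * s * (- (f e \<bullet> w)) + s\<^sup>2 * (- (f w \<bullet> w)) \<le> 0" for s
  proof -
    have "f (e + s *\<^sub>R w) \<bullet> (e + s *\<^sub>R w) \<ge> 0"
      using S e w by (intro nonneg) (auto intro: subspace_add subspace_scale)
    moreover have "f w \<bullet> e = f e \<bullet> w" using sym[OF w e(1)] by (simp add: inner_commute)
    ultimately show ?thesis using f e(2)
      by (simp add: linear_add linear_scale inner_add_left inner_add_right power2_eq_square algebra_simps)
  qed
  then have "- (f e \<bullet> w) = 0" by (rule quadratic_nonpos_imp_zero)
  then show ?thesis by simp
qed

text \<open>With m the minimum of the quadratic form over the unit sphere of \<open>S\<close>, the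
  map f - m is semidefinite on \<open>S\<close> and has a null vector e. Invariance of
  \<open>S\<close> allows f e - m e itself as test direction, and its norm is then zero.\<close>

lemma self_adjoint_eigenvector:
  fixes f :: "'a::euclidean_space \<Rightarrow> 'a"
  assumes f: "linear f" and sym: "\<And>x y. f x \<bullet> y = x \<bullet> f y"
    and S: "subspace S" "f ` S \<subseteq> S" "S \<noteq> {0}"
  obtains e m where "e \<in> S" "norm e = 1" "f e = m *\<^sub>R e"
proof -
  obtain x where x: "x \<in> S" "x \<noteq> 0"
    using S subspace_0 by blast
  have "compact (S \<inter> sphere 0 1)"
    using closed_subspace[OF S(1)] by (simp add: closed_Int_compact)
  moreover have "x /\<^sub>R norm x \<in> S \<inter> sphere 0 1"
    using x S(1) by (simp add: subspace_scale)
  moreover have "continuous_on (S \<inter> sphere 0 1) (\<lambda>x. f x \<bullet> x)"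
    using f by (intro continuous_intros linear_continuous_on) (simp add: linear_conv_bounded_linear)
  ultimately obtain e where e: "e \<in> S \<inter> sphere 0 1"
      "\<And>y. y \<in> S \<inter> sphere 0 1 \<Longrightarrow> f e \<bullet> e \<le> f y \<bullet> y"
    using continuous_attains_inf[of "S \<inter> sphere 0 1" "\<lambda>x. f x \<bullet> x"] by blast
  define m where "m = f e \<bullet> e"
  define h where "h x = f x - m *\<^sub>R x" for x
  have eS: "e \<in> S" and ne: "norm e = 1" using e by auto
  have h: "linear h"
    unfolding h_def using f by (intro linear_compose_sub) (auto intro!: linearI simp: algebra_simps)
  have nonneg: "h y \<bullet> y \<ge> 0" if y: "y \<in> S" for y
  proof (cases "y = 0")
    case False
    then have "y /\<^sub>R norm y \<in> S \<inter> sphere 0 1"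
      using y S(1) by (simp add: subspace_scale)
    then have "m \<le> f (y /\<^sub>R norm y) \<bullet> (y /\<^sub>R norm y)"
      using e m_def by blast
    also have "\<dots> = f y \<bullet> y / (norm y)\<^sup>2"
      using f by (simp add: linear_scale power2_eq_square divide_inverse)
    finally show ?thesis
      using False by (simp add: h_def field_simps inner_diff_left power2_norm_eq_inner)
  qed (use h in \<open>simp add: linear_0\<close>)
  have hS: "h e \<in> S"
    unfolding h_def using S eS by (meson image_subset_iff subspace_diff subspace_scale)
  have "h e \<bullet> h e = 0"
  proof (rule semidefinite_null_vector[OF h _ S(1) nonneg eS _ hS])
    show "h x \<bullet> y = x \<bullet> h y" for x y
      by (simp add: h_def inner_diff_left inner_diff_right sym)
    show "h e \<bullet> e = 0"
      using ne by (simp add: h_def inner_diff_left m_def flip: power2_norm_eq_inner)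
  qed
  then have "f e = m *\<^sub>R e" by (simp add: h_def)
  then show thesis using that eS ne by blast
qed

text \<open>Stated for every invariant subspace so that the induction on the dimension can pass to
  the orthogonal complement of one eigenvector.\<close>

lemma self_adjoint_eigenbasis:
  fixes f :: "'a::euclidean_space \<Rightarrow> 'a"
  assumes f: "linear f" and sym: "\<And>x y. f x \<bullet> y = x \<bullet> f y"
  shows "subspace S \<Longrightarrow> f ` S \<subseteq> S \<Longrightarrow> \<exists>B. B \<subseteq> S \<and> pairwise orthogonal B \<and> span B = S \<and>
    (\<forall>b\<in>B. norm b = 1 \<and> (\<exists>m. f b = m *\<^sub>R b))"
proof (induction "dim S" arbitrary: S rule: less_induct)
  case less
  show ?case
  proof (cases "S = {0}")
    case True
    then show ?thesis by (intro exI[of _ "{}"]) auto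
  next
    case False
    obtain e m where e: "e \<in> S" "norm e = 1" "f e = m *\<^sub>R e"
      using self_adjoint_eigenvector[OF f sym less.prems False] by blast
    define R where "R = S \<inter> {x. e \<bullet> x = 0}"
    have R: "subspace R"
      unfolding R_def by (intro subspace_inter less.prems subspace_hyperplane)
    have fR: "f ` R \<subseteq> R"
      using less.prems(2) sym[of _ e] e(3) by (auto simp: R_def inner_commute)
    have "R \<subset> S"
    proof (intro psubsetI)
      show "R \<subseteq> S" by (auto simp: R_def)
      have "e \<bullet> e = 1" using e(2) by (simp flip: power2_norm_eq_inner)
      then have "e \<notin> R" by (simp add: R_def)
      then show "R \<noteq> S" using e(1) by blast
    qed
    then have "dim R < dim S"
      using R less.prems(1) by (metis dim_psubset span_eq_iff)
    then obtain B where B: "B \<subseteq> R" "pairwise orthogonal B" "span B = R"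
        "\<forall>b\<in>B. norm b = 1 \<and> (\<exists>m. f b = m *\<^sub>R b)"
      using less.hyps[OF _ R fR] by blast
    have "pairwise orthogonal (insert e B)"
      using B by (auto simp: pairwise_insert orthogonal_def R_def inner_commute)
    moreover have "S \<subseteq> span (insert e B)"
    proof
      fix x assume x: "x \<in> S"
      have "x - (e \<bullet> x) *\<^sub>R e \<in> R"
        using x e less.prems(1) by (auto simp: R_def inner_diff_right subspace_diff subspace_scale
            power2_norm_eq_inner[symmetric] simp flip: power2_norm_eq_inner)
      then show "x \<in> span (insert e B)"
        using B(3) span_breakdown_eq by blast
    qed
    moreover have "span (insert e B) \<subseteq> S"
      using B(1) e(1) less.prems(1) by (intro span_minimal) (auto simp: R_def)
    ultimately show ?thesis using B e
      by (intro exI[of _ "insert e B"]) (auto simp: R_def)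
  qed
qed

text \<open>The eigenbasis is indexed by the coordinate type itself, so that traces and determinants
  become sums and products over \<open>UNIV\<close>.\<close>

lemma symmetric_matrix_eigenbasis:
  fixes A :: "real^'n::finite^'n"
  assumes "transpose A = A"
  obtains e :: "'n \<Rightarrow> real^'n" and m where "\<And>i j. e i \<bullet> e j = (if i = j then 1 else 0)"
    "\<And>i. A *v e i = m i *\<^sub>R e i"
proof -
  have "(A *v x) \<bullet> y = x \<bullet> (A *v y)" for x y
    using dot_lmul_matrix[of x A y] assms by (metis inner_commute transpose_matrix_vector)
  then obtain B where B: "pairwise orthogonal B" "span B = (UNIV :: (real^'n) set)"
      "\<forall>b\<in>B. norm b = 1 \<and> (\<exists>m. A *v b = m *\<^sub>R b)"
    using self_adjoint_eigenbasis[of "(*v) A" UNIV] by auto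
  have "0 \<notin> B" using B(3) by auto
  then have "independent B" using B(1) pairwise_orthogonal_independent by blast
  then have "card B = CARD('n)" "finite B"
    using B(2) by (metis dim_span_eq_card_independent dim_UNIV DIM_cart DIM_real mult.right_neutral,
        metis independent_imp_finite)
  then obtain e :: "'n \<Rightarrow> real^'n" where e: "bij_betw e UNIV B"
    by (metis finite_same_card_bij finite_class.finite_UNIV)
  then have eB: "e i \<in> B" for i by (auto simp: bij_betw_def)
  then have "\<forall>i. \<exists>m. A *v e i = m *\<^sub>R e i" using B(3) by blast
  then obtain m where m: "\<And>i. A *v e i = m i *\<^sub>R e i"
    using choice[of "\<lambda>i m. A *v e i = m *\<^sub>R e i"] by blast
  have "e i \<bullet> e j = (if i = j then 1 else 0)" for i j
  proof (cases "i = j")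
    case True
    then show ?thesis using B(3) eB[of j] by (auto simp flip: power2_norm_eq_inner)
  next
    case False
    then have "e i \<noteq> e j" using e by (auto simp: bij_betw_def inj_def)
    then show ?thesis using B(1) eB False by (auto simp: pairwise_def orthogonal_def)
  qed
  then show thesis using that m by blast
qed

section \<open>Determinants and their derivatives in an orthonormal eigenbasis\<close>

lemma det_conjugate_orthonormal:
  fixes A :: "real^'n::finite^'n" and e :: "'n \<Rightarrow> real^'n"
  assumes e: "\<And>i j. e i \<bullet> e j = (if i = j then 1 else 0)"
  shows "det (\<chi> i j. e i \<bullet> (A *v e j)) = det A"
proof -
  define R where "R = (\<chi> i j. e i $ j)"
  have row: "row i R = e i" "column i (transpose R) = e i" for i
    by (simp_all add: R_def row_def column_def transpose_def vec_eq_iff)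
  have "R ** transpose R = mat 1"
    by (simp add: vec_eq_iff matrix_matrix_mult_def transpose_def R_def mat_def inner_vec_def
        flip: e)
  then have d: "det R * det (transpose R) = 1"
    by (metis det_mul det_I)
  have "(\<chi> i j. e i \<bullet> (A *v e j)) = R ** (A ** transpose R)"
    by (simp add: vec_eq_iff R_def matrix_matrix_mult_def transpose_def inner_vec_def
        matrix_vector_mult_def)
  then show ?thesis using d by (simp add: det_mul)
qed

lemma det_eigenbasis:
  fixes A :: "real^'n::finite^'n" and e :: "'n \<Rightarrow> real^'n"
  assumes e: "\<And>i j. e i \<bullet> e j = (if i = j then 1 else 0)"
    and m: "\<And>i. A *v e i = m i *\<^sub>R e i"
  shows "det A = (\<Prod>i\<in>UNIV. m i)"
proof -
  have "det A = det (\<chi> i j. e i \<bullet> (A *v e j))"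
    using det_conjugate_orthonormal[OF e] by simp
  also have "\<dots> = (\<Prod>i\<in>UNIV. m i)"
    by (subst det_diagonal) (auto simp: m e)
  finally show ?thesis .
qed

text \<open>A permutation other than the identity moves at least two indices, so at a diagonal matrix its
  product vanishes to second order.\<close>

lemma has_real_derivative_det_diagonal:
  fixes C :: "real \<Rightarrow> real^'n::finite^'n"
  assumes C: "\<And>i j. ((\<lambda>s. C s $ i $ j) has_real_derivative C' i j) (at x)"
    and diag: "\<And>i j. i \<noteq> j \<Longrightarrow> C x $ i $ j = 0" and nz: "\<And>i. C x $ i $ i \<noteq> 0"
  shows "((\<lambda>s. det (C s)) has_real_derivative
    (\<Prod>i\<in>UNIV. C x $ i $ i) * (\<Sum>i\<in>UNIV. C' i i / C x $ i $ i)) (at x)"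
proof -
  let ?P = "{p. p permutes (UNIV::'n set)}"
  let ?d = "\<lambda>p. \<Sum>i\<in>UNIV. C' i (p i) * (\<Prod>j\<in>UNIV - {i}. C x $ j $ p j)"
  have "((\<lambda>s. det (C s)) has_real_derivative (\<Sum>p\<in>?P. of_int (sign p) * ?d p)) (at x)"
    unfolding det_def by (intro DERIV_sum DERIV_cmult has_field_derivative_prod C)
  moreover have "?d p = 0" if p: "p \<in> ?P - {id}" for p
  proof (rule sum.neutral, intro ballI)
    fix i
    obtain k where k: "p k \<noteq> k" using p by (metis DiffD2 eq_id_iff singletonI)
    have "p (p k) \<noteq> p k" using k p by (metis DiffD1 mem_Collect_eq permutes_inj inj_eq)
    then obtain j where "j \<noteq> i" "p j \<noteq> j" using k by metis
    then have "(\<Prod>j\<in>UNIV - {i}. C x $ j $ p j) = 0"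
      using diag by (intro prod_zero) (auto intro!: bexI[of _ j])
    then show "C' i (p i) * (\<Prod>j\<in>UNIV - {i}. C x $ j $ p j) = 0" by simp
  qed
  then have "(\<Sum>p\<in>?P. of_int (sign p) * ?d p) = (\<Sum>p\<in>{id}. of_int (sign p) * ?d p)"
    by (intro sum.mono_neutral_right) (auto simp: permutes_id finite_permutations)
  moreover have "?d id = (\<Prod>i\<in>UNIV. C x $ i $ i) * (\<Sum>i\<in>UNIV. C' i i / C x $ i $ i)"
  proof -
    have "(\<Prod>j\<in>UNIV - {i}. C x $ j $ j) = (\<Prod>j\<in>UNIV. C x $ j $ j) / C x $ i $ i" for i
      using nz[of i] prod.remove[of UNIV i "\<lambda>j. C x $ j $ j"] by simp
    then show ?thesis by (simp add: sum_distrib_left ac_simps)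
  qed
  ultimately show ?thesis by (simp add: sign_id)
qed

text \<open>Jacobi's formula. Conjugating the whole curve with the eigenbasis frozen at x leaves the
  determinant unchanged and makes the matrix diagonal at x, where only the diagonal entries of the
  derivative survive.\<close>

lemma has_real_derivative_det:
  fixes A :: "real \<Rightarrow> real^'n::finite^'n" and e :: "'n \<Rightarrow> real^'n"
  assumes A: "\<And>i j. ((\<lambda>s. A s $ i $ j) has_real_derivative A' $ i $ j) (at x)"
    and e: "\<And>i j. e i \<bullet> e j = (if i = j then 1 else 0)"
    and m: "\<And>i. A x *v e i = m i *\<^sub>R e i" "\<And>i. m i \<noteq> 0"
  shows "((\<lambda>s. det (A s)) has_real_derivative
    det (A x) * (\<Sum>i\<in>UNIV. (e i \<bullet> (A' *v e i)) / m i)) (at x)"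
proof -
  have "((\<lambda>s. det (\<chi> i j. e i \<bullet> (A s *v e j))) has_real_derivative
    (\<Prod>i\<in>UNIV. (\<chi> i j. e i \<bullet> (A x *v e j)) $ i $ i) *
    (\<Sum>i\<in>UNIV. (e i \<bullet> (A' *v e i)) / (\<chi> i j. e i \<bullet> (A x *v e j)) $ i $ i)) (at x)"
  proof (rule has_real_derivative_det_diagonal[where C' = "\<lambda>i j. e i \<bullet> (A' *v e j)"])
    show "((\<lambda>s. (\<chi> i j. e i \<bullet> (A s *v e j)) $ i $ j) has_real_derivative
        e i \<bullet> (A' *v e j)) (at x)" for i j
      unfolding inner_vec_def matrix_vector_mult_def
      by (auto intro!: derivative_eq_intros A sum.cong simp: ac_simps)
  qed (auto simp: m e)
  then show ?thesis
    unfolding det_conjugate_orthonormal[OF e] by (simp add: m e det_eigenbasis[OF e m(1)])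
qed

lemma orthonormal_expand_inner:
  fixes e :: "'n::finite \<Rightarrow> 'a::real_inner"
  assumes "\<And>i j. e i \<bullet> e j = (if i = j then 1 else 0)"
  shows "e j \<bullet> (\<Sum>i\<in>UNIV. c i *\<^sub>R e i) = c j"
  by (simp add: inner_sum_right assms if_distrib cong: if_cong)

lemma orthonormal_vec_expand:
  fixes e :: "'n::finite \<Rightarrow> real^'n"
  assumes e: "\<And>i j. e i \<bullet> e j = (if i = j then 1 else 0)"
  shows "(\<Sum>i\<in>UNIV. (e i \<bullet> x) *\<^sub>R e i) = x"
proof -
  have inj: "inj e"
  proof (rule injI)
    fix i j assume "e i = e j"
    then show "i = j" using e[of i j] e[of i i] by (auto split: if_splits)
  qed
  have "pairwise orthogonal (range e)" "0 \<notin> range e"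
    using e by (auto simp: pairwise_def orthogonal_def) (metis inner_zero_left zero_neq_one)
  then have ind: "independent (range e)" by (rule pairwise_orthogonal_independent)
  have "card (range e) = DIM(real^'n)" using inj by (simp add: card_image)
  then have "span (range e) = UNIV"
    using ind by (metis dim_eq_full dim_eq_card_independent)
  let ?y = "x - (\<Sum>i\<in>UNIV. (e i \<bullet> x) *\<^sub>R e i)"
  have "orthogonal ?y b" if "b \<in> range e" for b
    using that by (auto simp: orthogonal_def inner_commute inner_diff_right
        orthonormal_expand_inner[OF e])
  then have "orthogonal ?y ?y"
    using \<open>span (range e) = UNIV\<close> by (intro orthogonal_to_span[of ?y "range e"]) auto
  then show ?thesis by (simp add: orthogonal_def)
qed

section \<open>The metric of a graph with gradient q, and eigenvalues relative to it\<close>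

definition rank_one_update :: "real^'n::finite \<Rightarrow> real^'n^'n" where
  "rank_one_update q = (\<chi> i j. (if i = j then 1 else 0) + q $ i * q $ j)"

lemma rank_one_update_mult: "rank_one_update q *v v = v + (q \<bullet> v) *\<^sub>R q"
proof (rule vec_eq_iff[THEN iffD2], rule allI)
  fix i
  have "(rank_one_update q *v v) $ i = (\<Sum>j\<in>UNIV. (if i = j then v $ j else 0) + q $ i * (q $ j * v $ j))"
    unfolding rank_one_update_def matrix_vector_mult_def by (auto intro!: sum.cong simp: algebra_simps)
  also have "\<dots> = v $ i + q $ i * (\<Sum>j\<in>UNIV. q $ j * v $ j)"
    by (simp add: sum.distrib sum_distrib_left)
  finally show "(rank_one_update q *v v) $ i = (v + (q \<bullet> v) *\<^sub>R q) $ i"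
    by (simp add: inner_vec_def mult.commute)
qed

lemma transpose_rank_one_update: "transpose (rank_one_update q) = rank_one_update q"
  by (simp add: vec_eq_iff rank_one_update_def transpose_def ac_simps)

text \<open>A rotation carries a coordinate axis to the direction of q; in the rotated basis the
  eigenvalues are 1 + |q|^2 once and 1 otherwise.\<close>

lemma det_rank_one_update:
  fixes q :: "real^'n::finite"
  shows "det (rank_one_update q) = 1 + (norm q)\<^sup>2"
proof -
  fix k :: 'n
  have nq: "norm (norm q *\<^sub>R axis k (1::real)) = norm q" by simp
  obtain f :: "real^'n \<Rightarrow> real^'n" where f: "orthogonal_transformation f" "f (norm q *\<^sub>R axis k 1) = q"
    using orthogonal_transformation_exists[OF nq] by blast
  define e where "e i = f (axis i (1::real))" for i
  have lf: "linear f" using f(1) by (simp add: orthogonal_transformation_linear)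
  have e: "e i \<bullet> e j = (if i = j then 1 else 0)" for i j
    using f(1) by (simp add: e_def orthogonal_transformation_def inner_axis_axis)
  have q: "q = norm q *\<^sub>R e k"
    using f(2) lf by (simp add: e_def linear_scale)
  have "rank_one_update q *v e i = (if i = k then 1 + (norm q)\<^sup>2 else 1) *\<^sub>R e i" for i
  proof (cases "i = k")
    case True
    have "q \<bullet> e k = norm q" by (subst q) (simp add: e)
    then have "rank_one_update q *v e k = e k + norm q *\<^sub>R (norm q *\<^sub>R e k)"
      using q by (simp add: rank_one_update_mult)
    then show ?thesis using True by (simp add: algebra_simps power2_eq_square)
  next
    case False
    have "q \<bullet> e i = 0" by (subst q) (use False e in auto)
    then show ?thesis using False by (simp add: rank_one_update_mult)
  qed
  from det_eigenbasis[OF e this] show ?thesis by (simp add: prod.delta)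
qed

text \<open>Minimization of the Rayleigh quotient relative to g. With \<mu> the minimum, h - \<mu> g
  is semidefinite and a minimizer is a null vector, hence lies in the kernel.\<close>

lemma rayleigh_minimum:
  fixes h g :: "real^'n::finite^'n"
  assumes h: "transpose h = h" and g: "transpose g = g" and pos: "\<And>v. v \<noteq> 0 \<Longrightarrow> v \<bullet> (g *v v) > 0"
  obtains \<mu> v where "v \<noteq> 0" "h *v v = \<mu> *\<^sub>R (g *v v)" "\<And>w. \<mu> * (w \<bullet> (g *v w)) \<le> w \<bullet> (h *v w)"
proof -
  have symm: "(B *v x) \<bullet> y = x \<bullet> (B *v y)" if "transpose B = B" for B :: "real^'n^'n" and x y
    using dot_lmul_matrix[of x B y] that by (metis inner_commute transpose_matrix_vector)
  fix k :: 'n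
  let ?S = "sphere (0::real^'n) 1"
  have "axis k 1 \<in> ?S" by simp
  then have "?S \<noteq> {}" by blast
  moreover have "continuous_on ?S (\<lambda>v. (v \<bullet> (h *v v)) / (v \<bullet> (g *v v)))"
    proof (intro continuous_intros matrix_vector_mult_linear_continuous_on ballI)
    fix v assume "v \<in> ?S"
    then have "v \<noteq> 0" by auto
    then show "v \<bullet> (g *v v) \<noteq> 0" using pos[of v] by simp
  qed
  ultimately obtain v where v: "v \<in> ?S"
      "\<And>y. y \<in> ?S \<Longrightarrow> (v \<bullet> (h *v v)) / (v \<bullet> (g *v v)) \<le> (y \<bullet> (h *v y)) / (y \<bullet> (g *v y))"
    using continuous_attains_inf[OF compact_sphere] by blast
  define \<mu> where "\<mu> = (v \<bullet> (h *v v)) / (v \<bullet> (g *v v))"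
  have v0: "v \<noteq> 0" using v(1) by auto
  have le: "\<mu> * (w \<bullet> (g *v w)) \<le> w \<bullet> (h *v w)" for w
  proof (cases "w = 0")
    case False
    let ?y = "w /\<^sub>R norm w"
    have "?y \<in> ?S" using False by simp
    then have "\<mu> \<le> (?y \<bullet> (h *v ?y)) / (?y \<bullet> (g *v ?y))" using v(2) \<mu>_def by blast
    also have "\<dots> = (w \<bullet> (h *v w)) / (w \<bullet> (g *v w))"
      using False by (simp add: matrix_vector_mult_scaleR divide_simps)
    finally show ?thesis using pos[OF False] by (simp add: pos_le_divide_eq)
  qed simp
  define B where "B = h - \<mu> *\<^sub>R g"
  have Bv: "B *v x = h *v x - \<mu> *\<^sub>R (g *v x)" for x
    by (simp add: B_def matrix_vector_mult_diff_rdistrib scaleR_matrix_vector_assoc)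
  have "(B *v v) \<bullet> (B *v v) = 0"
  proof (rule semidefinite_null_vector[where S = UNIV and f = "(*v) B" and e = v])
    show "(B *v x) \<bullet> y = x \<bullet> (B *v y)" for x y
      by (simp add: Bv inner_diff_left inner_diff_right symm[OF h] symm[OF g])
    show "(B *v x) \<bullet> x \<ge> 0" for x
      using le[of x] by (simp add: Bv inner_diff_left inner_diff_right inner_commute)
    show "(B *v v) \<bullet> v = 0"
      using pos[OF v0] by (simp add: Bv inner_diff_left inner_diff_right \<mu>_def inner_commute)
  qed auto
  then have "h *v v = \<mu> *\<^sub>R (g *v v)" by (simp add: Bv)
  then show thesis using that v0 le by blast
qed

text \<open>Guarantees that the minimum in \<open>lambda_min\<close> is taken over a finite set.
  Sending v to (v, q \<bullet> v), the tangent vector of the graph above v, turns the metric into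
  the Euclidean inner product; eigenvectors of distinct eigenvalues become orthogonal vectors, of
  which there are only finitely many.\<close>

lemma finite_generalized_eigenvalues:
  fixes h :: "real^'n::finite^'n" and q :: "real^'n"
  assumes h: "transpose h = h"
  shows "finite {\<kappa>. \<exists>v. v \<noteq> 0 \<and> h *v v = \<kappa> *\<^sub>R (rank_one_update q *v v)}" (is "finite ?E")
proof -
  have symm: "(h *v x) \<bullet> y = x \<bullet> (h *v y)" for x y
    using dot_lmul_matrix[of x h y] h by (metis inner_commute transpose_matrix_vector)
  obtain v where v: "\<And>\<kappa>. \<kappa> \<in> ?E \<Longrightarrow> v \<kappa> \<noteq> 0 \<and> h *v v \<kappa> = \<kappa> *\<^sub>R (rank_one_update q *v v \<kappa>)"
    using bchoice[of ?E "\<lambda>\<kappa> v. v \<noteq> 0 \<and> h *v v = \<kappa> *\<^sub>R (rank_one_update q *v v)"]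
    by auto
  define w where "w \<kappa> = (v \<kappa>, q \<bullet> v \<kappa>)" for \<kappa>
  have orth: "w \<kappa> \<bullet> w \<kappa>' = 0" if "\<kappa> \<in> ?E" "\<kappa>' \<in> ?E" "\<kappa> \<noteq> \<kappa>'" for \<kappa> \<kappa>'
  proof -
    have g: "w \<kappa> \<bullet> w \<kappa>' = v \<kappa> \<bullet> (rank_one_update q *v v \<kappa>')"
      "w \<kappa> \<bullet> w \<kappa>' = (rank_one_update q *v v \<kappa>) \<bullet> v \<kappa>'"
      by (simp_all add: w_def rank_one_update_mult inner_add_right inner_add_left inner_commute)
    have "\<kappa> * (w \<kappa> \<bullet> w \<kappa>') = (h *v v \<kappa>) \<bullet> v \<kappa>'" using v[OF that(1)] g(2) by simp
    also have "\<dots> = v \<kappa> \<bullet> (h *v v \<kappa>')" by (rule symm)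
    also have "\<dots> = \<kappa>' * (w \<kappa> \<bullet> w \<kappa>')" using v[OF that(2)] g(1) by simp
    finally show ?thesis using that(3) by simp
  qed
  have "pairwise orthogonal (w ` ?E)"
    using orth by (auto simp: pairwise_def orthogonal_def)
  then have "finite (w ` ?E)" by (rule pairwise_orthogonal_imp_finite)
  moreover have "inj_on w ?E"
  proof (rule inj_onI)
    fix \<kappa> \<kappa>' assume *: "\<kappa> \<in> ?E" "\<kappa>' \<in> ?E" "w \<kappa> = w \<kappa>'"
    show "\<kappa> = \<kappa>'"
    proof (rule ccontr)
      assume "\<kappa> \<noteq> \<kappa>'"
      then have "w \<kappa> = 0" using orth[OF *(1,2)] *(3) by simp
      then show False using v[OF *(1)] by (simp add: w_def zero_prod_def)
    qed
  qed
  ultimately show ?thesis using finite_imageD by blast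
qed

subsection \<open>Geometry of a strictly convex graph\<close>

lemma det_scaleR_matrix:
  fixes A :: "real^'n::finite^'n"
  shows "det (c *\<^sub>R A) = c ^ CARD('n) * det A"
proof -
  have "c *\<^sub>R A = (\<chi> i. c *s A $ i)" by (simp add: vec_eq_iff)
  then show ?thesis using det_rows_mul[of "\<lambda>_. c" "\<lambda>i. A $ i"] by simp
qed

lemma strictly_convex_interior_normal:
  assumes "strictly_convex_hypersurface \<Sigma>" "P \<in> \<Sigma>"
  shows "is_interior_normal \<Sigma> P (interior_normal \<Sigma> P)"
  unfolding interior_normal_def
  by (rule theI') (use assms in \<open>auto simp: strictly_convex_hypersurface_def\<close>)

text \<open>Uniqueness of the interior normal is what puts \<open>\<Sigma>\<close> on the boundary of its convex hull: at an
  interior point of the hull the opposite normal would qualify as well.\<close>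

lemma strictly_convex_support:
  assumes \<Sigma>: "strictly_convex_hypersurface \<Sigma>" and P: "P \<in> \<Sigma>"
  obtains a where "a \<noteq> 0" "\<And>Q. Q \<in> convex hull \<Sigma> \<Longrightarrow> a \<bullet> P \<le> a \<bullet> Q"
proof -
  define \<nu> where "\<nu> = interior_normal \<Sigma> P"
  have \<nu>: "is_interior_normal \<Sigma> P \<nu>"
    unfolding \<nu>_def using strictly_convex_interior_normal[OF assms] .
  have uniq: "\<mu> = \<nu>" if "is_interior_normal \<Sigma> P \<mu>" for \<mu>
    using \<Sigma> P \<nu> that by (auto simp: strictly_convex_hypersurface_def)
  have "P \<notin> interior (convex hull \<Sigma>)"
  proof
    assume "P \<in> interior (convex hull \<Sigma>)"
    then obtain e where e: "e > 0" "ball P e \<subseteq> interior (convex hull \<Sigma>)"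
      using open_contains_ball[of "interior (convex hull \<Sigma>)"] by auto
    have "is_interior_normal \<Sigma> P (- \<nu>)"
      unfolding is_interior_normal_def
    proof (intro conjI exI[of _ e] ballI)
      show "P + s *\<^sub>R (- \<nu>) \<in> interior (convex hull \<Sigma>)" if "s \<in> {0<..<e}" for s
        using that \<nu> by (intro subsetD[OF e(2)]) (auto simp: dist_norm is_interior_normal_def)
    qed (use \<nu> e in \<open>auto simp: is_interior_normal_def\<close>)
    then have "- \<nu> = \<nu>" by (rule uniq)
    then have "2 *\<^sub>R \<nu> = 0" by (metis add.right_inverse scaleR_2)
    then show False using \<nu> by (auto simp: is_interior_normal_def)
  qed
  \<comment> \<open>The inward segment also shows that the hull has nonempty interior, so its
    relative interior is the interior and \<open>P\<close> lies on the relative boundary.\<close>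
  moreover obtain e where "e > 0" "\<And>s. s \<in> {0<..<e} \<Longrightarrow> P + s *\<^sub>R \<nu> \<in> interior (convex hull \<Sigma>)"
    using \<nu> by (auto simp: is_interior_normal_def)
  then have "P + (e / 2) *\<^sub>R \<nu> \<in> interior (convex hull \<Sigma>)" by simp
  then have "interior (convex hull \<Sigma>) \<noteq> {}" by blast
  ultimately have "P \<notin> rel_interior (convex hull \<Sigma>)"
    using rel_interior_nonempty_interior by blast
  moreover have "P \<in> convex hull \<Sigma>" using P by (simp add: hull_inc)
  ultimately obtain a where "a \<noteq> 0" "\<And>Q. Q \<in> convex hull \<Sigma> \<Longrightarrow> a \<bullet> P \<le> a \<bullet> Q"
    using supporting_hyperplane_rel_boundary[OF convex_convex_hull] by metis
  then show thesis by (rule that)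
qed

text \<open>Over an open domain one can step against a horizontal functional and lower its value, so
  a supporting functional must see the vertical direction.\<close>

lemma graph_support_not_vertical:
  fixes D :: "(real^'n::finite) set"
  assumes D: "open D" and x: "x \<in> D" and a: "a \<noteq> 0"
    and sup: "\<And>y. y \<in> D \<Longrightarrow> a \<bullet> (x, u x) \<le> a \<bullet> (y, u y)"
  shows "snd a \<noteq> 0"
proof
  assume s: "snd a = 0"
  obtain r where r: "r > 0" "ball x r \<subseteq> D" using D x open_contains_ball by blast
  have fa: "fst a \<noteq> 0" using a s by (auto simp: prod_eq_iff)
  define y where "y = x - (r / (2 * norm (fst a))) *\<^sub>R fst a"
  have "y \<in> ball x r" using r fa by (simp add: y_def dist_norm)
  then have "a \<bullet> (x, u x) \<le> a \<bullet> (y, u y)" using r(2) sup by blast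
  then have "fst a \<bullet> x \<le> fst a \<bullet> y" using s by (simp add: inner_prod_def)
  then have "(r / (2 * norm (fst a))) * (fst a \<bullet> fst a) \<le> 0"
    by (simp add: y_def inner_diff_right)
  moreover have "(r / (2 * norm (fst a))) * (fst a \<bullet> fst a) > 0"
    using r(1) fa by (intro mult_pos_pos divide_pos_pos) auto
  ultimately show False by linarith
qed

text \<open>The gradient \<open>q\<close> and the Hessian \<open>H\<close> are parameters tied to
  \<open>u\<close> by derivative rules, so that the space-time derivatives of the flow can be
  supplied for each slice. The graph may still be concave: the sign of the normal is left open
  here.\<close>

locale smooth_convex_graph =
  fixes \<Sigma> :: "'n::finite space set" and D :: "(real^'n) set" and u :: "real^'n \<Rightarrow> real"
    and q :: "real^'n \<Rightarrow> real^'n" and H :: "real^'n \<Rightarrow> real^'n^'n"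
  assumes open_D: "open D" and graph: "\<Sigma> = graph_over D u"
    and convex_\<Sigma>: "strictly_convex_hypersurface \<Sigma>"
    and smooth_u: "smooth_on D u"
    and der_u: "x \<in> D \<Longrightarrow> (u has_derivative (\<lambda>v. q x \<bullet> v)) (at x)"
    and der_q: "x \<in> D \<Longrightarrow> (q has_derivative (\<lambda>v. H x *v v)) (at x)"
    and sym_H: "x \<in> D \<Longrightarrow> transpose (H x) = H x"
begin

lemma graph_mem: "x \<in> D \<Longrightarrow> (x, u x) \<in> \<Sigma>"
  by (auto simp: graph graph_over_def)

lemma local_param_graph: "local_param \<Sigma> D (\<lambda>x. (x, u x))"
  unfolding local_param_def
proof (intro conjI ballI)
  show "smooth_on D (\<lambda>x. (x, u x))"
    using smooth_u Ck_on_Pair[OF Ck_on_linear[OF bounded_linear_ident]]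
    by (auto simp: smooth_on_def)
  have im: "(\<lambda>x. (x, u x)) ` D = \<Sigma>" by (auto simp: graph graph_over_def)
  then show "openin (top_of_set \<Sigma>) ((\<lambda>x. (x, u x)) ` D)" by simp
  have cont: "continuous_on D u"
    using smooth_u Ck_on_imp_continuous_on by (auto simp: smooth_on_def)
  then have "homeomorphism D ((\<lambda>x. (x, u x)) ` D) (\<lambda>x. (x, u x)) fst"
    unfolding homeomorphism_def by (auto intro!: continuous_intros simp: image_image)
  then show "\<exists>Y. homeomorphism D ((\<lambda>x. (x, u x)) ` D) (\<lambda>x. (x, u x)) Y" by blast
  show "inj (frechet_derivative (\<lambda>x. (x, u x)) (at x))" if "x \<in> D" for x
  proof -
    have "((\<lambda>x. (x, u x)) has_derivative (\<lambda>v. (v, q x \<bullet> v))) (at x)"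
      using der_u[OF that] by (auto intro!: derivative_eq_intros)
    then have "frechet_derivative (\<lambda>x. (x, u x)) (at x) = (\<lambda>v. (v, q x \<bullet> v))"
      using frechet_derivative_at by metis
    then show ?thesis by (simp add: inj_def)
  qed
qed (rule open_D)

lemma tangent_graph:
  assumes "x \<in> D" shows "(v, q x \<bullet> v) \<in> tangent_space \<Sigma> (x, u x)"
proof -
  have "((\<lambda>x. (x, u x)) has_derivative (\<lambda>v. (v, q x \<bullet> v))) (at x)"
    using der_u[OF assms] by (auto intro!: derivative_eq_intros)
  then have "frechet_derivative (\<lambda>x. (x, u x)) (at x) = (\<lambda>v. (v, q x \<bullet> v))"
    using frechet_derivative_at by metis
  then show ?thesis
    unfolding tangent_space_def using local_param_graph assms by (auto intro!: exI)
qed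

abbreviation nrm :: "real^'n \<Rightarrow> 'n space" where
  "nrm x \<equiv> interior_normal \<Sigma> (x, u x)"

text \<open>The reciprocal of the gradient function. Up to sign it is determined by
  \<open>q\<close>; the sign tells a convex graph from a concave one.\<close>

definition nu :: "real^'n \<Rightarrow> real" where "nu x = snd (nrm x)"

lemma nrm_eq:
  assumes "x \<in> D" shows "nrm x = nu x *\<^sub>R (- q x, 1)" and "(nu x)\<^sup>2 * (1 + (norm (q x))\<^sup>2) = 1"
proof -
  have N: "is_interior_normal \<Sigma> (x, u x) (nrm x)"
    using strictly_convex_interior_normal[OF convex_\<Sigma> graph_mem[OF assms]] .
  have "(v, q x \<bullet> v) \<bullet> nrm x = 0" for v
    using N tangent_graph[OF assms] by (auto simp: is_interior_normal_def)
  then have "v \<bullet> (fst (nrm x) + nu x *\<^sub>R q x) = 0" for v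
    by (simp add: nu_def inner_prod_def inner_add_right inner_commute mult.commute)
  from this[of "fst (nrm x) + nu x *\<^sub>R q x"] have "fst (nrm x) + nu x *\<^sub>R q x = 0" by simp
  then have "fst (nrm x) = - nu x *\<^sub>R q x" by (simp add: eq_neg_iff_add_eq_0)
  then show 1: "nrm x = nu x *\<^sub>R (- q x, 1)"
    by (simp add: prod_eq_iff nu_def)
  have "(norm (nrm x))\<^sup>2 = 1" using N by (simp add: is_interior_normal_def)
  then show "(nu x)\<^sup>2 * (1 + (norm (q x))\<^sup>2) = 1"
    unfolding 1 by (simp add: norm_Pair power_mult_distrib algebra_simps)
qed

lemma nu_nonzero: "x \<in> D \<Longrightarrow> nu x \<noteq> 0"
  using nrm_eq(2) by fastforce

text \<open>A supporting functional of the hull, restricted to the graph, has a minimum at x, so it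
  annihilates the tangent plane and is a multiple of (- q x, 1). On the interior normal, which
  enters the hull, it is nonnegative; hence the multiple has the sign of \<open>nu\<close>.\<close>

lemma above_tangent:
  assumes x: "x \<in> D" and y: "y \<in> D"
  shows "nu x * (u y - u x - q x \<bullet> (y - x)) \<ge> 0"
proof -
  obtain a where a: "a \<noteq> 0" "\<And>Q. Q \<in> convex hull \<Sigma> \<Longrightarrow> a \<bullet> (x, u x) \<le> a \<bullet> Q"
    using strictly_convex_support[OF convex_\<Sigma> graph_mem[OF x]] by blast
  have sup: "a \<bullet> (x, u x) \<le> a \<bullet> (z, u z)" if "z \<in> D" for z
    using a(2) graph_mem[OF that] by (simp add: hull_inc)
  have sa: "snd a \<noteq> 0"
    using graph_support_not_vertical[OF open_D x a(1)] sup by blast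
  have "((\<lambda>z. a \<bullet> (z, u z)) has_derivative (\<lambda>v. a \<bullet> (v, q x \<bullet> v))) (at x)"
    using der_u[OF x] by (auto intro!: derivative_eq_intros)
  then have "(\<lambda>v. a \<bullet> (v, q x \<bullet> v)) = (\<lambda>v. 0)"
    by (rule differential_zero_maxmin[OF x open_D]) (use sup in auto)
  then have "a \<bullet> (v, q x \<bullet> v) = 0" for v by meson
  then have "v \<bullet> (fst a + snd a *\<^sub>R q x) = 0" for v
    by (simp add: inner_prod_def inner_add_right inner_commute mult.commute)
  from this[of "fst a + snd a *\<^sub>R q x"] have "fst a + snd a *\<^sub>R q x = 0" by simp
  then have fa: "fst a = - snd a *\<^sub>R q x" by (simp add: eq_neg_iff_add_eq_0)
  then have aeq: "a = snd a *\<^sub>R (- q x, 1)" by (simp add: prod_eq_iff)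
  have N: "is_interior_normal \<Sigma> (x, u x) (nrm x)"
    using strictly_convex_interior_normal[OF convex_\<Sigma> graph_mem[OF x]] .
  then obtain e where e: "e > 0"
      "\<And>s. s \<in> {0<..<e} \<Longrightarrow> (x, u x) + s *\<^sub>R nrm x \<in> interior (convex hull \<Sigma>)"
    by (auto simp: is_interior_normal_def)
  have "(x, u x) + (e/2) *\<^sub>R nrm x \<in> convex hull \<Sigma>"
    using e(2)[of "e/2"] e(1) interior_subset by auto
  then have "a \<bullet> nrm x \<ge> 0"
    using a(2) e(1) by (fastforce simp: inner_add_right zero_le_mult_iff)
  then have "snd a * nu x * (1 + (norm (q x))\<^sup>2) \<ge> 0"
    by (subst (asm) aeq, subst (asm) nrm_eq(1)[OF x])
      (simp add: inner_prod_def power2_norm_eq_inner algebra_simps)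
  moreover have "1 + (norm (q x))\<^sup>2 > 0" by (simp add: add_pos_nonneg)
  ultimately have sgn: "snd a * nu x > 0"
    using sa nu_nonzero[OF x] by (simp add: zero_le_mult_iff zero_less_mult_iff) linarith
  have "snd a * (u y - u x - q x \<bullet> (y - x)) \<ge> 0"
    using sup[OF y] by (simp add: inner_prod_def fa algebra_simps inner_diff_right)
  then show ?thesis using sgn by (auto simp: zero_le_mult_iff zero_less_mult_iff)
qed

text \<open>Every parametrization of the graph has the form (\<xi>, u(\<xi>)), and \<open>J\<close>
  is the Jacobian of the horizontal part \<xi>. It is injective since a tangent vector without
  horizontal part vanishes. In the second form the second derivatives of \<xi> drop out, because
  they enter through a vector (d, q \<bullet> d), which is orthogonal to the normal.\<close>

lemma forms_local_param:
  assumes X: "local_param \<Sigma> U X" and y: "y \<in> U" "X y = (x, u x)"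
  obtains J :: "real^'n^'n" where "det J \<noteq> 0"
    "first_form X y = transpose J ** rank_one_update (q x) ** J"
    "second_form X (nrm x) y = transpose J ** (nu x *\<^sub>R H x) ** J"
proof -
  have U: "open U" and sX: "smooth_on U X" using X by (auto simp: local_param_def)
  have XD: "fst (X z) \<in> D" "snd (X z) = u (fst (X z))" if "z \<in> U" for z
  proof -
    have "X z \<in> \<Sigma>" using X that unfolding local_param_def by (meson imageI openin_imp_subset subsetD)
    then show "fst (X z) \<in> D" "snd (X z) = u (fst (X z))" by (auto simp: graph graph_over_def)
  qed
  have x: "x \<in> D" using XD[OF y(1)] y(2) by simp
  have C2: "Ck_on (Suc (Suc 0)) U X" using sX by (auto simp: smooth_on_def)
  have X': "(X has_derivative (\<lambda>v. pder U v X z)) (at z)" if "z \<in> U" for z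
    using Ck_on_pder(2)[OF thick_open[OF U] C2 that] at_within_open[OF that U] by simp
  have fX: "((\<lambda>z. fst (X z)) has_derivative (\<lambda>v. fst (pder U v X z))) (at z)" if "z \<in> U" for z
    using has_derivative_fst[OF X'[OF that]] .
  have tang: "snd (pder U v X z) = q (fst (X z)) \<bullet> fst (pder U v X z)" if "z \<in> U" for z v
  proof -
    have "((\<lambda>z. u (fst (X z))) has_derivative (\<lambda>v. q (fst (X z)) \<bullet> fst (pder U v X z))) (at z)"
      using has_derivative_compose[OF fX[OF that] der_u[OF XD(1)[OF that]]] .
    then have "((\<lambda>z. snd (X z)) has_derivative (\<lambda>v. q (fst (X z)) \<bullet> fst (pder U v X z))) (at z)"
      by (rule has_derivative_transform_within_open[OF _ U that]) (simp add: XD)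
    from has_derivative_unique[OF has_derivative_snd[OF X'[OF that]] this]
    show ?thesis by meson
  qed
  have fre: "frechet_derivative X (at z) = (\<lambda>v. pder U v X z)" if "z \<in> U" for z
    using frechet_derivative_at[OF X'[OF that]] by simp
  then have pd: "pd i X z = pder U (axis i 1) X z" if "z \<in> U" for z i
    using that by (simp add: pd_def)
  define J where "J = matrix (\<lambda>v. fst (pder U v X y))"
  have linJ: "linear (\<lambda>v. fst (pder U v X y))"
    using has_derivative_linear[OF fX[OF y(1)]] .
  have Jv: "J *v v = fst (pder U v X y)" for v
    unfolding J_def by (rule matrix_works) (simp add: linear_matrix_vector_mul_eq linJ)
  have "inj ((*v) J)"
    unfolding linear_injective_0[OF matrix_vector_mul_linear]
  proof (intro allI impI)
    fix v assume "J *v v = 0"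
    then have "pder U v X y = 0"
      using tang[OF y(1), of v] by (simp add: Jv prod_eq_iff)
    moreover have "pder U 0 X y = 0"
      using linear_0[OF has_derivative_linear[OF X'[OF y(1)]]] .
    ultimately show "v = 0"
      using X y(1) fre[OF y(1)] by (metis injD local_param_def)
  qed
  then have "det J \<noteq> 0" using det_nz_iff_inj[OF matrix_vector_mul_linear[of J]] by simp
  have ent: "(transpose J ** G ** J) $ i $ j = (J *v axis i 1) \<bullet> (G *v (J *v axis j 1))"
    for G :: "real^'n^'n" and i j
    unfolding matrix_mul_assoc[symmetric] matrix_vector_mul_assoc
    by (simp add: matrix_matrix_mult_def transpose_def inner_vec_def matrix_vector_mult_basis
        column_def)
  have "first_form X y = transpose J ** rank_one_update (q x) ** J"
    by (simp add: vec_eq_iff first_form_def ent pd[OF y(1)] Jv rank_one_update_mult inner_prod_def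
        tang[OF y(1)] y(2) inner_add_right inner_commute mult.commute)
  moreover have "second_form X (nrm x) y $ i $ j = (transpose J ** (nu x *\<^sub>R H x) ** J) $ i $ j"
    for i j
  proof -
    let ?e = "axis j 1 :: real^'n" and ?i = "axis i 1 :: real^'n"
    let ?Y = "pder U ?e X" and ?Y' = "\<lambda>v. pder U v (pder U ?e X) y"
    have Y: "(?Y has_derivative ?Y') (at y)"
      using Ck_on_pder(2)[OF thick_open[OF U] Ck_on_pder(1)[OF thick_open[OF U] C2] y(1)]
        at_within_open[OF y(1) U] by simp
    have qX: "((\<lambda>z. q (fst (X z))) has_derivative (\<lambda>v. H x *v (J *v v))) (at y)"
      using has_derivative_compose[OF fX[OF y(1)] der_q[OF XD(1)[OF y(1)]]] by (simp add: y(2) Jv)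
    have "((\<lambda>z. q (fst (X z)) \<bullet> fst (?Y z)) has_derivative
        (\<lambda>v. q (fst (X y)) \<bullet> fst (?Y' v) + (H x *v (J *v v)) \<bullet> fst (?Y y))) (at y)"
      using has_derivative_inner[OF qX has_derivative_fst[OF Y]] .
    then have "((\<lambda>z. snd (?Y z)) has_derivative
        (\<lambda>v. q (fst (X y)) \<bullet> fst (?Y' v) + (H x *v (J *v v)) \<bullet> fst (?Y y))) (at y)"
      by (rule has_derivative_transform_within_open[OF _ U y(1)]) (simp add: tang)
    from has_derivative_unique[OF has_derivative_snd[OF Y] this]
    have sY: "snd (?Y' v) = q x \<bullet> fst (?Y' v) + (H x *v (J *v v)) \<bullet> (J *v ?e)" for v
      unfolding y(2) Jv fst_conv by meson
    have "((pd j X) has_derivative ?Y') (at y)"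
      by (rule has_derivative_transform_within_open[OF Y U y(1)]) (simp add: pd)
    then have "frechet_derivative (pd j X) (at y) = ?Y'"
      using frechet_derivative_at by metis
    then have "pd i (pd j X) y = ?Y' ?i" by (simp add: pd_def)
    then have "second_form X (nrm x) y $ i $ j = ?Y' ?i \<bullet> nrm x"
      by (simp add: second_form_def)
    also have "\<dots> = nu x * ((H x *v (J *v ?i)) \<bullet> (J *v ?e))"
      unfolding nrm_eq(1)[OF x]
      by (simp add: inner_prod_def sY algebra_simps inner_commute)
    also have "\<dots> = nu x * ((J *v ?i) \<bullet> (H x *v (J *v ?e)))"
      using dot_lmul_matrix[of "J *v ?i" "H x" "J *v ?e"] sym_H[OF x]
      by (metis inner_commute transpose_matrix_vector)
    also have "\<dots> = (transpose J ** (nu x *\<^sub>R H x) ** J) $ i $ j"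
      by (simp add: ent scaleR_matrix_vector_assoc[symmetric])
    finally show ?thesis .
  qed
  then have "second_form X (nrm x) y = transpose J ** (nu x *\<^sub>R H x) ** J"
    by (simp add: vec_eq_iff)
  ultimately show thesis using that \<open>det J \<noteq> 0\<close> by blast
qed

lemma rank_one_update_pos: "v \<noteq> 0 \<Longrightarrow> v \<bullet> (rank_one_update p *v v) > 0"
  by (simp add: rank_one_update_mult inner_add_right add_pos_nonneg inner_commute)

text \<open>The factors of \<open>J\<close> cancel in the determinant, and \<open>J\<close> maps
  eigenvectors of the shape matrix to eigenvectors relative to the metric of the graph. Both
  right-hand sides are free of the parametrization.\<close>

lemma shape_local_param:
  assumes X: "local_param \<Sigma> U X" and y: "y \<in> U" "X y = (x, u x)"
  shows "det (shape_matrix X (nrm x) y) = (nu x) ^ CARD('n) * det (H x) / (1 + (norm (q x))\<^sup>2)"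
    and "(\<exists>v. v \<noteq> 0 \<and> shape_matrix X (nrm x) y *v v = \<kappa> *\<^sub>R v) \<longleftrightarrow>
      (\<exists>v. v \<noteq> 0 \<and> (nu x *\<^sub>R H x) *v v = \<kappa> *\<^sub>R (rank_one_update (q x) *v v))"
proof -
  obtain J :: "real^'n^'n" where J: "det J \<noteq> 0"
    "first_form X y = transpose J ** rank_one_update (q x) ** J"
    "second_form X (nrm x) y = transpose J ** (nu x *\<^sub>R H x) ** J"
    using forms_local_param[OF assms] by blast
  let ?G = "transpose J ** rank_one_update (q x) ** J" and ?B = "transpose J ** (nu x *\<^sub>R H x) ** J"
  have p: "1 + (norm (q x))\<^sup>2 > 0" by (simp add: add_pos_nonneg)
  have dG: "det ?G = det J * (1 + (norm (q x))\<^sup>2) * det J"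
    by (simp add: det_mul det_rank_one_update)
  then have dG0: "det ?G \<noteq> 0" using J(1) p by simp
  have inv: "?G ** matrix_inv ?G = mat 1" "matrix_inv ?G ** ?G = mat 1"
    using matrix_inv_mult[OF dG0] by auto
  have "det ?G * det (matrix_inv ?G) = 1"
    using inv(1) by (metis det_I det_mul)
  then have "det (matrix_inv ?G) = 1 / det ?G" using dG0 by (simp add: field_simps)
  moreover have "det ?B = det J * ((nu x) ^ CARD('n) * det (H x)) * det J"
    by (simp add: det_mul det_scaleR_matrix)
  moreover have alg: "1 / (d * p * d) * (d * k * d) = k / p" if "d \<noteq> 0" "p > 0" for d p k :: real
    using that by (simp add: field_simps)
  ultimately show "det (shape_matrix X (nrm x) y)
      = (nu x) ^ CARD('n) * det (H x) / (1 + (norm (q x))\<^sup>2)"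
    unfolding shape_matrix_def J(2,3) det_mul[of "matrix_inv ?G"] dG
    using alg[of "det J" "1 + (norm (q x))\<^sup>2"] J(1) p by simp
  have Jinv: "J ** matrix_inv J = mat 1" "matrix_inv J ** J = mat 1"
    using matrix_inv_mult[OF J(1)] by auto
  have injT: "w = 0" if "transpose J *v w = 0" for w
  proof -
    have "det (transpose J) \<noteq> 0" using J(1) by simp
    from matrix_inv_mult(2)[OF this] have "w = matrix_inv (transpose J) *v (transpose J *v w)"
      by (simp only: matrix_vector_mul_assoc matrix_vector_mul_lid)
    then show ?thesis using that by simp
  qed
  have key: "shape_matrix X (nrm x) y *v v = \<kappa> *\<^sub>R v \<longleftrightarrow>
      (nu x *\<^sub>R H x) *v (J *v v) = \<kappa> *\<^sub>R (rank_one_update (q x) *v (J *v v))" for v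
  proof -
    have "shape_matrix X (nrm x) y *v v = \<kappa> *\<^sub>R v \<longleftrightarrow> matrix_inv ?G *v (?B *v v) = \<kappa> *\<^sub>R v"
      by (simp add: shape_matrix_def J(2,3) matrix_vector_mul_assoc)
    also have "\<dots> \<longleftrightarrow> ?B *v v = \<kappa> *\<^sub>R (?G *v v)"
    proof
      assume "matrix_inv ?G *v (?B *v v) = \<kappa> *\<^sub>R v"
      then have "?G *v (matrix_inv ?G *v (?B *v v)) = \<kappa> *\<^sub>R (?G *v v)"
        by (simp add: matrix_vector_mult_scaleR)
      then show "?B *v v = \<kappa> *\<^sub>R (?G *v v)"
        by (metis inv(1) matrix_vector_mul_assoc matrix_vector_mul_lid)
    next
      assume "?B *v v = \<kappa> *\<^sub>R (?G *v v)"
      then have "matrix_inv ?G *v (?B *v v) = \<kappa> *\<^sub>R (matrix_inv ?G *v (?G *v v))"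
        by (simp add: matrix_vector_mult_scaleR)
      then show "matrix_inv ?G *v (?B *v v) = \<kappa> *\<^sub>R v"
        by (metis inv(2) matrix_vector_mul_assoc matrix_vector_mul_lid)
    qed
    also have "\<dots> \<longleftrightarrow> transpose J *v ((nu x *\<^sub>R H x) *v (J *v v)
        - \<kappa> *\<^sub>R (rank_one_update (q x) *v (J *v v))) = 0"
      by (simp add: matrix_vector_mult_diff_distrib matrix_vector_mult_scaleR
          flip: matrix_vector_mul_assoc)
    also have "\<dots> \<longleftrightarrow> (nu x *\<^sub>R H x) *v (J *v v) = \<kappa> *\<^sub>R (rank_one_update (q x) *v (J *v v))"
      using injT by (metis right_minus_eq matrix_vector_mult_0_right)
    finally show ?thesis .
  qed
  have nz: "J *v v \<noteq> 0" if "v \<noteq> 0" for v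
    using Jinv(2) that by (metis matrix_vector_mul_assoc matrix_vector_mul_lid matrix_vector_mult_0_right)
  have nz': "matrix_inv J *v v \<noteq> 0" "J *v (matrix_inv J *v v) = v" if "v \<noteq> 0" for v
    using Jinv(1) that by (metis matrix_vector_mul_assoc matrix_vector_mul_lid matrix_vector_mult_0_right,
        metis Jinv(1) matrix_vector_mul_assoc matrix_vector_mul_lid)
  show "(\<exists>v. v \<noteq> 0 \<and> shape_matrix X (nrm x) y *v v = \<kappa> *\<^sub>R v) \<longleftrightarrow>
      (\<exists>v. v \<noteq> 0 \<and> (nu x *\<^sub>R H x) *v v = \<kappa> *\<^sub>R (rank_one_update (q x) *v v))"
    unfolding key using nz nz' by metis
qed

text \<open>The definite description is legitimate because every parametrization gives the same
  determinant.\<close>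

lemma gauss_curvature_graph:
  assumes "x \<in> D"
  shows "gauss_curvature \<Sigma> (x, u x) = (nu x) ^ CARD('n) * det (H x) / (1 + (norm (q x))\<^sup>2)"
  unfolding gauss_curvature_def
proof (rule the_equality)
  show "\<exists>U X z. local_param \<Sigma> U X \<and> z \<in> U \<and> X z = (x, u x) \<and>
      (nu x) ^ CARD('n) * det (H x) / (1 + (norm (q x))\<^sup>2) = det (shape_matrix X (nrm x) z)"
    using local_param_graph assms shape_local_param(1)[OF local_param_graph assms refl]
    by (intro exI[of _ D] exI[of _ "\<lambda>x. (x, u x)"] exI[of _ x]) auto
qed (auto simp: shape_local_param(1))

lemma principal_curvatures_graph:
  assumes "x \<in> D"
  shows "principal_curvatures \<Sigma> (x, u x) =
    {\<kappa>. \<exists>v. v \<noteq> 0 \<and> (nu x *\<^sub>R H x) *v v = \<kappa> *\<^sub>R (rank_one_update (q x) *v v)}"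
proof (intro set_eqI iffI)
  fix \<kappa> assume "\<kappa> \<in> principal_curvatures \<Sigma> (x, u x)"
  then obtain U X z v where "local_param \<Sigma> U X" "z \<in> U" "X z = (x, u x)" "v \<noteq> 0"
      "shape_matrix X (nrm x) z *v v = \<kappa> *\<^sub>R v"
    by (auto simp: principal_curvatures_def)
  then show "\<kappa> \<in> {\<kappa>. \<exists>v. v \<noteq> 0 \<and> (nu x *\<^sub>R H x) *v v = \<kappa> *\<^sub>R (rank_one_update (q x) *v v)}"
    using shape_local_param(2)[of U X z x \<kappa>] by blast
next
  fix \<kappa> assume "\<kappa> \<in> {\<kappa>. \<exists>v. v \<noteq> 0 \<and> (nu x *\<^sub>R H x) *v v = \<kappa> *\<^sub>R (rank_one_update (q x) *v v)}"
  then obtain v where "v \<noteq> 0" "shape_matrix (\<lambda>x. (x, u x)) (nrm x) x *v v = \<kappa> *\<^sub>R v"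
    using shape_local_param(2)[OF local_param_graph assms refl, of \<kappa>] by blast
  then show "\<kappa> \<in> principal_curvatures \<Sigma> (x, u x)"
    using local_param_graph assms unfolding principal_curvatures_def by blast
qed

text \<open>The smallest principal curvature is the minimum of a Rayleigh quotient. This yields both
  a bound in all directions and a direction in which it is attained.\<close>

lemma lambda_min_graph:
  assumes x: "x \<in> D"
  shows "lambda_min \<Sigma> (x, u x) > 0"
    and "lambda_min \<Sigma> (x, u x) * (w \<bullet> (rank_one_update (q x) *v w)) \<le> nu x * (w \<bullet> (H x *v w))"
    and "\<exists>v. v \<noteq> 0 \<and> (nu x *\<^sub>R H x) *v v = lambda_min \<Sigma> (x, u x) *\<^sub>R (rank_one_update (q x) *v v)"
proof -
  let ?E = "{\<kappa>. \<exists>v. v \<noteq> 0 \<and> (nu x *\<^sub>R H x) *v v = \<kappa> *\<^sub>R (rank_one_update (q x) *v v)}"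
  have tr: "transpose (nu x *\<^sub>R H x) = nu x *\<^sub>R H x"
    using sym_H[OF x] by (simp add: vec_eq_iff transpose_def)
  obtain \<mu> v where \<mu>: "v \<noteq> 0" "(nu x *\<^sub>R H x) *v v = \<mu> *\<^sub>R (rank_one_update (q x) *v v)"
      "\<And>w. \<mu> * (w \<bullet> (rank_one_update (q x) *v w)) \<le> w \<bullet> ((nu x *\<^sub>R H x) *v w)"
    using rayleigh_minimum[OF tr transpose_rank_one_update rank_one_update_pos] by blast
  have fin: "finite ?E" by (rule finite_generalized_eigenvalues[OF tr])
  have "lambda_min \<Sigma> (x, u x) = \<mu>"
    unfolding lambda_min_def principal_curvatures_graph[OF x]
  proof (rule Min_eqI[OF fin])
    show "\<mu> \<in> ?E" using \<mu> by blast
    fix \<kappa> assume "\<kappa> \<in> ?E"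
    then obtain w where w: "w \<noteq> 0" "(nu x *\<^sub>R H x) *v w = \<kappa> *\<^sub>R (rank_one_update (q x) *v w)" by blast
    have "\<mu> * (w \<bullet> (rank_one_update (q x) *v w)) \<le> \<kappa> * (w \<bullet> (rank_one_update (q x) *v w))"
      using \<mu>(3)[of w] w(2) by simp
    then show "\<mu> \<le> \<kappa>" using rank_one_update_pos[OF w(1)] by (simp add: mult_le_cancel_right)
  qed
  moreover have "\<mu> > 0"
    using convex_\<Sigma> graph_mem[OF x] \<mu>(1,2) principal_curvatures_graph[OF x]
    unfolding strictly_convex_hypersurface_def by blast
  ultimately show "lambda_min \<Sigma> (x, u x) > 0"
    "lambda_min \<Sigma> (x, u x) * (w \<bullet> (rank_one_update (q x) *v w)) \<le> nu x * (w \<bullet> (H x *v w))"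
    "\<exists>v. v \<noteq> 0 \<and> (nu x *\<^sub>R H x) *v v = lambda_min \<Sigma> (x, u x) *\<^sub>R (rank_one_update (q x) *v v)"
    using \<mu>(3)[of w] \<mu>(1,2) by (auto simp: scaleR_matrix_vector_assoc[symmetric])
qed

lemma hessian_definite:
  assumes "x \<in> D" "w \<noteq> 0"
  shows "nu x * (w \<bullet> (H x *v w)) > 0"
  using lambda_min_graph(1)[OF assms(1)] lambda_min_graph(2)[OF assms(1), of w] rank_one_update_pos[OF assms(2), of "q x"]
  by (meson less_le_trans mult_pos_pos)

end

subsection \<open>Intrinsic distance and completeness\<close>

text \<open>The fundamental theorem of calculus away from finitely many corners, followed by the
  triangle inequality for integrals.\<close>

lemma dist_le_curve_length:
  fixes \<gamma> :: "real \<Rightarrow> 'a::euclidean_space"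
  assumes \<gamma>: "\<gamma> piecewise_C1_differentiable_on {0..1}"
    and L: "((\<lambda>s. norm (vector_derivative \<gamma> (at s))) has_integral L) {0..1}"
  shows "dist (\<gamma> 0) (\<gamma> 1) \<le> L"
proof -
  obtain S where S: "finite S" "continuous_on {0..1} \<gamma>" "\<gamma> C1_differentiable_on ({0..1} - S)"
    using \<gamma> by (auto simp: piecewise_C1_differentiable_on_def)
  have "(\<gamma> has_vector_derivative vector_derivative \<gamma> (at x)) (at x)" if "x \<in> {0..1} - S" for x
    using S(3) that by (simp add: C1_differentiable_on_eq vector_derivative_works)
  then have I: "((\<lambda>x. vector_derivative \<gamma> (at x)) has_integral (\<gamma> 1 - \<gamma> 0)) {0..1}"
    using fundamental_theorem_of_calculus_strong[OF S(1), of 0 1 \<gamma>] S(2) by simp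
  have "norm (integral {0..1} (\<lambda>x. vector_derivative \<gamma> (at x)))
      \<le> integral {0..1} (\<lambda>s. norm (vector_derivative \<gamma> (at s)))"
    using I L by (intro integral_norm_bound_integral) (auto simp: has_integral_integrable)
  then show ?thesis
    using integral_unique[OF I] integral_unique[OF L] by (simp add: dist_norm norm_minus_commute)
qed

text \<open>Named separately because the infimum of the empty set is unspecified: that some
  admissible curve exists is a side condition of the lower bound for the intrinsic distance.\<close>

definition curve_lengths :: "'n::finite space set \<Rightarrow> 'n space \<Rightarrow> 'n space \<Rightarrow> real set" where
  "curve_lengths \<Sigma> P Q =
     {L. \<exists>\<gamma>. \<gamma> piecewise_C1_differentiable_on {0..1} \<and> \<gamma> ` {0..1} \<subseteq> \<Sigma> \<and>
             \<gamma> 0 = P \<and> \<gamma> 1 = Q \<and>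
             ((\<lambda>s. norm (vector_derivative \<gamma> (at s))) has_integral L) {0..1}}"

lemma intrinsic_dist_eq: "intrinsic_dist \<Sigma> P Q = Inf (curve_lengths \<Sigma> P Q)"
  by (simp add: intrinsic_dist_def curve_lengths_def)

lemma dist_le_intrinsic_dist:
  "curve_lengths \<Sigma> P Q \<noteq> {} \<Longrightarrow> dist P Q \<le> intrinsic_dist \<Sigma> P Q"
  unfolding intrinsic_dist_eq
  by (rule cInf_greatest) (auto simp: curve_lengths_def dest: dist_le_curve_length)

lemma C1_curve_length:
  assumes \<gamma>: "\<gamma> C1_differentiable_on {0..1}" "\<gamma> ` {0..1} \<subseteq> \<Sigma>"
  shows "integral {0..1} (\<lambda>s. norm (vector_derivative \<gamma> (at s))) \<in> curve_lengths \<Sigma> (\<gamma> 0) (\<gamma> 1)"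
proof -
  have "(\<lambda>s. norm (vector_derivative \<gamma> (at s))) integrable_on {0..1}"
    using \<gamma>(1) by (intro integrable_continuous_real continuous_on_norm)
      (auto simp: C1_differentiable_on_eq)
  then show ?thesis
    unfolding curve_lengths_def using \<gamma>
    by (auto intro!: exI[of _ \<gamma>] C1_differentiable_imp_piecewise integrable_integral)
qed

text \<open>A majorant of the speed with a known integral suffices, so lengths never have to be
  computed.\<close>

lemma intrinsic_dist_le:
  assumes \<gamma>: "\<gamma> C1_differentiable_on {0..1}" "\<gamma> ` {0..1} \<subseteq> \<Sigma>"
    and b: "(b has_integral I) {0..1}" "\<And>s. s \<in> {0..1} \<Longrightarrow> norm (vector_derivative \<gamma> (at s)) \<le> b s"
  shows "intrinsic_dist \<Sigma> (\<gamma> 0) (\<gamma> 1) \<le> I"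
proof -
  let ?L = "integral {0..1} (\<lambda>s. norm (vector_derivative \<gamma> (at s)))"
  have L: "?L \<in> curve_lengths \<Sigma> (\<gamma> 0) (\<gamma> 1)" by (rule C1_curve_length[OF \<gamma>])
  have "bdd_below (curve_lengths \<Sigma> (\<gamma> 0) (\<gamma> 1))"
    by (intro bdd_belowI[of _ 0])
      (auto simp: curve_lengths_def dest!: dist_le_curve_length intro: order_trans[OF zero_le_dist])
  then have "intrinsic_dist \<Sigma> (\<gamma> 0) (\<gamma> 1) \<le> ?L"
    unfolding intrinsic_dist_eq using L by (intro cInf_lower)
  also have "\<dots> \<le> integral {0..1} b"
  proof (rule integral_le)
    show "(\<lambda>s. norm (vector_derivative \<gamma> (at s))) integrable_on {0..1}"
      using \<gamma>(1) by (intro integrable_continuous_real continuous_on_norm)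
        (auto simp: C1_differentiable_on_eq)
  qed (use b in auto)
  finally show ?thesis using b(1) by (simp add: integral_unique)
qed

text \<open>Adds the sign of the normal, so that u lies above its tangent planes, and completeness,
  which controls the boundary of \<open>D\<close>.\<close>

locale complete_convex_graph = smooth_convex_graph +
  assumes connected_D: "connected D" and complete: "complete_hypersurface \<Sigma>"
    and nu_pos: "x \<in> D \<Longrightarrow> nu x > 0"
begin

lemma tangent_le: "x \<in> D \<Longrightarrow> y \<in> D \<Longrightarrow> u x + q x \<bullet> (y - x) \<le> u y"
  using above_tangent[of x y] nu_pos[of x] by (simp add: zero_le_mult_iff)

lemma continuous_q: "continuous_on D q"
  using der_q by (meson continuous_at_imp_continuous_on has_derivative_continuous)

lemma C1_graph_curve:
  assumes z: "\<And>s. s \<in> {0..1} \<Longrightarrow> (z has_vector_derivative z' s) (at s)"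
    "continuous_on {0..1} z'" "\<And>s. s \<in> {0..1} \<Longrightarrow> z s \<in> D"
  shows "(\<lambda>s. (z s, u (z s))) C1_differentiable_on {0..1}"
    and "s \<in> {0..1} \<Longrightarrow> vector_derivative (\<lambda>s. (z s, u (z s))) (at s) = (z' s, q (z s) \<bullet> z' s)"
proof -
  have d: "((\<lambda>s. (z s, u (z s))) has_vector_derivative (z' s, q (z s) \<bullet> z' s)) (at s)"
    if "s \<in> {0..1}" for s
    using has_derivative_compose[OF z(1)[OF that, unfolded has_vector_derivative_def] der_u[OF z(3)[OF that]]]
      z(1)[OF that]
    by (auto simp: has_vector_derivative_def intro!: derivative_eq_intros)
  have "continuous_on {0..1} z"
    using z(1) by (meson continuous_at_imp_continuous_on has_vector_derivative_continuous)
  then have "continuous_on {0..1} (\<lambda>s. q (z s))"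
    using z(3) by (intro continuous_on_compose2[OF continuous_q]) auto
  then show "(\<lambda>s. (z s, u (z s))) C1_differentiable_on {0..1}"
    unfolding C1_differentiable_on_def using d z(2)
    by (auto intro!: exI[of _ "\<lambda>s. (z' s, q (z s) \<bullet> z' s)"] continuous_intros)
  show "vector_derivative (\<lambda>s. (z s, u (z s))) (at s) = (z' s, q (z s) \<bullet> z' s)" if "s \<in> {0..1}"
    using vector_derivative_at[OF d[OF that]] .
qed

text \<open>Points of a connected open set are joined by a polynomial path, whose lift to the graph
  is C^1 and has finite length.\<close>

lemma curve_lengths_nonempty:
  assumes "x \<in> D" "y \<in> D" shows "curve_lengths \<Sigma> (x, u x) (y, u y) \<noteq> {}"
proof -
  obtain z where z: "polynomial_function z" "path_image z \<subseteq> D" "pathstart z = x" "pathfinish z = y"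
    using connected_open_polynomial_connected[OF open_D connected_D assms] by blast
  obtain z' where z': "polynomial_function z'" "\<And>s. (z has_vector_derivative z' s) (at s)"
    using has_vector_derivative_polynomial_function[OF z(1)] by blast
  have in_D: "z s \<in> D" if "s \<in> {0..1}" for s
    using z(2) that by (auto simp: path_image_def)
  have "(\<lambda>s. (z s, u (z s))) C1_differentiable_on {0..1}"
    by (rule C1_graph_curve(1)[OF z'(2) _ in_D])
      (auto intro: continuous_on_polymonial_function z'(1))
  moreover have "(\<lambda>s. (z s, u (z s))) ` {0..1} \<subseteq> \<Sigma>"
    using in_D graph_mem by auto
  ultimately show ?thesis
    using C1_curve_length[of "\<lambda>s. (z s, u (z s))" \<Sigma>] z(3,4) by (auto simp: pathstart_def pathfinish_def)
qed

lemma gradient_monotone: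
  assumes "x \<in> D" "y \<in> D" shows "q x \<bullet> (y - x) \<le> q y \<bullet> (y - x)"
  using tangent_le[OF assms] tangent_le[OF assms(2,1)] by (simp add: inner_diff_right)

text \<open>By convexity the graph over a segment on which \<open>u\<close> is bounded has finite length, so completeness
  keeps its end point in the domain.\<close>

lemma bounded_segment_end:
  assumes seg: "\<And>l. 0 \<le> l \<Longrightarrow> l < 1 \<Longrightarrow> x + l *\<^sub>R d \<in> D"
    and bd: "\<And>l. 0 \<le> l \<Longrightarrow> l < 1 \<Longrightarrow> u (x + l *\<^sub>R d) \<le> C"
  shows "x + d \<in> D"
proof -
  have x: "x \<in> D" using seg[of 0] by simp
  \<comment> \<open>By monotonicity of the gradient the slope q \<bullet> d along the segment stays
    above -m, so |q \<bullet> d| \<le> q \<bullet> d + 2m. Hence the derivative q \<bullet> d + 2m +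
    |d| of \<open>ch\<close> dominates the speed |(d, q \<bullet> d)| of the lifted segment:
    \<open>ch\<close> measures its length from above, and it is bounded along with u.\<close>
  define m where "m = \<bar>q x \<bullet> d\<bar>"
  define ch where "ch l = u (x + l *\<^sub>R d) + (2 * m + norm d) * l" for l
  have mono: "q (x + l *\<^sub>R d) \<bullet> d \<ge> - m" if "0 \<le> l" "l < 1" for l
  proof (cases "l = 0")
    case False
    have "l * (q x \<bullet> d) \<le> l * (q (x + l *\<^sub>R d) \<bullet> d)"
      using gradient_monotone[OF x seg[OF that]] by simp
    then show ?thesis using False that by (simp add: m_def)
  qed (simp add: m_def)
  have ch': "(ch has_real_derivative (q (x + l *\<^sub>R d) \<bullet> d + (2 * m + norm d))) (at l)"
    if "0 \<le> l" "l < 1" for l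
    unfolding ch_def
    using line_deriv[OF der_u[OF seg[OF that]]]
    by (auto intro!: derivative_eq_intros simp: has_real_derivative_iff_has_vector_derivative[symmetric])
  have ch_mono: "ch l \<le> ch l'" if "0 \<le> l" "l \<le> l'" "l' < 1" for l l'
  proof (rule DERIV_nonneg_imp_nondecreasing[OF that(2)])
    fix r assume r: "l \<le> r" "r \<le> l'"
    then show "\<exists>y. (ch has_real_derivative y) (at r) \<and> 0 \<le> y"
    proof (intro exI[of _ "q (x + r *\<^sub>R d) \<bullet> d + (2 * m + norm d)"] conjI)
      have "m \<ge> 0" by (simp add: m_def)
      then show "0 \<le> q (x + r *\<^sub>R d) \<bullet> d + (2 * m + norm d)"
        using mono[of r] r that norm_ge_zero[of d] by linarith
    qed (use ch'[of r] r that in auto)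
  qed
  have dist_le: "intrinsic_dist \<Sigma> (x + l *\<^sub>R d, u (x + l *\<^sub>R d)) (x + l' *\<^sub>R d, u (x + l' *\<^sub>R d))
      \<le> \<bar>ch l' - ch l\<bar>" if l: "0 \<le> l" "l < 1" "0 \<le> l'" "l' < 1" for l l'
  proof -
    \<comment> \<open>The two parameters may come in either order; the difference is signed, and the
      factor \<open>sgn \<delta>\<close> makes the majorant nonnegative.\<close>
    define \<delta> where "\<delta> = l' - l"
    define z where "z s = x + (l + s * \<delta>) *\<^sub>R d" for s
    have par: "0 \<le> l + s * \<delta>" "l + s * \<delta> < 1" if "s \<in> {0..1}" for s
    proof -
      have e: "l + s * \<delta> = (1 - s) * l + s * l'" by (simp add: \<delta>_def algebra_simps)
      show "0 \<le> l + s * \<delta>" unfolding e using that l by simp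
      show "l + s * \<delta> < 1" unfolding e using convex_bound_lt[of l 1 l' "1 - s" s] that l by simp
    qed
    have zd: "(z has_vector_derivative \<delta> *\<^sub>R d) (at s)" for s
      unfolding z_def by (auto intro!: derivative_eq_intros simp: scaleR_left_distrib)
    have zD: "z s \<in> D" if "s \<in> {0..1}" for s
      unfolding z_def using seg par[OF that] by blast
    let ?\<gamma> = "\<lambda>s. (z s, u (z s))"
    let ?b = "\<lambda>s. sgn \<delta> * (\<delta> * (q (z s) \<bullet> d + (2 * m + norm d)))"
    have "((\<lambda>s. ch (l + s * \<delta>)) has_real_derivative
        \<delta> * (q (z s) \<bullet> d + (2 * m + norm d))) (at s)" if "s \<in> {0..1}" for s
    proof -
      have "((\<lambda>s. l + s * \<delta>) has_real_derivative \<delta>) (at s)"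
        by (auto intro!: derivative_eq_intros)
      from DERIV_chain2[where f = ch and g = "\<lambda>s. l + s * \<delta>", OF ch'[OF par[OF that]] this]
      show ?thesis unfolding z_def by (simp add: ac_simps)
    qed
    then have "((\<lambda>s. \<delta> * (q (z s) \<bullet> d + (2 * m + norm d))) has_integral
        (ch (l + 1 * \<delta>) - ch (l + 0 * \<delta>))) {0..1}"
      by (intro fundamental_theorem_of_calculus)
        (auto simp: has_real_derivative_iff_has_vector_derivative intro: has_vector_derivative_at_within)
    then have "(?b has_integral (sgn \<delta> * (ch l' - ch l))) {0..1}"
      by (intro has_integral_mult_right) (simp add: \<delta>_def)
    moreover have "norm (vector_derivative ?\<gamma> (at s)) \<le> ?b s" if s: "s \<in> {0..1}" for s
    proof -
      have "norm (vector_derivative ?\<gamma> (at s)) = norm (\<delta> *\<^sub>R d, \<delta> * (q (z s) \<bullet> d))"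
        using C1_graph_curve(2)[OF zd _ zD s] by simp
      also have "\<dots> \<le> \<bar>\<delta>\<bar> * norm d + \<bar>\<delta>\<bar> * \<bar>q (z s) \<bullet> d\<bar>"
        using norm_Pair_le[of "\<delta> *\<^sub>R d" "\<delta> * (q (z s) \<bullet> d)"] by (simp add: abs_mult)
      also have "\<dots> = \<bar>\<delta>\<bar> * (norm d + \<bar>q (z s) \<bullet> d\<bar>)" by (simp add: algebra_simps)
      also have "\<dots> \<le> \<bar>\<delta>\<bar> * (q (z s) \<bullet> d + (2 * m + norm d))"
      proof (rule mult_left_mono)
        have "m \<ge> 0" by (simp add: m_def)
        then show "norm d + \<bar>q (z s) \<bullet> d\<bar> \<le> q (z s) \<bullet> d + (2 * m + norm d)"
          using mono[OF par[OF s]] by (simp add: z_def abs_if)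
      qed simp
      also have "\<dots> = ?b s" by (simp add: abs_sgn ac_simps)
      finally show ?thesis .
    qed
    moreover have "?\<gamma> C1_differentiable_on {0..1}"
      by (rule C1_graph_curve(1)[OF zd _ zD]) auto
    moreover have "?\<gamma> ` {0..1} \<subseteq> \<Sigma>" using zD graph_mem by auto
    ultimately have "intrinsic_dist \<Sigma> (?\<gamma> 0) (?\<gamma> 1) \<le> sgn \<delta> * (ch l' - ch l)"
      by (intro intrinsic_dist_le)
    also have "\<dots> \<le> \<bar>ch l' - ch l\<bar>" by (auto simp: sgn_if)
    finally show ?thesis by (simp add: z_def \<delta>_def)
  qed
  \<comment> \<open>Parameters increasing to 1 without reaching it. Along them \<open>ch\<close> is
    monotone and bounded, so the lifted points form a Cauchy sequence for the intrinsic
    distance.\<close>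
  define r where "r i = 1 - 1 / real (Suc i)" for i
  have r: "0 \<le> r i" "r i < 1" for i by (auto simp: r_def)
  have r_mono: "r i \<le> r j" if "i \<le> j" for i j
    using that by (simp add: r_def frac_le)
  define X where "X i = (x + r i *\<^sub>R d, u (x + r i *\<^sub>R d))" for i
  have XS: "range X \<subseteq> \<Sigma>" using seg[OF r] graph_mem by (auto simp: X_def)
  have "incseq (\<lambda>i. ch (r i))"
    by (intro incseq_SucI ch_mono r r_mono) auto
  moreover have "ch (r i) \<le> C + (2 * m + norm d)" for i
    unfolding ch_def using bd[OF r, of i] r[of i]
    by (intro add_mono mult_left_le) (auto simp: m_def)
  ultimately have "convergent (\<lambda>i. ch (r i))"
    using incseq_convergent by (metis convergentI)
  then have "Cauchy (\<lambda>i. ch (r i))" by (simp add: Cauchy_convergent_iff)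
  have "\<forall>\<epsilon>>0. \<exists>N. \<forall>i\<ge>N. \<forall>j\<ge>N. intrinsic_dist \<Sigma> (X i) (X j) < \<epsilon>"
  proof (intro allI impI)
    fix \<epsilon> :: real assume "\<epsilon> > 0"
    then obtain N where N: "\<And>i j. i \<ge> N \<Longrightarrow> j \<ge> N \<Longrightarrow> dist (ch (r i)) (ch (r j)) < \<epsilon>"
      using \<open>Cauchy (\<lambda>i. ch (r i))\<close> unfolding Cauchy_def by blast
    have "intrinsic_dist \<Sigma> (X i) (X j) < \<epsilon>" if "i \<ge> N" "j \<ge> N" for i j
      using dist_le[OF r r, of i j] N[OF that(2,1)] by (simp add: X_def dist_real_def)
    then show "\<exists>N. \<forall>i\<ge>N. \<forall>j\<ge>N. intrinsic_dist \<Sigma> (X i) (X j) < \<epsilon>" by blast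
  qed
  then obtain P where P: "P \<in> \<Sigma>" "(\<lambda>i. intrinsic_dist \<Sigma> (X i) P) \<longlonglongrightarrow> 0"
    using complete XS unfolding complete_hypersurface_def by blast
  then obtain p where p: "p \<in> D" "P = (p, u p)" by (auto simp: graph graph_over_def)
  \<comment> \<open>Euclidean distance is at most intrinsic distance, so the limit supplied by
    completeness is also the Euclidean limit, and its horizontal part is x + d.\<close>
  have "dist (X i) P \<le> intrinsic_dist \<Sigma> (X i) P" for i
    unfolding X_def p(2)
    by (rule dist_le_intrinsic_dist[OF curve_lengths_nonempty[OF seg[OF r] p(1)]])
  then have "(\<lambda>i. dist (X i) P) \<longlonglongrightarrow> 0"
    by (intro tendsto_sandwich[OF _ _ tendsto_const P(2)]) auto
  then have "X \<longlonglongrightarrow> P" using tendsto_dist_iff by blast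
  then have 1: "(\<lambda>i. x + r i *\<^sub>R d) \<longlonglongrightarrow> p"
    using tendsto_fst[of X P] by (simp add: X_def p)
  have "r \<longlonglongrightarrow> 1 - 0"
    unfolding r_def by (intro tendsto_diff tendsto_const LIMSEQ_Suc lim_1_over_n)
  then have "(\<lambda>i. x + r i *\<^sub>R d) \<longlonglongrightarrow> x + 1 *\<^sub>R d"
    by (intro tendsto_intros) simp
  then have "x + d = p" using LIMSEQ_unique[OF 1] by simp
  then show ?thesis using p by simp
qed

text \<open>Consider the first parameter at which the segment from x to y leaves \<open>D\<close>.
  Before it the graph stays below C, so \<open>bounded_segment_end\<close> puts the exit point into
  \<open>D\<close>.\<close>

lemma bounded_ray_mem:
  assumes x: "x \<in> D"
    and bd: "\<And>l. 0 \<le> l \<Longrightarrow> l < 1 \<Longrightarrow> x + l *\<^sub>R (y - x) \<in> D \<Longrightarrow> u (x + l *\<^sub>R (y - x)) \<le> C"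
  shows "y \<in> D"
proof (rule ccontr)
  assume y: "y \<notin> D"
  define B where "B = {0..1} \<inter> (\<lambda>l. x + l *\<^sub>R (y - x)) -` (- D)"
  have "closed ((\<lambda>l::real. x + l *\<^sub>R (y - x)) -` (- D))"
    using open_D by (intro closed_vimage continuous_intros) auto
  then have "compact B" unfolding B_def by (intro compact_Int_closed) auto
  moreover have "1 \<in> B" using y by (simp add: B_def)
  ultimately obtain l where l: "l \<in> B" "\<And>k. k \<in> B \<Longrightarrow> l \<le> k"
    using compact_attains_inf[of B] by blast
  have "x + 0 *\<^sub>R (y - x) \<in> D" using x by simp
  then have "l > 0" using l(1) by (auto simp: B_def intro: ccontr)
  have le1: "l \<le> 1" using l(1) by (simp add: B_def)
  have "k * l \<notin> B" "0 \<le> k * l" "k * l < 1" if "0 \<le> k" "k < 1" for k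
  proof -
    have "k * l < l" using that \<open>l > 0\<close> by simp
    then show "k * l \<notin> B" "k * l < 1" using l(2)[of "k * l"] le1 by auto
    show "0 \<le> k * l" using that \<open>l > 0\<close> by simp
  qed
  then have "x + k *\<^sub>R (l *\<^sub>R (y - x)) \<in> D" "u (x + k *\<^sub>R (l *\<^sub>R (y - x))) \<le> C"
    if "0 \<le> k" "k < 1" for k
    using that bd[of "k * l"] by (auto simp: B_def le_less)
  then have "x + l *\<^sub>R (y - x) \<in> D" by (rule bounded_segment_end)
  then show False using l(1) by (simp add: B_def)
qed

text \<open>Both end points lie above the tangent plane at the intermediate point, so the
  combination of the two tangent inequalities loses its gradient terms.\<close>

lemma graph_convex_ineq:
  assumes "x \<in> D" "y \<in> D" "0 \<le> l" "l \<le> 1" "x + l *\<^sub>R (y - x) \<in> D"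
  shows "u (x + l *\<^sub>R (y - x)) \<le> (1 - l) * u x + l * u y"
proof -
  let ?w = "x + l *\<^sub>R (y - x)"
  have "(1 - l) * (u ?w + q ?w \<bullet> (x - ?w)) + l * (u ?w + q ?w \<bullet> (y - ?w)) \<le> (1 - l) * u x + l * u y"
    using tangent_le[OF assms(5,1)] tangent_le[OF assms(5,2)] assms(3,4)
    by (intro add_mono mult_left_mono) auto
  moreover have "(1 - l) * (u ?w + q ?w \<bullet> (x - ?w)) + l * (u ?w + q ?w \<bullet> (y - ?w)) = u ?w"
    by (simp add: inner_diff_right inner_add_right algebra_simps)
  ultimately show ?thesis by simp
qed

lemma graph_max_ineq:
  assumes "x \<in> D" "y \<in> D" "0 \<le> l" "l \<le> 1" "x + l *\<^sub>R (y - x) \<in> D"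
  shows "u (x + l *\<^sub>R (y - x)) \<le> max (u x) (u y)"
proof -
  have "(1 - l) * u x + l * u y \<le> (1 - l) * max (u x) (u y) + l * max (u x) (u y)"
    using assms by (intro add_mono mult_left_mono) auto
  then show ?thesis using graph_convex_ineq[OF assms] by (simp add: algebra_simps)
qed

end

subsection \<open>Space-time regularity of the graph function\<close>

lemma thick_time_slab: "0 < T \<Longrightarrow> thick (UNIV \<times> {0..<T} :: ('a::euclidean_space \<times> real) set)"
  unfolding thick_def
proof (intro ballI allI impI)
  fix z i :: "'a \<times> real" and e :: real
  assume z: "z \<in> UNIV \<times> {0..<T}" and i: "i \<in> Basis" and e: "e > 0"
  obtain x t where xt: "z = (x, t)" "0 \<le> t" "t < T" using z by (cases z) auto
  define d where "d = min e (T - t) / 2"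
  have d: "0 < d" "d < e" "t + d < T" using e xt by (auto simp: d_def min_def field_simps)
  have "z + d *\<^sub>R i \<in> UNIV \<times> {0..<T}"
    using i d xt by (auto simp: Basis_prod_def)
  then show "\<exists>d. 0 < \<bar>d\<bar> \<and> \<bar>d\<bar> < e \<and> z + d *\<^sub>R i \<in> UNIV \<times> {0..<T}"
    using d by (intro exI[of _ d]) auto
qed

text \<open>Continuity of a derivative is known direction by direction; this converts it into
  control of the operator norm.\<close>

lemma norm_linear_le_basis:
  fixes L :: "real^'n::finite \<Rightarrow> 'b::real_normed_vector"
  assumes "linear L"
  shows "norm (L v) \<le> norm v * (\<Sum>i\<in>UNIV. norm (L (axis i 1)))"
proof -
  have "L v = L (\<Sum>i\<in>UNIV. (v $ i) *\<^sub>R axis i 1)"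
    using basis_expansion[of v] by (simp add: scalar_mult_eq_scaleR)
  also have "\<dots> = (\<Sum>i\<in>UNIV. (v $ i) *\<^sub>R L (axis i 1))"
    using assms by (simp add: linear_sum linear_scale)
  also have "norm \<dots> \<le> (\<Sum>i\<in>UNIV. norm v * norm (L (axis i 1)))"
    using component_le_norm_cart[of v] by (intro sum_norm_le) (auto intro: mult_right_mono)
  finally show ?thesis by (simp add: sum_distrib_left)
qed

text \<open>Invariance of domain needs an open set, so time is reflected at \<open>t = 0\<close>.\<close>

lemma fibred_local_inverse:
  fixes a :: "(real^'n::finite) \<times> real \<Rightarrow> real^'n"
  assumes W: "open W" and a: "smooth_on (W \<times> {0..<T}) a" and z0: "(x0, s0) \<in> W \<times> {0..<T}"
    and a': "\<And>z. z \<in> W \<times> {0..<T} \<Longrightarrow> (a has_derivative a' z) (at z within W \<times> {0..<T})"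
    and a'C: "\<And>k v. Ck_on k (W \<times> {0..<T}) (\<lambda>z. a' z v)"
    and inj: "\<And>v. a' (x0, s0) (v, 0) = 0 \<Longrightarrow> v = 0"
  obtains S V g where "S \<subseteq> W \<times> {0..<T}" "(x0, s0) \<in> S" "open V"
    "(\<lambda>z. (a z, snd z)) ` S = (UNIV \<times> {0..<T}) \<inter> V"
    "\<And>z. z \<in> S \<Longrightarrow> g (a z, snd z) = z"
    "\<And>k. Ck_on k ((\<lambda>z. (a z, snd z)) ` S) g"
proof -
  let ?S = "W \<times> {0..<T}"
  have lin: "linear (\<lambda>v. a' z (v, 0))" if "z \<in> ?S" for z
  proof -
    have "linear (\<lambda>v::real^'n. (v, 0::real))" by (auto intro!: linearI)
    from linear_compose[OF this has_derivative_linear[OF a'[OF that]]] show ?thesis by (simp add: o_def)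
  qed
  define L where "L v = a' (x0, s0) (v, 0)" for v
  have linL: "linear L" unfolding L_def by (rule lin[OF z0])
  have "inj L" using inj by (simp add: linear_injective_0[OF linL] L_def)
  then obtain B where B: "B > 0" "\<And>v. B * norm v \<le> norm (L v)"
    using linear_inj_bounded_below_pos[OF linL] by blast
  \<comment> \<open>Bounds the operator norm of the deviation of the spatial derivative at
    \<open>z\<close> from \<open>L\<close>, and is continuous because each direction is.\<close>
  define \<epsilon> where "\<epsilon> z = (\<Sum>i\<in>UNIV. norm (a' z (axis i 1, 0) - L (axis i 1)))" for z
  have "continuous_on ?S \<epsilon>"
    unfolding \<epsilon>_def by (intro continuous_intros Ck_on_imp_continuous_on[OF a'C])
  moreover have "\<epsilon> (x0, s0) = 0" by (simp add: \<epsilon>_def L_def)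
  ultimately obtain r where r: "r > 0" "\<And>z. z \<in> ?S \<Longrightarrow> dist z (x0, s0) < r \<Longrightarrow> \<epsilon> z < B / 2"
    using z0 B(1) unfolding continuous_on_iff dist_real_def
    by (metis abs_less_iff diff_zero half_gt_zero)
  obtain r2 where r2: "r2 > 0" "ball x0 r2 \<subseteq> W"
    using W z0 open_contains_ball by (metis mem_Sigma_iff)
  define \<rho> where "\<rho> = min (r / 2) r2"
  have \<rho>: "\<rho> > 0" "\<rho> \<le> r / 2" "ball x0 \<rho> \<subseteq> W" using r r2 by (auto simp: \<rho>_def)
  \<comment> \<open>The time window together with its mirror image, so that \<open>U\<close> is open
    even when s0 = 0.\<close>
  define I where "I = {t. \<bar>t\<bar> < T \<and> \<bar>\<bar>t\<bar> - s0\<bar> < \<rho>}"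
  define U where "U = ball x0 \<rho> \<times> I"
  define S where "S = ball x0 \<rho> \<times> {t \<in> {0..<T}. \<bar>t - s0\<bar> < \<rho>}"
  have S_sub: "S \<subseteq> ?S" using \<rho> by (auto simp: S_def)
  have z0S: "(x0, s0) \<in> S" using z0 \<rho> by (auto simp: S_def)
  have near: "\<epsilon> z < B / 2" if "z \<in> S" for z
  proof (rule r(2))
    show "z \<in> ?S" using S_sub that by blast
    obtain x t where xt: "z = (x, t)" by (cases z)
    have "dist z (x0, s0) \<le> dist x x0 + dist t s0"
      unfolding xt dist_Pair_Pair using sqrt_sum_squares_le_sum[of "dist x x0" "dist t s0"] by simp
    also have "\<dots> < \<rho> + \<rho>"
      using that by (intro add_strict_mono) (auto simp: S_def xt dist_commute dist_real_def)
    finally show "dist z (x0, s0) < r" using \<rho> by simp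
  qed
  have opdiff: "norm (a' z (v, 0) - L v) \<le> B / 2 * norm v" if "z \<in> S" for z v
  proof -
    have "linear (\<lambda>v. a' z (v, 0) - L v)"
      using lin linL that S_sub by (intro linear_compose_sub) auto
    from norm_linear_le_basis[OF this, of v]
    have "norm (a' z (v, 0) - L v) \<le> norm v * \<epsilon> z" by (simp add: \<epsilon>_def)
    also have "\<dots> \<le> norm v * (B / 2)" using near[OF that] by (intro mult_left_mono) auto
    finally show ?thesis by (simp add: mult.commute)
  qed
  have inj': "v = 0" if "z \<in> S" "a' z (v, 0) = 0" for z v
  proof (rule ccontr)
    assume "v \<noteq> 0"
    then have "B * norm v > B / 2 * norm v" using B(1) by simp
    then show False using opdiff[OF that(1), of v] B(2)[of v] that(2) by simp
  qed
  \<comment> \<open>On each time slice \<open>a\<close> is \<open>L\<close> plus a map with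
    Lipschitz constant B/2, half of the lower bound B of \<open>L\<close>. Hence it is injective
    there, on a ball whose radius does not depend on the time.\<close>
  have sep: "B / 2 * norm (x - y) \<le> norm (a (x, t) - a (y, t))"
    if st: "(x, t) \<in> S" "(y, t) \<in> S" for x y t
  proof -
    define \<phi> where "\<phi> x = a (x, t) - L x" for x
    have t: "(x, t) \<in> S" if "x \<in> ball x0 \<rho>" for x
      using that st by (auto simp: S_def)
    have "norm (\<phi> x - \<phi> y) \<le> B / 2 * norm (x - y)"
    proof (rule differentiable_bound[OF convex_ball])
      fix x assume x: "x \<in> ball x0 \<rho>"
      have "((\<lambda>x. a (x, t)) has_derivative (\<lambda>v. a' (x, t) (v, 0))) (at x within ball x0 \<rho>)"
      proof (rule has_derivative_in_compose[where g = a and f = "\<lambda>x. (x, t)"])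
        show "(a has_derivative a' (x, t)) (at (x, t) within (\<lambda>x. (x, t)) ` ball x0 \<rho>)"
        proof (rule has_derivative_subset[OF a'])
          show "(x, t) \<in> ?S" using t[OF x] S_sub by blast
          show "(\<lambda>x. (x, t)) ` ball x0 \<rho> \<subseteq> ?S" using t S_sub by blast
        qed
      qed (auto intro!: derivative_eq_intros)
      then show "(\<phi> has_derivative (\<lambda>v. a' (x, t) (v, 0) - L v)) (at x within ball x0 \<rho>)"
        unfolding \<phi>_def
        by (intro has_derivative_diff linear_imp_has_derivative linL)
      show "onorm (\<lambda>v. a' (x, t) (v, 0) - L v) \<le> B / 2"
        using opdiff[OF t[OF x]] by (intro onorm_le)
    qed (use st in \<open>auto simp: S_def\<close>)
    moreover have "L (x - y) = L x - L y" using linL by (simp add: linear_diff)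
    then have "a (x, t) - a (y, t) = L (x - y) + (\<phi> x - \<phi> y)" by (simp add: \<phi>_def)
    ultimately have "norm (a (x, t) - a (y, t)) \<ge> norm (L (x - y)) - B / 2 * norm (x - y)"
      by (smt (verit) norm_diff_ineq)
    then show ?thesis using B(2)[of "x - y"] by (simp add: field_simps)
  qed
  \<comment> \<open>Evaluating \<open>a\<close> at |t| extends the map continuously to negative
    times. Smoothness at t = 0 may be lost, but invariance of domain asks only for continuity and
    injectivity.\<close>
  define \<Psi> where "\<Psi> z = (a (fst z, \<bar>snd z\<bar>), snd z)" for z :: "(real^'n) \<times> real"
  have refl: "(fst z, \<bar>snd z\<bar>) \<in> S" if "z \<in> U" for z
    using that by (auto simp: U_def S_def I_def)
  have "open I"
    unfolding I_def by (intro open_Collect_conj open_Collect_less continuous_intros)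
  then have openU: "open U" unfolding U_def by (intro open_Times) auto
  have contU: "continuous_on U \<Psi>"
    unfolding \<Psi>_def
  proof (intro continuous_intros)
    have "continuous_on ?S a" using a Ck_on_imp_continuous_on by (auto simp: smooth_on_def)
    then show "continuous_on U (\<lambda>z. a (fst z, \<bar>snd z\<bar>))"
    proof (rule continuous_on_compose2[of ?S a])
      show "continuous_on U (\<lambda>z. (fst z, \<bar>snd z\<bar>))" by (intro continuous_intros)
      show "(\<lambda>z. (fst z, \<bar>snd z\<bar>)) ` U \<subseteq> ?S" using refl S_sub by blast
    qed
  qed
  have injU: "inj_on \<Psi> U"
  proof (rule inj_onI)
    fix z w assume zw: "z \<in> U" "w \<in> U" "\<Psi> z = \<Psi> w"
    then have s: "snd z = snd w" and e: "a (fst z, \<bar>snd z\<bar>) = a (fst w, \<bar>snd z\<bar>)"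
      by (auto simp: \<Psi>_def)
    have "B / 2 * norm (fst z - fst w) \<le> 0"
      using sep[of "fst z" "\<bar>snd z\<bar>" "fst w"] refl[OF zw(1)] refl[OF zw(2)] s e by simp
    then have "fst z = fst w" using B(1) by (simp add: mult_le_0_iff)
    then show "z = w" using s by (simp add: prod_eq_iff)
  qed
  have openV: "open (\<Psi> ` U)" by (rule invariance_of_domain[OF contU openU injU])
  obtain g where g: "homeomorphism U (\<Psi> ` U) \<Psi> g"
    using invariance_of_domain_homeomorphism[OF openU contU _ injU] by auto
  have SU: "S \<subseteq> U" using z0 by (auto simp: S_def U_def I_def)
  have \<Psi>S: "\<Psi> z = (a z, snd z)" if "z \<in> S" for z
    using that by (auto simp: S_def \<Psi>_def)
  have im: "(\<lambda>z. (a z, snd z)) ` S = (UNIV \<times> {0..<T}) \<inter> \<Psi> ` U"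
  proof (intro set_eqI iffI)
    fix y assume "y \<in> (\<lambda>z. (a z, snd z)) ` S"
    then show "y \<in> (UNIV \<times> {0..<T}) \<inter> \<Psi> ` U"
      using \<Psi>S SU S_sub by force
  next
    fix y assume "y \<in> (UNIV \<times> {0..<T}) \<inter> \<Psi> ` U"
    then have y: "0 \<le> snd y" "y \<in> \<Psi> ` U" by (cases y, simp)+
    then obtain z where z: "z \<in> U" "y = \<Psi> z" "0 \<le> snd y" by blast
    then have "z \<in> S" using refl[OF z(1)] by (cases z) (auto simp: \<Psi>_def)
    then show "y \<in> (\<lambda>z. (a z, snd z)) ` S" using z \<Psi>S by auto
  qed
  have gS: "g (a z, snd z) = z" if "z \<in> S" for z
    using g SU that \<Psi>S[OF that] unfolding homeomorphism_def by (metis subsetD)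
  have contg: "continuous_on ((\<lambda>z. (a z, snd z)) ` S) g"
    unfolding im using g continuous_on_subset homeomorphism_def by (metis Int_lower2)
  have Ck: "Ck_on (Suc k) ((\<lambda>z. (a z, snd z)) ` S) g" for k
  proof (rule Ck_on_inverse_fibred[where a' = a'])
    show "Ck_on (Suc k) S a" using a unfolding smooth_on_def by (intro Ck_on_subset[OF _ S_sub]) blast
    show "(a has_derivative a' z) (at z within S)" if "z \<in> S" for z
      using has_derivative_subset[OF a' S_sub] that S_sub by blast
    show "Ck_on (Suc k - 1) S (\<lambda>z. a' z v)" for v using Ck_on_subset[OF a'C S_sub] .
  qed (use inj' gS contg in auto)
  show thesis
    by (rule that[OF S_sub z0S openV im gS Ck_on_SucD[OF Ck]])
qed

locale gcf_flow =
  fixes A :: "('m::{second_countable_topology, t2_space}, 'n::finite) chart set"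
    and \<alpha> T :: real and \<Sigma>0 :: "'n space set" and F :: "'m \<Rightarrow> real \<Rightarrow> 'n space"
  assumes T_pos: "0 < T" and atlas: "smooth_atlas A" and sol: "gcf_graph_solution A \<alpha> T \<Sigma>0 F"
begin

definition dom_at :: "real \<Rightarrow> (real^'n) set" where "dom_at s = fst ` slice F s"

text \<open>The solution provides a domain and a graph function for each time by an existence
  statement. Reading the height off the slice gives a single function of space and time.\<close>

definition hgt :: "(real^'n) \<times> real \<Rightarrow> real" where
  "hgt z = (THE h. (fst z, h) \<in> slice F (snd z))"

definition spacetime :: "((real^'n) \<times> real) set" where "spacetime = {z. snd z \<in> {0..<T} \<and> fst z \<in> dom_at (snd z)}"

lemma spacetime_iff [simp]: "(x, s) \<in> spacetime \<longleftrightarrow> s \<in> {0..<T} \<and> x \<in> dom_at s"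
  by (simp add: spacetime_def)

lemma slice_graph:
  assumes "s \<in> {0..<T}"
  shows "open (dom_at s)" "connected (dom_at s)" "slice F s = graph_over (dom_at s) (\<lambda>x. hgt (x, s))"
proof -
  obtain D u where D: "open D" "connected D" "slice F s = graph_over D u"
    using sol assms unfolding gcf_graph_solution_def by blast
  have dom_at: "dom_at s = D" unfolding dom_at_def D(3) by (force simp: graph_over_def)
  then show "open (dom_at s)" "connected (dom_at s)" using D by auto
  have "hgt (x, s) = u x" if "x \<in> D" for x
    unfolding hgt_def D(3) using that by (auto simp: D(3) graph_over_def)
  then show "slice F s = graph_over (dom_at s) (\<lambda>x. hgt (x, s))"
    unfolding dom_at using D(3) by (auto simp: graph_over_def)
qed

lemma F_slice: "F p s \<in> slice F s" by (auto simp: slice_def)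

lemma F_graph:
  assumes "s \<in> {0..<T}"
  shows "fst (F p s) \<in> dom_at s" "F p s = (fst (F p s), hgt (fst (F p s), s))"
  using F_slice[of p s] unfolding slice_graph(3)[OF assms] by (auto simp: graph_over_def)

lemma slice_point:
  assumes "s \<in> {0..<T}" "x \<in> dom_at s"
  obtains p where "F p s = (x, hgt (x, s))"
proof -
  have "(x, hgt (x, s)) \<in> slice F s"
    using assms(2) unfolding slice_graph(3)[OF assms(1)] by (auto simp: graph_over_def)
  then show thesis using that by (metis (no_types, lifting) slice_def rangeE)
qed

lemma slice_props:
  assumes "s \<in> {0..<T}"
  shows "complete_hypersurface (slice F s)" "strictly_convex_hypersurface (slice F s)"
  using sol assms by (auto simp: gcf_graph_solution_def)

lemma chart:
  obtains V c where "(V, c) \<in> A" "p \<in> V" "open (c ` V)" "inv_into V c (c p) = p"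
    "smooth_on (c ` V \<times> {0..<T}) (\<lambda>z. F (inv_into V c (fst z)) (snd z))"
    "\<And>s x. s \<in> {0..<T} \<Longrightarrow> x \<in> c ` V \<Longrightarrow>
      inj (frechet_derivative (\<lambda>y. F (inv_into V c y) s) (at x))"
proof -
  have "p \<in> (\<Union>(U, c)\<in>A. U)" using atlas by (auto simp: smooth_atlas_def)
  then obtain V c where Vc: "(V, c) \<in> A" "p \<in> V" by auto
  then have h: "open (c ` V)" "homeomorphism V (c ` V) c (inv_into V c)"
    using atlas by (auto simp: smooth_atlas_def)
  have "smooth_family_of_immersions A T F" using sol by (simp add: gcf_graph_solution_def)
  then have "smooth_on (c ` V \<times> {0..<T}) (\<lambda>(x, t). F (inv_into V c x) t)"
    "\<And>s x. s \<in> {0..<T} \<Longrightarrow> x \<in> c ` V \<Longrightarrow>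
      inj (frechet_derivative (\<lambda>y. F (inv_into V c y) s) (at x))"
    using Vc(1) unfolding smooth_family_of_immersions_def by blast+
  then show thesis
    using that[OF Vc h(1)] h(2) Vc(2) by (auto simp: homeomorphism_def case_prod_beta')
qed

text \<open>The tangent plane of a slice is not vertical, since it is a supporting plane of a graph
  over an open set. So the horizontal part of the flow in a chart has an invertible spatial
  derivative, and \<open>hgt\<close> is the vertical part composed with the local inverse. The
  relatively open image of the inverse function argument also shows that points near in space and
  time belong to the domains of their slices.\<close>

lemma local_regularity:
  assumes s0: "s0 \<in> {0..<T}"
  obtains V where "open V" "(fst (F p s0), s0) \<in> V" "(UNIV \<times> {0..<T}) \<inter> V \<subseteq> spacetime"
    "\<And>k. Ck_on k ((UNIV \<times> {0..<T}) \<inter> V) hgt"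
proof -
  obtain U c where Uc: "(U, c) \<in> A" "p \<in> U" "open (c ` U)" "inv_into U c (c p) = p"
    and sm: "smooth_on (c ` U \<times> {0..<T}) (\<lambda>z. F (inv_into U c (fst z)) (snd z))"
    and imm: "\<And>s x. s \<in> {0..<T} \<Longrightarrow> x \<in> c ` U \<Longrightarrow>
      inj (frechet_derivative (\<lambda>y. F (inv_into U c y) s) (at x))"
    by (rule chart[of p], rule that, assumption+)
  let ?W = "c ` U" and ?S = "c ` U \<times> {0..<T}"
  define f where "f z = F (inv_into U c (fst z)) (snd z)" for z :: "(real^'n) \<times> real"
  have f: "Ck_on k ?S f" for k using sm by (simp add: smooth_on_def f_def[abs_def])
  have thickS: "thick ?S"
  proof -
    have "?S = (UNIV \<times> {0..<T}) \<inter> (?W \<times> UNIV)" by auto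
    then show ?thesis
      using thick_Int_open[OF thick_time_slab[OF T_pos] open_Times[OF Uc(3) open_UNIV]] by metis
  qed
  have f': "(f has_derivative (\<lambda>v. pder ?S v f z)) (at z within ?S)" if "z \<in> ?S" for z
    using Ck_on_pder(2)[OF thickS f that] .
  have f'C: "Ck_on k ?S (pder ?S v f)" for k v
    using Ck_on_pder(1)[OF thickS f] .
  let ?a = "\<lambda>z. fst (f z)" and ?a' = "\<lambda>z v. fst (pder ?S v f z)"
  have z0: "(c p, s0) \<in> ?S" using Uc(2) s0 by auto
  have fz: "f (c p, s0) = F p s0" by (simp add: f_def Uc(4))
  let ?x = "fst (F p s0)"
  have x: "?x \<in> dom_at s0" "F p s0 = (?x, hgt (?x, s0))" using F_graph[OF s0] by auto
  obtain b where b: "b \<noteq> 0" "\<And>Q. Q \<in> convex hull (slice F s0) \<Longrightarrow> b \<bullet> F p s0 \<le> b \<bullet> Q"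
    using strictly_convex_support[OF slice_props(2)[OF s0] F_slice] by blast
  have b_le: "b \<bullet> F p s0 \<le> b \<bullet> Q" if "Q \<in> slice F s0" for Q
    using b(2) hull_inc[OF that] by blast
  have "b \<bullet> (?x, hgt (?x, s0)) \<le> b \<bullet> (y, hgt (y, s0))" if "y \<in> dom_at s0" for y
    unfolding x(2)[symmetric] using that slice_graph(3)[OF s0] by (intro b_le) (auto simp: graph_over_def)
  then have sb: "snd b \<noteq> 0"
    using graph_support_not_vertical[OF slice_graph(1)[OF s0] x(1) b(1), of "\<lambda>y. hgt (y, s0)"] by blast
  have fs: "((\<lambda>y. f (y, s0)) has_derivative (\<lambda>v. pder ?S (v, 0) f (c p, s0))) (at (c p))"
  proof -
    have "((\<lambda>y. f (y, s0)) has_derivative (\<lambda>v. pder ?S (v, 0) f (c p, s0))) (at (c p) within ?W)"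
    proof (rule has_derivative_in_compose[where g = f and f = "\<lambda>y. (y, s0)"
          and f' = "\<lambda>v. (v, 0)" and g' = "\<lambda>v. pder ?S v f (c p, s0)"])
      show "(f has_derivative (\<lambda>v. pder ?S v f (c p, s0))) (at (c p, s0) within (\<lambda>y. (y, s0)) ` ?W)"
        using s0 by (intro has_derivative_subset[OF f'[OF z0]]) auto
    qed (auto intro!: derivative_eq_intros)
    then show ?thesis using at_within_open[OF _ Uc(3)] Uc(2) by simp
  qed
  have "((\<lambda>y. b \<bullet> f (y, s0)) has_derivative (\<lambda>v. b \<bullet> pder ?S (v, 0) f (c p, s0))) (at (c p))"
    using fs by (auto intro!: derivative_eq_intros)
  then have "(\<lambda>v. b \<bullet> pder ?S (v, 0) f (c p, s0)) = (\<lambda>v. 0)"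
    by (rule differential_zero_maxmin[OF imageI[OF Uc(2)] Uc(3)])
      (use b_le in \<open>auto simp: fz f_def F_slice Uc(4)\<close>)
  then have orth: "b \<bullet> pder ?S (v, 0) f (c p, s0) = 0" for v by meson
  have inj: "v = 0" if "?a' (c p, s0) (v, 0) = 0" for v
  proof -
    have "pder ?S (v, 0) f (c p, s0) = 0"
      using orth[of v] that sb by (simp add: inner_prod_def prod_eq_iff)
    moreover have "pder ?S (0, 0) f (c p, s0) = 0"
      using linear_0[OF has_derivative_linear[OF fs]] by simp
    moreover have "inj (\<lambda>v. pder ?S (v, 0) f (c p, s0))"
      using imm[OF s0, of "c p"] Uc(2) frechet_derivative_at[OF fs] by (simp add: f_def)
    ultimately show ?thesis by (metis (no_types, lifting) injD)
  qed
  obtain S V g where S: "S \<subseteq> ?S" "(c p, s0) \<in> S" "open V"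
    "(\<lambda>z. (?a z, snd z)) ` S = (UNIV \<times> {0..<T}) \<inter> V"
    "\<And>z. z \<in> S \<Longrightarrow> g (?a z, snd z) = z"
    "\<And>k. Ck_on k ((\<lambda>z. (?a z, snd z)) ` S) g"
  proof (rule fibred_local_inverse[OF Uc(3) _ z0, where a = ?a and a' = ?a'])
    show "smooth_on ?S ?a"
      using Ck_on_linear_compose[OF bounded_linear_fst f] by (simp add: smooth_on_def)
    show "(?a has_derivative ?a' z) (at z within ?S)" if "z \<in> ?S" for z
      using has_derivative_fst[OF f'[OF that]] .
    show "Ck_on k ?S (\<lambda>z. ?a' z v)" for k v
      using Ck_on_linear_compose[OF bounded_linear_fst f'C] .
  qed (use inj in auto)
  let ?R = "(UNIV \<times> {0..<T}) \<inter> V"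
  have mem: "(?a z, snd z) \<in> spacetime \<and> snd (f z) = hgt (?a z, snd z)" if "z \<in> S" for z
  proof -
    have t: "snd z \<in> {0..<T}" using S(1) that by auto
    then show ?thesis
      using F_graph[OF t, of "inv_into U c (fst z)"] by (auto simp: f_def prod_eq_iff)
  qed
  have hgt_eq: "hgt y = snd (f (g y))" if "y \<in> ?R" for y
    using that mem S(5) unfolding S(4)[symmetric] by auto
  have "Ck_on k ?R (\<lambda>y. snd (f (g y)))" for k
  proof (rule Ck_on_linear_compose[OF bounded_linear_snd])
    show "Ck_on k ?R (\<lambda>y. f (g y))"
      using S(6)[of k] S(1,5) unfolding S(4)[symmetric] by (intro Ck_on_compose[OF f]) auto
  qed
  then have "Ck_on k ?R hgt" for k by (rule Ck_on_cong) (simp add: hgt_eq)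
  moreover have "?R \<subseteq> spacetime" using mem unfolding S(4)[symmetric] by auto
  moreover have "(?x, s0) \<in> V" using S(2,4) fz by force
  ultimately show thesis using that S(3) by blast
qed

lemma spacetime_subset: "spacetime \<subseteq> UNIV \<times> {0..<T}"
  by (auto simp: spacetime_def)

lemma spacetime_relatively_open: "\<exists>V. open V \<and> spacetime = (UNIV \<times> {0..<T}) \<inter> V"
proof -
  have "\<exists>V. open V \<and> z \<in> V \<and> (UNIV \<times> {0..<T}) \<inter> V \<subseteq> spacetime" if z: "z \<in> spacetime" for z
  proof -
    obtain p where p: "F p (snd z) = (fst z, hgt (fst z, snd z))"
      using slice_point[of "snd z" "fst z"] z by (auto simp: spacetime_def)
    have "snd z \<in> {0..<T}" using z by (auto simp: spacetime_def)
    from local_regularity[OF this, of p] obtain V where "open V" "(fst (F p (snd z)), snd z) \<in> V"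
      "(UNIV \<times> {0..<T}) \<inter> V \<subseteq> spacetime" by metis
    then show ?thesis using p by auto
  qed
  then obtain V where V: "\<forall>z\<in>spacetime. open (V z) \<and> z \<in> V z \<and> (UNIV \<times> {0..<T}) \<inter> V z \<subseteq> spacetime"
    by metis
  have "spacetime = (UNIV \<times> {0..<T}) \<inter> (\<Union>z\<in>spacetime. V z)"
    using V spacetime_subset by blast
  moreover have "open (\<Union>z\<in>spacetime. V z)" using V by blast
  ultimately show ?thesis by blast
qed

lemma thick_spacetime: "thick spacetime"
  using spacetime_relatively_open thick_Int_open[OF thick_time_slab[OF T_pos]] by metis

lemma Ck_hgt: "Ck_on k spacetime hgt"
proof (rule Ck_on_local[OF thick_spacetime])
  fix z assume z: "z \<in> spacetime"
  obtain p where p: "F p (snd z) = (fst z, hgt (fst z, snd z))"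
    using slice_point[of "snd z" "fst z"] z by (auto simp: spacetime_def)
  have "snd z \<in> {0..<T}" using z by (auto simp: spacetime_def)
  from local_regularity[OF this, of p] obtain V where V: "open V" "(fst (F p (snd z)), snd z) \<in> V"
      "(UNIV \<times> {0..<T}) \<inter> V \<subseteq> spacetime" "Ck_on k ((UNIV \<times> {0..<T}) \<inter> V) hgt" by metis
  have "Ck_on k (spacetime \<inter> V) hgt" using spacetime_subset by (intro Ck_on_subset[OF V(4)]) auto
  then show "\<exists>V. open V \<and> z \<in> V \<and> Ck_on k (spacetime \<inter> V) hgt"
    using V p by (intro exI[of _ V]) auto
qed

section \<open>Space-time derivatives, the gradient and the Hessian\<close>

abbreviation dd :: "(real^'n) \<times> real \<Rightarrow> ((real^'n) \<times> real \<Rightarrow> 'b::real_normed_vector) \<Rightarrow> _" where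
  "dd \<equiv> pder spacetime"

lemma Ck_dd: "(\<And>k. Ck_on k spacetime f) \<Longrightarrow> Ck_on k spacetime (dd v f)"
  using Ck_on_pder(1)[OF thick_spacetime] by blast

lemma has_derivative_dd:
  "(\<And>k. Ck_on k spacetime f) \<Longrightarrow> z \<in> spacetime \<Longrightarrow> (f has_derivative (\<lambda>v. dd v f z)) (at z within spacetime)"
  using Ck_on_pder(2)[OF thick_spacetime] by blast

lemma has_derivative_slice:
  assumes f: "\<And>k. Ck_on k spacetime f" and s: "s \<in> {0..<T}" and x: "x \<in> dom_at s"
  shows "((\<lambda>y. f (y, s)) has_derivative (\<lambda>v. dd (v, 0) f (x, s))) (at x)"
proof -
  have "((\<lambda>y. f (y, s)) has_derivative (\<lambda>v. dd (v, 0) f (x, s))) (at x within dom_at s)"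
  proof (rule has_derivative_in_compose[where g = f and f = "\<lambda>y. (y, s)"
        and f' = "\<lambda>v. (v, 0)" and g' = "\<lambda>v. dd v f (x, s)"])
    show "(f has_derivative (\<lambda>v. dd v f (x, s))) (at (x, s) within (\<lambda>y. (y, s)) ` dom_at s)"
      using s x by (intro has_derivative_subset[OF has_derivative_dd[OF f]]) auto
  qed (auto intro!: derivative_eq_intros)
  then show ?thesis using at_within_open[OF x slice_graph(1)[OF s]] by simp
qed

lemma Ck_slice:
  assumes "Ck_on k spacetime f" "s \<in> {0..<T}" shows "Ck_on k (dom_at s) (\<lambda>y. f (y, s))"
  by (rule Ck_on_compose[OF assms(1) Ck_on_Pair[OF Ck_on_linear[OF bounded_linear_ident] Ck_on_const]])
    (use assms in auto)

lemma pder_slice: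
  assumes f: "\<And>k. Ck_on k spacetime f" and s: "s \<in> {0..<T}" and x: "x \<in> dom_at s"
  shows "pder (dom_at s) v (\<lambda>y. f (y, s)) x = dd (v, 0) f (x, s)"
  using pder_eq[OF thick_open[OF slice_graph(1)[OF s]] x
      has_derivative_at_withinI[OF has_derivative_slice[OF assms]]] .

text \<open>Points at time 0 are boundary points of \<open>spacetime\<close>, so symmetry of second
  derivatives is taken from the slices, which are open and contain the spatial directions.\<close>

lemma dd_commute_spatial:
  fixes f :: "(real^'n) \<times> real \<Rightarrow> real"
  assumes f: "\<And>k. Ck_on k spacetime f" and s: "s \<in> {0..<T}" and x: "x \<in> dom_at s"
  shows "dd (v, 0) (dd (w, 0) f) (x, s) = dd (w, 0) (dd (v, 0) f) (x, s)"
proof -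
  note D = slice_graph(1)[OF s]
  have cong: "pder (dom_at s) v (\<lambda>y. dd (w, 0) f (y, s)) x
      = pder (dom_at s) v (pder (dom_at s) w (\<lambda>y. f (y, s))) x" for v w
  proof (rule pder_eq[OF thick_open[OF D] x])
    have "((\<lambda>y. pder (dom_at s) w (\<lambda>y. f (y, s)) y) has_derivative
        (\<lambda>v. pder (dom_at s) v (pder (dom_at s) w (\<lambda>y. f (y, s))) x)) (at x within dom_at s)"
      by (rule Ck_on_pder(2)[OF thick_open[OF D] Ck_on_pder(1)[OF thick_open[OF D] Ck_slice[OF f s]] x])
    then show "((\<lambda>y. dd (w, 0) f (y, s)) has_derivative
        (\<lambda>v. pder (dom_at s) v (pder (dom_at s) w (\<lambda>y. f (y, s))) x)) (at x within dom_at s)"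
      by (rule has_derivative_transform[OF x, rotated]) (simp add: pder_slice[OF f s])
  qed
  show ?thesis
    using pder_commute[OF D Ck_slice[OF f s] x, of v w]
    unfolding cong[symmetric] pder_slice[OF Ck_dd[OF f] s x] .
qed

definition grad :: "(real^'n) \<times> real \<Rightarrow> real^'n" where
  "grad z = (\<chi> i. dd (axis i 1, 0) hgt z)"

definition hess :: "(real^'n) \<times> real \<Rightarrow> real^'n^'n" where
  "hess z = (\<chi> i j. dd (axis i 1, 0) (dd (axis j 1, 0) hgt) z)"

lemma dd_linear:
  assumes "\<And>k. Ck_on k spacetime f" "z \<in> spacetime" shows "linear (\<lambda>v. dd v f z)"
  using has_derivative_linear[OF has_derivative_dd[OF assms]] .

lemma dd_spatial_expand:
  fixes f :: "(real^'n) \<times> real \<Rightarrow> real"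
  assumes "\<And>k. Ck_on k spacetime f" "z \<in> spacetime"
  shows "dd (v, 0) f z = (\<Sum>i\<in>UNIV. v $ i * dd (axis i 1, 0) f z)"
proof -
  note L = dd_linear[OF assms]
  have "(v, 0::real) = (\<Sum>i\<in>UNIV. (v $ i) *\<^sub>R (axis i 1, 0))"
    using basis_expansion[of v] by (simp add: prod_eq_iff fst_sum snd_sum scalar_mult_eq_scaleR)
  then have "dd (v, 0) f z = dd (\<Sum>i\<in>UNIV. (v $ i) *\<^sub>R (axis i 1, 0)) f z" by simp
  also have "\<dots> = (\<Sum>i\<in>UNIV. dd ((v $ i) *\<^sub>R (axis i 1, 0)) f z)"
    by (rule linear_sum[OF L])
  also have "\<dots> = (\<Sum>i\<in>UNIV. v $ i * dd (axis i 1, 0) f z)"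
    by (simp only: linear_scale[OF L] real_scaleR_def)
  finally show ?thesis .
qed

lemma dd_hgt: "z \<in> spacetime \<Longrightarrow> dd (v, 0) hgt z = grad z \<bullet> v"
  by (subst dd_spatial_expand[OF Ck_hgt]) (simp_all add: grad_def inner_vec_def mult.commute)

lemma Ck_grad: "Ck_on k spacetime grad"
  by (rule Ck_on_vec) (simp add: grad_def Ck_dd[OF Ck_hgt])

lemma dd_grad_nth:
  assumes "z \<in> spacetime" shows "dd v grad z $ i = dd v (dd (axis i 1, 0) hgt) z"
proof -
  have "((\<lambda>z. grad z $ i) has_derivative (\<lambda>v. dd v grad z $ i)) (at z within spacetime)"
    using bounded_linear.has_derivative[OF bounded_linear_vec_nth has_derivative_dd[OF Ck_grad assms]] .
  from pder_eq[OF thick_spacetime assms this] show ?thesis by (simp add: grad_def)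
qed

lemma dd_grad: 
  assumes "z \<in> spacetime" shows "dd (v, 0) grad z = hess z *v v"
proof (rule vec_eq_iff[THEN iffD2], rule allI)
  fix i
  have z: "(fst z, snd z) \<in> spacetime" using assms by simp
  have "dd (v, 0) (dd (axis i 1, 0) hgt) z = (\<Sum>j\<in>UNIV. v $ j * dd (axis j 1, 0) (dd (axis i 1, 0) hgt) z)"
    by (rule dd_spatial_expand[OF Ck_dd[OF Ck_hgt] assms])
  also have "\<dots> = (\<Sum>j\<in>UNIV. v $ j * dd (axis i 1, 0) (dd (axis j 1, 0) hgt) z)"
    using dd_commute_spatial[OF Ck_hgt, of "snd z" "fst z"] assms
    by (intro sum.cong refl arg_cong2[where f = "(*)"]) (simp add: spacetime_def)
  also have "\<dots> = (hess z *v v) $ i"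
    by (simp add: matrix_vector_mult_def hess_def mult.commute)
  finally show "dd (v, 0) grad z $ i = (hess z *v v) $ i" by (simp add: dd_grad_nth[OF assms])
qed

lemma graph_at:
  assumes s: "s \<in> {0..<T}"
  shows "smooth_convex_graph (slice F s) (dom_at s) (\<lambda>x. hgt (x, s)) (\<lambda>x. grad (x, s)) (\<lambda>x. hess (x, s))"
proof
  show "smooth_on (dom_at s) (\<lambda>x. hgt (x, s))"
    using Ck_slice[OF Ck_hgt s] by (simp add: smooth_on_def)
  show "((\<lambda>x. hgt (x, s)) has_derivative (\<bullet>) (grad (x, s))) (at x)" if "x \<in> dom_at s" for x
    using has_derivative_slice[OF Ck_hgt s that] dd_hgt[of "(x, s)"] s that by simp
  show "((\<lambda>x. grad (x, s)) has_derivative (*v) (hess (x, s))) (at x)" if "x \<in> dom_at s" for x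
    using has_derivative_slice[OF Ck_grad s that] dd_grad[of "(x, s)"] s that by simp
  show "transpose (hess (x, s)) = hess (x, s)" if "x \<in> dom_at s" for x
    using dd_commute_spatial[OF Ck_hgt s that] by (simp add: vec_eq_iff transpose_def hess_def)
qed (use slice_graph[OF s] slice_props[OF s] in auto)

end

subsection \<open>Convexity, evolution equation and compactness of sublevel sets\<close>

lemma thick_time_interval: "0 < T \<Longrightarrow> thick {0..<T::real}"
  unfolding thick_def
proof (intro ballI allI impI)
  fix t i e :: real assume t: "t \<in> {0..<T}" and i: "i \<in> Basis" and e: "e > 0"
  define d where "d = min e (T - t) / 2"
  have "0 < d" "d < e" "t + d < T" using e t by (auto simp: d_def min_def field_simps)
  then show "\<exists>d. 0 < \<bar>d\<bar> \<and> \<bar>d\<bar> < e \<and> t + d *\<^sub>R i \<in> {0..<T}"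
    using i t by (intro exI[of _ d]) auto
qed

lemma connected_pos:
  fixes h :: "'a::topological_space \<Rightarrow> real"
  assumes "connected S" "continuous_on S h" "\<And>z. z \<in> S \<Longrightarrow> h z \<noteq> 0" "z \<in> S" "h z > 0" "w \<in> S"
  shows "h w > 0"
proof (rule ccontr)
  assume "\<not> h w > 0"
  then have "h w < 0" using assms(3)[OF assms(6)] by simp
  have "connected (h ` S)" using assms by (intro connected_continuous_image)
  then have "0 \<in> h ` S"
    using assms(4-6) \<open>h w < 0\<close> connected_contains_Icc[of "h ` S" "h w" "h z"] by auto
  then show False using assms(3) by force
qed

lemma positive_definite_det_pos:
  fixes A :: "real^'n::finite^'n"
  assumes sym: "transpose A = A" and pos: "\<And>w. w \<noteq> 0 \<Longrightarrow> w \<bullet> (A *v w) > 0"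
  obtains e :: "'n \<Rightarrow> real^'n" and m where "\<And>i j. e i \<bullet> e j = (if i = j then 1 else 0)"
    "\<And>i. A *v e i = m i *\<^sub>R e i" "\<And>i. m i > 0" "det A = (\<Prod>i\<in>UNIV. m i)" "det A > 0"
proof -
  obtain e :: "'n \<Rightarrow> real^'n" and m where e: "\<And>i j. e i \<bullet> e j = (if i = j then 1 else 0)"
    "\<And>i. A *v e i = m i *\<^sub>R e i"
    using symmetric_matrix_eigenbasis[OF sym] by metis
  have m: "m i > 0" for i
  proof -
    have "e i \<noteq> 0" using e(1)[of i i] by auto
    from pos[OF this] show ?thesis by (simp add: e)
  qed
  have "det A = (\<Prod>i\<in>UNIV. m i)" by (rule det_eigenbasis[OF e])
  moreover have "(\<Prod>i\<in>UNIV. m i) > 0" using m by (simp add: prod_pos)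
  ultimately show thesis using that[OF e m] by simp
qed

lemma continuous_on_matrix_vector_mult [continuous_intros]:
  fixes A :: "'a::topological_space \<Rightarrow> real^'n::finite^'m::finite"
  assumes "continuous_on S A" "continuous_on S v"
  shows "continuous_on S (\<lambda>x. A x *v v x)"
  unfolding matrix_vector_mult_def
  by (intro continuous_on_vec_lambda continuous_on_sum continuous_on_mult continuous_on_component assms)

text \<open>What the conditions on u_0 are good for: the minimum decides the sign of the normal, and
  the bounded sublevel sets give compactness.\<close>

locale proper_gcf_flow = gcf_flow A \<alpha> T \<Sigma>0 F
  for A :: "('m::{second_countable_topology, t2_space}, 'n::finite) chart set"
    and \<alpha> T :: real and \<Sigma>0 :: "'n space set" and F :: "'m \<Rightarrow> real \<Rightarrow> 'n space" +
  assumes \<alpha>_pos: "0 < \<alpha>"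
    and init_min: "\<exists>x\<in>dom_at 0. \<forall>y\<in>dom_at 0. hgt (x, 0) \<le> hgt (y, 0)"
    and init_proper: "bounded {x \<in> dom_at 0. hgt (x, 0) \<le> C}"
begin

definition vnormal :: "(real^'n) \<times> real \<Rightarrow> real" where
  "vnormal z = snd (interior_normal (slice F (snd z)) (fst z, hgt z))"

lemma vnormal_eq: "vnormal (x, s) = smooth_convex_graph.nu (slice F s) (\<lambda>x. hgt (x, s)) x" if "s \<in> {0..<T}"
  unfolding vnormal_def smooth_convex_graph.nu_def[OF graph_at[OF that]] by simp

lemma continuous_dd: "(\<And>k. Ck_on k spacetime f) \<Longrightarrow> continuous_on spacetime f"
  using Ck_on_imp_continuous_on by blast

lemma Ck_hess_nth: "Ck_on k spacetime (\<lambda>z. hess z $ i $ j)"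
  by (simp add: hess_def Ck_dd[OF Ck_dd[OF Ck_hgt]])

lemma continuous_hess: "continuous_on spacetime hess"
  unfolding hess_def
  by (intro continuous_on_vec_lambda Ck_on_imp_continuous_on[of 0] Ck_dd Ck_hgt)

text \<open>At a minimum of the graph function the convex hull lies in the half-space above, so a
  normal entering the hull cannot point downwards.\<close>

lemma vnormal_pos_initially: "\<exists>x\<in>dom_at 0. vnormal (x, 0) > 0"
proof -
  obtain x where x: "x \<in> dom_at 0" "\<And>y. y \<in> dom_at 0 \<Longrightarrow> hgt (x, 0) \<le> hgt (y, 0)"
    using init_min by blast
  have s: "0 \<in> {0..<T}" using T_pos by simp
  interpret G: smooth_convex_graph "slice F 0" "dom_at 0" "\<lambda>x. hgt (x, 0)" "\<lambda>x. grad (x, 0)" "\<lambda>x. hess (x, 0)"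
    by (rule graph_at[OF s])
  have "is_interior_normal (slice F 0) (x, hgt (x, 0)) (G.nrm x)"
    using strictly_convex_interior_normal[OF G.convex_\<Sigma> G.graph_mem[OF x(1)]] .
  then obtain e where e: "e > 0"
      "\<And>s. s \<in> {0<..<e} \<Longrightarrow> (x, hgt (x, 0)) + s *\<^sub>R G.nrm x \<in> interior (convex hull slice F 0)"
    by (auto simp: is_interior_normal_def)
  have "convex {Q :: 'n space. (0, 1) \<bullet> Q \<ge> hgt (x, 0)}" by (rule convex_halfspace_ge)
  then have "convex hull slice F 0 \<subseteq> {Q. (0, 1) \<bullet> Q \<ge> hgt (x, 0)}"
    using x(2) by (intro hull_minimal) (auto simp: G.graph graph_over_def inner_prod_def)
  moreover have "(x, hgt (x, 0)) + (e/2) *\<^sub>R G.nrm x \<in> convex hull slice F 0"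
    using e(2)[of "e/2"] e(1) interior_subset by auto
  ultimately have "(0, 1) \<bullet> ((x, hgt (x, 0)) + (e/2) *\<^sub>R G.nrm x) \<ge> hgt (x, 0)" by blast
  then have "snd (G.nrm x) \<ge> 0" using e(1) by (simp add: inner_prod_def zero_le_mult_iff)
  moreover have "snd (G.nrm x) \<noteq> 0" using G.nu_nonzero[OF x(1)] by (simp add: G.nu_def)
  ultimately show ?thesis using x(1) by (auto simp: vnormal_def intro!: bexI[of _ x])
qed

lemma F_continuous: "continuous_on {0..<T} (F p)"
proof -
  have "\<exists>v. (F p has_vector_derivative v) (at t within {0..<T})" if "t \<in> {0..<T}" for t
    using sol that unfolding gcf_graph_solution_def by blast
  then show ?thesis
    by (meson continuous_on_eq_continuous_within has_vector_derivative_continuous)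
qed

text \<open>The normal is defined through convex hulls, so its continuity in time is not evident.
  The second derivative h of the graph function in one fixed direction is continuous, never zero and
  of the same sign as the normal. Its sign is carried over slice 0, along the trajectory of one
  point, and over slice s, each of which is connected.\<close>

lemma vnormal_pos: assumes "z \<in> spacetime" shows "vnormal z > 0"
proof -
  fix k :: 'n
  define h where "h z = axis k 1 \<bullet> (hess z *v axis k 1)" for z
  have ax: "axis k (1::real) \<noteq> 0" by (simp add: axis_eq_0_iff)
  have pos: "vnormal z * h z > 0" if z: "z \<in> spacetime" for z
  proof -
    obtain x s where xs: "z = (x, s)" "s \<in> {0..<T}" "x \<in> dom_at s" using z by (cases z) auto
    show ?thesis
      using smooth_convex_graph.hessian_definite[OF graph_at[OF xs(2)] xs(3) ax] vnormal_eq[OF xs(2)]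
      by (simp add: h_def xs(1))
  qed
  have nz: "h z \<noteq> 0" if "z \<in> spacetime" for z using pos[OF that] by auto
  have cont: "continuous_on spacetime h"
    unfolding h_def by (intro continuous_intros continuous_hess)
  have sub: "continuous_on S h" if "S \<subseteq> spacetime" for S using continuous_on_subset[OF cont that] .
  have slc: "connected (dom_at s \<times> {s})" "dom_at s \<times> {s} \<subseteq> spacetime" if "s \<in> {0..<T}" for s
    using slice_graph(2)[OF that] that by (auto intro: connected_Times)
  \<comment> \<open>Any point will do: every trajectory meets every slice.\<close>
  obtain p :: 'm where True by blast
  define \<Gamma> where "\<Gamma> = (\<lambda>s. (fst (F p s), s)) ` {0..<T}"
  have G: "connected \<Gamma>" "\<Gamma> \<subseteq> spacetime"
    unfolding \<Gamma>_def using F_continuous[of p] F_graph(1)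
    by (auto intro!: connected_continuous_image continuous_intros)
  obtain x where x: "x \<in> dom_at 0" "vnormal (x, 0) > 0" using vnormal_pos_initially by blast
  have T0: "0 \<in> {0..<T}" using T_pos by simp
  have "h (x, 0) > 0" using pos[of "(x, 0)"] x T0 by (simp add: zero_less_mult_iff)
  then have "h (fst (F p 0), 0) > 0"
    using connected_pos[OF slc(1)[OF T0] sub[OF slc(2)[OF T0]], of "(x, 0)" "(fst (F p 0), 0)"]
      nz slc(2)[OF T0] x(1) F_graph(1)[OF T0] by auto
  moreover obtain y s where ys: "z = (y, s)" "s \<in> {0..<T}" "y \<in> dom_at s" using assms by (cases z) auto
  ultimately have "h (fst (F p s), s) > 0"
    using connected_pos[OF G(1) sub[OF G(2)], of "(fst (F p 0), 0)" "(fst (F p s), s)"] nz G(2) T0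
    by (auto simp: \<Gamma>_def)
  then have "h z > 0"
    using connected_pos[OF slc(1)[OF ys(2)] sub[OF slc(2)[OF ys(2)]], of "(fst (F p s), s)" z]
      nz slc(2)[OF ys(2)] ys F_graph(1)[OF ys(2)] by auto
  then show ?thesis using pos[OF assms] by (simp add: zero_less_mult_iff)
qed

lemma complete_graph_at:
  assumes s: "s \<in> {0..<T}"
  shows "complete_convex_graph (slice F s) (dom_at s) (\<lambda>x. hgt (x, s)) (\<lambda>x. grad (x, s)) (\<lambda>x. hess (x, s))"
proof -
  interpret G: smooth_convex_graph "slice F s" "dom_at s" "\<lambda>x. hgt (x, s)" "\<lambda>x. grad (x, s)" "\<lambda>x. hess (x, s)"
    by (rule graph_at[OF s])
  show ?thesis
    using slice_graph(2)[OF s] slice_props(1)[OF s] vnormal_pos[of "(_, s)"] s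
    by unfold_locales (auto simp flip: vnormal_eq[OF s])
qed

lemma vnormal_sq: "z \<in> spacetime \<Longrightarrow> (vnormal z)\<^sup>2 * (1 + (norm (grad z))\<^sup>2) = 1"
  using smooth_convex_graph.nrm_eq(2)[OF graph_at, of "snd z" "fst z"] vnormal_eq[of "snd z" "fst z"]
  by (simp add: spacetime_def)

lemma interior_normal_eq:
  "z \<in> spacetime \<Longrightarrow> interior_normal (slice F (snd z)) (fst z, hgt z) = vnormal z *\<^sub>R (- grad z, 1)"
  using smooth_convex_graph.nrm_eq(1)[OF graph_at, of "snd z" "fst z"] vnormal_eq[of "snd z" "fst z"]
  by (simp add: spacetime_def)

lemma vnormal_explicit: assumes "z \<in> spacetime" shows "vnormal z = 1 / sqrt (1 + (norm (grad z))\<^sup>2)"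
proof -
  have p: "1 + (norm (grad z))\<^sup>2 > 0" by (simp add: add_pos_nonneg)
  have "(vnormal z)\<^sup>2 = 1 / (1 + (norm (grad z))\<^sup>2)" using vnormal_sq[OF assms] p by (simp add: field_simps)
  then have "sqrt ((vnormal z)\<^sup>2) = 1 / sqrt (1 + (norm (grad z))\<^sup>2)" by (simp add: real_sqrt_divide)
  then show ?thesis using vnormal_pos[OF assms] by simp
qed

lemma hess_sym: "z \<in> spacetime \<Longrightarrow> transpose (hess z) = hess z"
  using smooth_convex_graph.sym_H[OF graph_at, of "snd z" "fst z"] by (simp add: spacetime_def)

lemma hess_pos: "z \<in> spacetime \<Longrightarrow> w \<noteq> 0 \<Longrightarrow> w \<bullet> (hess z *v w) > 0"
  using smooth_convex_graph.hessian_definite[OF graph_at, of "snd z" "fst z" w]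
    vnormal_eq[of "snd z" "fst z"] vnormal_pos[of z]
  by (simp add: spacetime_def zero_less_mult_iff)

lemma det_hess_pos: "z \<in> spacetime \<Longrightarrow> det (hess z) > 0"
  using positive_definite_det_pos[OF hess_sym hess_pos] by metis

definition curv :: "(real^'n) \<times> real \<Rightarrow> real" where
  "curv z = gauss_curvature (slice F (snd z)) (fst z, hgt z)"

lemma curv_eq: "z \<in> spacetime \<Longrightarrow> curv z = vnormal z ^ CARD('n) * det (hess z) / (1 + (norm (grad z))\<^sup>2)"
  using smooth_convex_graph.gauss_curvature_graph[OF graph_at, of "snd z" "fst z"]
    vnormal_eq[of "snd z" "fst z"]
  by (simp add: spacetime_def curv_def)

lemma curv_pos: assumes "z \<in> spacetime" shows "curv z > 0"
proof -
  have "1 + (norm (grad z))\<^sup>2 > 0" by (simp add: add_pos_nonneg)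
  then show ?thesis
    unfolding curv_eq[OF assms] using vnormal_pos[OF assms] det_hess_pos[OF assms] by simp
qed

lemma dd_add: "(\<And>k. Ck_on k spacetime f) \<Longrightarrow> z \<in> spacetime \<Longrightarrow> dd (v + w) f z = dd v f z + dd w f z"
  using dd_linear linear_add by blast

text \<open>The flow moves points along the normal, not vertically. Differentiating the identity
  between the vertical part of F and \<open>hgt\<close> along a trajectory accounts for the
  horizontal drift, and the identity \<open>vnormal_sq\<close> simplifies the result. At time 0 the
  derivative is one-sided, which thickness of the time interval admits.\<close>

lemma evolution: assumes z: "z \<in> spacetime" shows "dd (0, 1) hgt z = curv z powr \<alpha> / vnormal z"
proof -
  obtain x s where xs: "z = (x, s)" "s \<in> {0..<T}" "x \<in> dom_at s" using z by (cases z) auto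
  obtain p where p: "F p s = (x, hgt z)" using slice_point[OF xs(2,3)] xs(1) by metis
  let ?V = "(curv z powr \<alpha>) *\<^sub>R (vnormal z *\<^sub>R (- grad z, 1::real))"
  have "((\<lambda>s. F p s) has_vector_derivative
      (gauss_curvature (slice F s) (F p s) powr \<alpha>) *\<^sub>R interior_normal (slice F s) (F p s))
      (at s within {0..<T})"
    using sol xs(2) unfolding gcf_graph_solution_def by blast
  then have "((\<lambda>s. F p s) has_vector_derivative ?V) (at s within {0..<T})"
    using interior_normal_eq[OF z] by (simp add: p curv_def xs(1))
  then have FV: "((\<lambda>s. F p s) has_derivative (\<lambda>h. h *\<^sub>R ?V)) (at s within {0..<T})"
    by (simp add: has_vector_derivative_def)
  have c: "((\<lambda>r. (fst (F p r), r)) has_derivative (\<lambda>h. (fst (h *\<^sub>R ?V), h))) (at s within {0..<T})"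
    by (rule has_derivative_Pair[OF has_derivative_fst[OF FV] has_derivative_ident])
  have "((\<lambda>r. hgt (fst (F p r), r)) has_derivative (\<lambda>h. dd (fst (h *\<^sub>R ?V), h) hgt z)) (at s within {0..<T})"
  proof (rule has_derivative_in_compose[where g = hgt and g' = "\<lambda>v. dd v hgt z", OF c])
    show "(hgt has_derivative (\<lambda>v. dd v hgt z))
        (at (fst (F p s), s) within (\<lambda>r. (fst (F p r), r)) ` {0..<T})"
    proof -
      have "(\<lambda>r. (fst (F p r), r)) ` {0..<T} \<subseteq> spacetime" using F_graph(1) by auto
      from has_derivative_subset[OF has_derivative_dd[OF Ck_hgt z] this]
      show ?thesis by (simp add: p xs(1))
    qed
  qed
  then have 1: "((\<lambda>r. snd (F p r)) has_derivative (\<lambda>h. dd (fst (h *\<^sub>R ?V), h) hgt z)) (at s within {0..<T})"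
    by (rule has_derivative_transform[OF xs(2), rotated]) (metis F_graph(2) snd_conv)
  have "(\<lambda>h. dd (fst (h *\<^sub>R ?V), h) hgt z) = (\<lambda>h. snd (h *\<^sub>R ?V))"
    by (rule thick_unique[OF thick_time_interval[OF T_pos] xs(2) 1 has_derivative_snd[OF FV]])
  then have "dd (fst (1 *\<^sub>R ?V), 1) hgt z = snd (1 *\<^sub>R ?V)" by meson
  then have "dd (fst ?V, 1) hgt z = snd ?V" by simp
  moreover have "dd (fst ?V, 1) hgt z = dd (fst ?V, 0) hgt z + dd (0, 1) hgt z"
    using dd_add[OF Ck_hgt z, of "(fst ?V, 0)" "(0, 1)"] by simp
  ultimately have "dd (0, 1) hgt z = snd ?V - grad z \<bullet> fst ?V" by (simp add: dd_hgt[OF z])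
  also have "\<dots> = curv z powr \<alpha> * vnormal z * (1 + (norm (grad z))\<^sup>2)"
    by (simp add: power2_norm_eq_inner algebra_simps)
  also have "\<dots> = curv z powr \<alpha> * ((vnormal z)\<^sup>2 * (1 + (norm (grad z))\<^sup>2)) / vnormal z"
    using vnormal_pos[OF z] by (simp add: power2_eq_square)
  also have "\<dots> = curv z powr \<alpha> / vnormal z" by (simp add: vnormal_sq[OF z])
  finally show ?thesis .
qed

lemma time_derivative_pos: "z \<in> spacetime \<Longrightarrow> dd (0, 1) hgt z > 0"
  using vnormal_pos[of z] curv_pos[of z] by (simp add: evolution powr_gt_zero)

text \<open>Convexity bounds the graph functions of the approximating slices on segments from a fixed point
  of the limit domain; in the limit the graph stays bounded along such a segment, which therefore
  cannot leave the domain.\<close>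

lemma bounded_limit_mem:
  assumes z: "\<And>k. z k \<in> spacetime" "z \<longlonglongrightarrow> (x, s)" "s \<in> {0..<T}" "\<And>k. hgt (z k) \<le> C"
  shows "(x, s) \<in> spacetime"
proof -
  interpret G: complete_convex_graph "slice F s" "dom_at s" "\<lambda>x. hgt (x, s)" "\<lambda>x. grad (x, s)" "\<lambda>x. hess (x, s)"
    by (rule complete_graph_at[OF z(3)])
  obtain V where V: "open V" "spacetime = (UNIV \<times> {0..<T}) \<inter> V" using spacetime_relatively_open by blast
  obtain p :: 'm where True by blast
  define y where "y = fst (F p s)"
  have y: "y \<in> dom_at s" using F_graph(1)[OF z(3)] by (simp add: y_def)
  have sk: "snd (z k) \<in> {0..<T}" "fst (z k) \<in> dom_at (snd (z k))" for k using z(1)[of k] by (auto simp: spacetime_def)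
  have lim: "(\<lambda>k. fst (z k)) \<longlonglongrightarrow> x" "(\<lambda>k. snd (z k)) \<longlonglongrightarrow> s"
    using tendsto_fst[OF z(2)] tendsto_snd[OF z(2)] by auto
  \<comment> \<open>Relative openness of \<open>spacetime\<close>: a sequence converging to a point
    of the limit domain eventually lies in the domains of the approximating slices, with converging
    heights.\<close>
  have ev: "\<forall>\<^sub>F k in sequentially. (w k, snd (z k)) \<in> spacetime" "(\<lambda>k. hgt (w k, snd (z k))) \<longlonglongrightarrow> hgt (v, s)"
    if v: "v \<in> dom_at s" and w: "w \<longlonglongrightarrow> v" for v w
  proof -
    have t: "(\<lambda>k. (w k, snd (z k))) \<longlonglongrightarrow> (v, s)" by (intro tendsto_Pair w lim)
    have vs: "(v, s) \<in> spacetime" using v z(3) by simp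
    then have "(v, s) \<in> V" using V(2) by blast
    then have "\<forall>\<^sub>F k in sequentially. (w k, snd (z k)) \<in> V"
      using topological_tendstoD[OF t V(1)] by blast
    then show e: "\<forall>\<^sub>F k in sequentially. (w k, snd (z k)) \<in> spacetime"
      by (rule eventually_mono) (use sk V(2) in auto)
    show "(\<lambda>k. hgt (w k, snd (z k))) \<longlonglongrightarrow> hgt (v, s)"
      using continuous_on_tendsto_compose[OF continuous_dd[OF Ck_hgt] t vs e] .
  qed
  have "x \<in> dom_at s"
  proof (rule G.bounded_ray_mem[OF y])
    fix l :: real assume l: "0 \<le> l" "l < 1" and w: "y + l *\<^sub>R (x - y) \<in> dom_at s"
    have "(\<lambda>k. y + l *\<^sub>R (fst (z k) - y)) \<longlonglongrightarrow> y + l *\<^sub>R (x - y)"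
      by (intro tendsto_intros lim)
    note ev2 = ev[OF w this]
    have "\<forall>\<^sub>F k in sequentially. hgt (y, snd (z k)) < hgt (y, s) + 1"
      using order_tendstoD(2)[OF ev(2)[OF y tendsto_const]] by simp
    then have "\<forall>\<^sub>F k in sequentially. hgt (y + l *\<^sub>R (fst (z k) - y), snd (z k)) \<le> max (hgt (y, s) + 1) C"
      using ev(1)[OF y tendsto_const] ev2(1)
    proof eventually_elim
      case (elim k)
      interpret Gk: complete_convex_graph "slice F (snd (z k))" "dom_at (snd (z k))" "\<lambda>x. hgt (x, snd (z k))"
          "\<lambda>x. grad (x, snd (z k))" "\<lambda>x. hess (x, snd (z k))"
        by (rule complete_graph_at[OF sk(1)])
      have "hgt (y + l *\<^sub>R (fst (z k) - y), snd (z k)) \<le> max (hgt (y, snd (z k))) (hgt (fst (z k), snd (z k)))"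
        using elim l sk(2) by (intro Gk.graph_max_ineq) auto
      also have "\<dots> \<le> max (hgt (y, s) + 1) C" using elim(1) z(4)[of k] by auto
      finally show ?case .
    qed
    then show "hgt (y + l *\<^sub>R (x - y), s) \<le> max (hgt (y, s) + 1) C"
      using tendsto_upperbound[OF ev2(2)] by simp
  qed
  then show ?thesis using z(3) by simp
qed

section \<open>Positive times, where space-time is open, and growth of the height\<close>

definition interior_times :: "((real^'n) \<times> real) set" where "interior_times = spacetime \<inter> {z. snd z > 0}"

lemma open_pos_time: "open {z :: 'a::topological_space \<times> real. snd z > 0}"
  by (intro open_Collect_less continuous_intros)

lemma open_interior_times: "open interior_times"
proof -
  obtain V where V: "open V" "spacetime = (UNIV \<times> {0..<T}) \<inter> V" using spacetime_relatively_open by blast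
  have "interior_times = V \<inter> {z. snd z > 0} \<inter> {z. snd z < T}" unfolding interior_times_def V(2) by auto
  moreover have "open {z :: (real^'n) \<times> real. snd z < T}"
    by (intro open_Collect_less continuous_intros)
  ultimately show ?thesis using V(1) open_pos_time by (metis open_Int)
qed

lemma interior_times_subset: "interior_times \<subseteq> spacetime" by (simp add: interior_times_def)

lemma pder_interior_times: "z \<in> interior_times \<Longrightarrow> pder interior_times v f z = dd v f z"
  unfolding interior_times_def by (rule pder_Int_open[OF open_pos_time]) auto

lemma line_deriv_dd:
  fixes f :: "(real^'n) \<times> real \<Rightarrow> real"
  assumes f: "\<And>k. Ck_on k spacetime f" and z: "z + r *\<^sub>R v \<in> interior_times"
  shows "((\<lambda>r. f (z + r *\<^sub>R v)) has_real_derivative dd v f (z + r *\<^sub>R v)) (at r)"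
  using line_deriv_pder[OF open_interior_times Ck_on_subset[OF f interior_times_subset] z] unfolding pder_interior_times[OF z] .

text \<open>The sign of the time derivative is used only inside the interval, where times are
  positive; continuity covers the left end, which may be time 0.\<close>

lemma height_mono_aux:
  assumes "0 \<le> r" "r \<le> s" "\<And>t. r \<le> t \<Longrightarrow> t \<le> s \<Longrightarrow> (x, t) \<in> spacetime"
  shows "hgt (x, r) \<le> hgt (x, s)"
proof (cases "r = s")
  case False
  then have rs: "r < s" using assms by simp
  have "\<exists>y. ((\<lambda>t. hgt (x, t)) has_real_derivative y) (at t) \<and> 0 < y" if "r < t" "t < s" for t
  proof -
    have zt: "(x, 0) + t *\<^sub>R (0, 1) \<in> interior_times" using assms that by (simp add: interior_times_def)
    from line_deriv_dd[OF Ck_hgt this] time_derivative_pos[of "(x, t)"] assms(3)[of t] that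
    show ?thesis by auto
  qed
  moreover have "continuous_on {r..s} (\<lambda>t. hgt (x, t))"
    by (rule continuous_on_compose2[OF continuous_dd[OF Ck_hgt]])
      (use assms(3) in \<open>auto intro!: continuous_intros\<close>)
  ultimately have "hgt (x, r) < hgt (x, s)"
    by (intro DERIV_pos_imp_increasing_open[OF rs]) auto
  then show ?thesis by simp
qed simp

text \<open>Suppose the vertical line through (x, s), traced backwards, leaves space-time, and let t
  be the last time outside. Just after t the heights stay below the final one, so
  \<open>bounded_limit_mem\<close> puts the point at time t into space-time after all.\<close>

lemma height_mono:
  assumes z: "(x, s) \<in> spacetime" and r: "0 \<le> r" "r \<le> s"
  shows "(x, r) \<in> spacetime" "hgt (x, r) \<le> hgt (x, s)"
proof -
  obtain V where V: "open V" "spacetime = (UNIV \<times> {0..<T}) \<inter> V" using spacetime_relatively_open by blast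
  define B where "B = {0..s} \<inter> (\<lambda>t. (x, t)) -` (- V)"
  have sT: "s < T" using z by simp
  have B_iff: "t \<in> B \<longleftrightarrow> 0 \<le> t \<and> t \<le> s \<and> (x, t) \<notin> spacetime" for t
    using sT unfolding B_def V(2) by auto
  have "closed ((\<lambda>t. (x, t)) -` (- V))"
    using V(1) by (intro closed_vimage continuous_intros) auto
  then have "compact B" unfolding B_def by (intro compact_Int_closed) auto
  have "B = {}"
  proof (rule ccontr)
    assume "B \<noteq> {}"
    then obtain t where t: "t \<in> B" "\<And>t'. t' \<in> B \<Longrightarrow> t' \<le> t"
      using compact_attains_sup[OF \<open>compact B\<close>] by blast
    have "t \<noteq> s" using t(1) z B_iff by blast
    then have ts: "0 \<le> t" "t < s" using t(1) by (auto simp: B_iff)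
    have after: "(x, t') \<in> spacetime" if "t < t'" "t' \<le> s" for t'
      using t(2)[of t'] that ts B_iff by force
    define tk where "tk k = t + (s - t) / real (Suc k)" for k
    have tk: "t < tk k" "tk k \<le> s" for k
    proof -
      show "t < tk k" using ts by (simp add: tk_def)
      have "(s - t) / real (Suc k) \<le> (s - t) / 1" using ts by (intro divide_left_mono) auto
      then show "tk k \<le> s" by (simp add: tk_def)
    qed
    have "(x, t) \<in> spacetime"
    proof (rule bounded_limit_mem)
      show "(x, tk k) \<in> spacetime" for k using after tk by blast
      have "(\<lambda>k. (s - t) * (1 / real (Suc k))) \<longlonglongrightarrow> (s - t) * 0"
        by (intro tendsto_mult tendsto_const LIMSEQ_Suc lim_1_over_n)
      then have "tk \<longlonglongrightarrow> t + 0"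
        unfolding tk_def by (intro tendsto_add tendsto_const) simp
      then show "(\<lambda>k. (x, tk k)) \<longlonglongrightarrow> (x, t)" by (intro tendsto_Pair) auto
      show "hgt (x, tk k) \<le> hgt (x, s)" for k
        using tk[of k] ts after by (intro height_mono_aux) auto
      show "t \<in> {0..<T}" using ts sT by simp
    qed
    then show False using t(1) B_iff by blast
  qed
  then have all: "(x, t) \<in> spacetime" if "0 \<le> t" "t \<le> s" for t using that B_iff by blast
  then show "(x, r) \<in> spacetime" using r by blast
  show "hgt (x, r) \<le> hgt (x, s)" using r all by (intro height_mono_aux) auto
qed

definition sublevel :: "real \<Rightarrow> real \<Rightarrow> ((real^'n) \<times> real) set" where
  "sublevel C t = {z \<in> spacetime. snd z \<le> t \<and> hgt z \<le> C}"

lemma compact_sublevel: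
  assumes t: "t < T" shows "compact (sublevel C t)"
proof -
  have "closed (sublevel C t)"
    unfolding closed_sequential_limits
  proof (intro allI impI)
    fix z l assume a: "(\<forall>k. z k \<in> sublevel C t) \<and> z \<longlonglongrightarrow> l"
    then have zk: "z k \<in> spacetime" "0 \<le> snd (z k)" "snd (z k) \<le> t" "hgt (z k) \<le> C" for k
      by (auto simp: sublevel_def spacetime_def)
    have s: "(\<lambda>k. snd (z k)) \<longlonglongrightarrow> snd l" using a tendsto_snd by blast
    have "0 \<le> snd l" "snd l \<le> t"
      using tendsto_lowerbound[OF s] tendsto_upperbound[OF s] zk by auto
    moreover from this have l: "l \<in> spacetime"
      using bounded_limit_mem[of z "fst l" "snd l" C] zk a t by auto
    moreover have "(\<lambda>k. hgt (z k)) \<longlonglongrightarrow> hgt l"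
      by (rule continuous_on_tendsto_compose[OF continuous_dd[OF Ck_hgt] _ l]) (use a zk in auto)
    then have "hgt l \<le> C" by (rule tendsto_upperbound) (use zk in auto)
    ultimately show "l \<in> sublevel C t" by (simp add: sublevel_def)
  qed
  moreover have "sublevel C t \<subseteq> {x \<in> dom_at 0. hgt (x, 0) \<le> C} \<times> {0..t}"
  proof
    fix z assume "z \<in> sublevel C t"
    then have z: "(fst z, snd z) \<in> spacetime" "0 \<le> snd z" "snd z \<le> t" "hgt (fst z, snd z) \<le> C"
      by (auto simp: sublevel_def spacetime_def)
    from height_mono[OF z(1) order_refl z(2)] z
    show "z \<in> {x \<in> dom_at 0. hgt (x, 0) \<le> C} \<times> {0..t}" by (cases z) auto
  qed
  then have "bounded (sublevel C t)"
    by (rule bounded_subset[rotated]) (intro bounded_Times init_proper bounded_closed_interval)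
  ultimately show ?thesis by (simp add: compact_eq_bounded_closed)
qed

lemma sublevel_subset: "sublevel C t \<subseteq> spacetime" by (auto simp: sublevel_def)

section \<open>Bounds for the gradient and the smallest curvature on sublevel sets\<close>

definition lam :: "(real^'n) \<times> real \<Rightarrow> real" where
  "lam z = lambda_min (slice F (snd z)) (fst z, hgt z)"

lemma lam_props:
  assumes "z \<in> spacetime"
  shows "lam z > 0"
    and "lam z * ((norm w)\<^sup>2 + (grad z \<bullet> w)\<^sup>2) \<le> vnormal z * (w \<bullet> (hess z *v w))"
    and "\<exists>v. norm v = 1 \<and> vnormal z * (v \<bullet> (hess z *v v)) = lam z * ((norm v)\<^sup>2 + (grad z \<bullet> v)\<^sup>2)"
proof -
  obtain x s where xs: "z = (x, s)" "s \<in> {0..<T}" "x \<in> dom_at s" using assms by (cases z) auto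
  have g: "w \<bullet> (rank_one_update (grad z) *v w) = (norm w)\<^sup>2 + (grad z \<bullet> w)\<^sup>2" for w
    by (simp add: rank_one_update_mult inner_add_right power2_norm_eq_inner inner_commute flip: power2_eq_square)
  note L = smooth_convex_graph.lambda_min_graph[OF graph_at[OF xs(2)] xs(3)]
  show "lam z > 0" using L(1) by (simp add: lam_def xs(1))
  show "lam z * ((norm w)\<^sup>2 + (grad z \<bullet> w)\<^sup>2) \<le> vnormal z * (w \<bullet> (hess z *v w))"
    using L(2)[of w] vnormal_eq[OF xs(2), of x] g[of w] by (simp add: lam_def xs(1))
  obtain v where v: "v \<noteq> 0" "(vnormal z *\<^sub>R hess z) *v v = lam z *\<^sub>R (rank_one_update (grad z) *v v)"
    using L(3) vnormal_eq[OF xs(2), of x] by (auto simp: lam_def xs(1))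
  define e where "e = v /\<^sub>R norm v"
  have "(vnormal z *\<^sub>R hess z) *v e = lam z *\<^sub>R (rank_one_update (grad z) *v e)"
    unfolding e_def using v(2) by (simp add: matrix_vector_mult_scaleR)
  then have "vnormal z *\<^sub>R (hess z *v e) = lam z *\<^sub>R (rank_one_update (grad z) *v e)"
    by (simp add: scaleR_matrix_vector_assoc)
  then have "e \<bullet> (vnormal z *\<^sub>R (hess z *v e)) = e \<bullet> (lam z *\<^sub>R (rank_one_update (grad z) *v e))" by simp
  then have "vnormal z * (e \<bullet> (hess z *v e)) = lam z * ((norm e)\<^sup>2 + (grad z \<bullet> e)\<^sup>2)" using g[of e] by simp
  moreover have "norm e = 1" using v(1) by (simp add: e_def)
  ultimately show "\<exists>v. norm v = 1 \<and> vnormal z * (v \<bullet> (hess z *v v)) = lam z * ((norm v)\<^sup>2 + (grad z \<bullet> v)\<^sup>2)"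
    by blast
qed

lemma continuous_grad: "continuous_on spacetime grad" by (rule continuous_dd[OF Ck_grad])

lemma continuous_vnormal: "continuous_on spacetime vnormal"
proof -
  have "1 + (norm (grad z))\<^sup>2 \<noteq> 0" for z by (metis add_pos_nonneg less_numeral_extra(1,3) zero_le_power2)
  then have "continuous_on spacetime (\<lambda>z. 1 / sqrt (1 + (norm (grad z))\<^sup>2))"
    by (intro continuous_intros continuous_grad) auto
  then show ?thesis using vnormal_explicit by (simp cong: continuous_on_cong)
qed

lemma gradient_bounded:
  assumes "t < T" obtains B where "\<And>z. z \<in> sublevel C t \<Longrightarrow> 1 + (norm (grad z))\<^sup>2 \<le> B"
proof -
  have "continuous_on (sublevel C t) (\<lambda>z. 1 + (norm (grad z))\<^sup>2)"
    by (intro continuous_intros continuous_on_subset[OF continuous_grad sublevel_subset])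
  then have "bounded ((\<lambda>z. 1 + (norm (grad z))\<^sup>2) ` sublevel C t)"
    using compact_sublevel[OF assms] compact_continuous_image compact_imp_bounded by blast
  then obtain B where "\<And>z. z \<in> sublevel C t \<Longrightarrow> \<bar>1 + (norm (grad z))\<^sup>2\<bar> \<le> B"
    by (auto simp: bounded_iff)
  then show thesis using that[of B] by fastforce
qed

text \<open>Continuity of \<open>lam\<close>, a minimum over a set of eigenvalues, is avoided. Its
  Rayleigh quotient is jointly continuous in the point and the direction and has a positive minimum
  on the product of the compact sublevel set with the unit sphere; each value of \<open>lam\<close>
  there is a value of the quotient.\<close>

lemma curvature_bounded:
  assumes "t < T" obtains B where "\<And>z. z \<in> sublevel C t \<Longrightarrow> inverse (lam z) \<le> B"
proof (cases "sublevel C t = {}")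
  case True
  then show thesis using that by auto
next
  case False
  fix k :: 'n
  let ?S = "sublevel C t \<times> sphere (0::real^'n) 1"
  define f where "f y = vnormal (fst y) * (snd y \<bullet> (hess (fst y) *v snd y)) / ((norm (snd y))\<^sup>2 + (grad (fst y) \<bullet> snd y)\<^sup>2)"
    for y
  have S: "compact ?S" by (intro compact_Times compact_sublevel assms compact_sphere)
  have "axis k 1 \<in> sphere (0::real^'n) 1" by simp
  then have ne: "?S \<noteq> {}" using False by blast
  have cont: "continuous_on ?S f"
    unfolding f_def
  proof (intro continuous_intros)
    show "continuous_on ?S (\<lambda>y. vnormal (fst y))"
      by (rule continuous_on_compose2[OF continuous_vnormal]) (use sublevel_subset in \<open>auto intro!: continuous_intros\<close>)
    show "continuous_on ?S (\<lambda>y. hess (fst y))"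
      by (rule continuous_on_compose2[OF continuous_hess]) (use sublevel_subset in \<open>auto intro!: continuous_intros\<close>)
    show "continuous_on ?S (\<lambda>y. grad (fst y))"
      by (rule continuous_on_compose2[OF continuous_grad]) (use sublevel_subset in \<open>auto intro!: continuous_intros\<close>)
    show "\<forall>y\<in>?S. (norm (snd y))\<^sup>2 + (grad (fst y) \<bullet> snd y)\<^sup>2 \<noteq> 0"
      by (auto simp: add_nonneg_eq_0_iff)
  qed
  obtain y0 where y0: "y0 \<in> ?S" "\<And>y. y \<in> ?S \<Longrightarrow> f y0 \<le> f y"
    using continuous_attains_inf[OF S ne cont] by blast
  have g_pos: "(norm v)\<^sup>2 + (grad z \<bullet> v)\<^sup>2 > 0" if "norm v = 1" for z v
    using that by (simp add: add_pos_nonneg)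
  have "f y0 > 0"
  proof -
    have "snd y0 \<noteq> 0" "fst y0 \<in> spacetime" "norm (snd y0) = 1"
      using y0(1) subsetD[OF sublevel_subset, of "fst y0" C t] by auto
    then show ?thesis
      unfolding f_def using vnormal_pos hess_pos g_pos by (intro divide_pos_pos mult_pos_pos) auto
  qed
  have "f y0 \<le> lam z" if z: "z \<in> sublevel C t" for z
  proof -
    have zD: "z \<in> spacetime" using z sublevel_subset by blast
    obtain v where v: "norm v = 1" "vnormal z * (v \<bullet> (hess z *v v)) = lam z * ((norm v)\<^sup>2 + (grad z \<bullet> v)\<^sup>2)"
      using lam_props(3)[OF zD] by blast
    have "f y0 \<le> f (z, v)" using z v(1) by (intro y0(2)) auto
    also have "\<dots> = lam z" using v g_pos[OF v(1), of z] by (auto simp: f_def)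
    finally show ?thesis .
  qed
  then have "inverse (lam z) \<le> inverse (f y0)" if "z \<in> sublevel C t" for z
    using that \<open>f y0 > 0\<close> by (intro le_imp_inverse_le)
  then show thesis using that by blast
qed

end

subsection \<open>The maximum principle\<close>

text \<open>A positive second derivative would make the first derivative positive just to the right
  of 0, and the mean value theorem would lift f above f 0.\<close>

lemma second_derivative_test_max:
  fixes f :: "real \<Rightarrow> real"
  assumes d: "0 < \<delta>" and f1: "\<And>r. \<bar>r\<bar> < \<delta> \<Longrightarrow> (f has_real_derivative f1 r) (at r)"
    and f2: "(f1 has_real_derivative f2) (at 0)" and max: "\<And>r. \<bar>r\<bar> < \<delta> \<Longrightarrow> f r \<le> f 0"
  shows "f1 0 = 0" "f2 \<le> 0"
proof -
  show 0: "f1 0 = 0"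
    using DERIV_local_max[OF f1[of 0] d] max d by auto
  show "f2 \<le> 0"
  proof (rule ccontr)
    assume "\<not> f2 \<le> 0"
    then obtain e where e: "e > 0" "\<And>h. 0 < h \<Longrightarrow> h < e \<Longrightarrow> f1 0 < f1 (0 + h)"
      using DERIV_pos_inc_right[OF f2] by auto
    define r where "r = min e \<delta> / 2"
    have r: "0 < r" "r < e" "r < \<delta>" using e d by (auto simp: r_def)
    obtain x where "0 < x" "x < r" "f r - f 0 = (r - 0) * f1 x"
      using MVT2[OF r(1), of f f1] f1 r(3) by auto
    moreover have "f1 x > 0" using e(2)[of x] calculation r 0 by auto
    ultimately have "f r - f 0 > 0" using r by simp
    then show False using max[of r] r by auto
  qed
qed

text \<open>In time the maximum is known only against earlier times, so the derivative has a sign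
  instead of vanishing.\<close>

lemma derivative_at_left_max:
  fixes f :: "real \<Rightarrow> real"
  assumes "0 < \<delta>" "(f has_real_derivative D) (at 0)" "\<And>r. - \<delta> < r \<Longrightarrow> r \<le> 0 \<Longrightarrow> f r \<le> f 0"
  shows "D \<ge> 0"
proof (rule ccontr)
  assume "\<not> D \<ge> 0"
  then obtain e where e: "e > 0" "\<And>h. 0 < h \<Longrightarrow> h < e \<Longrightarrow> f 0 < f (0 - h)"
    using DERIV_neg_dec_left[OF assms(2)] by auto
  define r where "r = min e \<delta> / 2"
  have "0 < r" "r < e" "r < \<delta>" using e assms(1) by (auto simp: r_def)
  then show False using e(2)[of r] assms(3)[of "- r"] by auto
qed

text \<open>In an eigenbasis \<open>e\<^sub>k\<close> of the Hessian with eigenvalues \<open>m k\<close>, \<open>a k\<close> and \<open>p k\<close> are the derivatives of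
  \<open>u\<close> and \<open>P = u\<^sub>t\<close> along \<open>e\<^sub>k\<close>. The premises are the first and second order conditions at the maximum
  and the equation for \<open>ln P\<close> differentiated in time and along the gradient. The third derivatives \<open>T k\<close>
  and the second derivatives \<open>Pk k\<close> cancel.\<close>

lemma maximum_point_algebra:
  fixes w m a p Pk T :: "'k::finite \<Rightarrow> real"
  assumes pos: "P > 0" "Q > 0" "\<psi> > 0" "c > 0" "\<alpha> > 0" "\<And>k. m k > 0" "v2 > 0"
    and w: "\<And>k. w k = 1 / m k"
    and time: "0 \<le> eta - 2 * P / \<psi> + c * (Pt / P + qP / Q)"
    and space: "\<And>k. - 2 * m k / \<psi> - 2 * (a k)\<^sup>2 / \<psi>\<^sup>2 +
      c * (Pk k / P - (p k)\<^sup>2 / P\<^sup>2 + ((m k)\<^sup>2 + T k) / Q + 2 * (m k * a k)\<^sup>2 / Q\<^sup>2) \<le> 0"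
    and grad: "\<And>k. - 2 * a k / \<psi> + c * (p k / P + m k * a k / Q) = 0"
    and gradq: "- 2 * q2 / \<psi> + c * (qP / P + qHq / Q) = 0"
    and pdet: "Pt / P = \<alpha> * (\<Sum>k\<in>UNIV. w k * Pk k) + 2 * \<beta> * qP / v2"
    and pdeq: "qP / P = \<alpha> * (\<Sum>k\<in>UNIV. w k * T k) + 2 * \<beta> * qHq / v2"
  shows "0 \<le> eta - 2 * P / \<psi> + 2 * real CARD('k) * \<alpha> * P / \<psi> + 4 * \<beta> * P * q2 / (v2 * \<psi>)
    + (2 * \<alpha> + 8 * \<alpha> / c) * P * (\<Sum>k\<in>UNIV. w k * (a k)\<^sup>2) / \<psi>\<^sup>2
    - c * \<alpha> * P * (\<Sum>k\<in>UNIV. m k) / Q"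
proof -
  have wp: "w k > 0" "w k * m k = 1" for k using pos(6)[of k] by (auto simp: w)
  \<comment> \<open>The second order condition along one eigenvector, weighted by 1 / m k as in the
    linearized operator.\<close>
  have k1: "w k * (Pk k / P + T k / Q) * c \<le> 2 / \<psi> + (2 + 8 / c) * (w k * (a k)\<^sup>2) / \<psi>\<^sup>2 - c * m k / Q" for k
  proof -
    \<comment> \<open>The first order condition reads p/P = x - y. The loss in (x - y)^2 \<le> 2 x^2
      + 2 y^2 is affordable because the convexity of the logarithmic term provides exactly 2 y^2;
      the part 2 x^2 is the source of the coefficient 8 / c.\<close>
    define x where "x = 2 * a k / (c * \<psi>)"
    define y where "y = m k * a k / Q"
    have "p k / P = x - y" using grad[of k] pos by (simp add: x_def y_def field_simps)
    then have "(p k)\<^sup>2 / P\<^sup>2 = (x - y)\<^sup>2" by (metis power_divide)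
    also have "\<dots> \<le> 2 * x\<^sup>2 + 2 * y\<^sup>2"
      using zero_le_power2[of "x + y"] by (simp add: power2_eq_square algebra_simps)
    finally have pp: "(p k)\<^sup>2 / P\<^sup>2 \<le> 2 * x\<^sup>2 + 2 * (m k * a k)\<^sup>2 / Q\<^sup>2"
      by (simp add: y_def power_divide)
    have "c * (Pk k / P + T k / Q) \<le> 2 * m k / \<psi> + 2 * (a k)\<^sup>2 / \<psi>\<^sup>2
        + c * ((p k)\<^sup>2 / P\<^sup>2 - 2 * (m k * a k)\<^sup>2 / Q\<^sup>2) - c * ((m k)\<^sup>2 / Q)"
      using space[of k] by (simp add: algebra_simps add_divide_distrib)
    also have "\<dots> \<le> 2 * m k / \<psi> + 2 * (a k)\<^sup>2 / \<psi>\<^sup>2 + c * (2 * x\<^sup>2) - c * ((m k)\<^sup>2 / Q)"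
      using pp pos by (intro add_mono diff_mono mult_left_mono) auto
    also have "c * (2 * x\<^sup>2) = 8 / c * ((a k)\<^sup>2 / \<psi>\<^sup>2)"
      using pos by (simp add: x_def power2_eq_square field_simps)
    finally have "c * (Pk k / P + T k / Q)
        \<le> 2 * m k / \<psi> + (2 + 8 / c) * ((a k)\<^sup>2 / \<psi>\<^sup>2) - c * ((m k)\<^sup>2 / Q)"
      by (simp add: distrib_right add_divide_distrib)
    then have "w k * (c * (Pk k / P + T k / Q))
        \<le> w k * (2 * m k / \<psi> + (2 + 8 / c) * ((a k)\<^sup>2 / \<psi>\<^sup>2) - c * ((m k)\<^sup>2 / Q))"
      using wp by (intro mult_left_mono) (auto simp: less_imp_le)
    also have "\<dots> = 2 * (w k * m k) / \<psi> + (2 + 8 / c) * (w k * (a k)\<^sup>2) / \<psi>\<^sup>2 - c * ((w k * m k) * m k) / Q"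
    proof -
      have "w' * (2 * m' / \<psi> + b * (y / \<psi>\<^sup>2) - c * (m'\<^sup>2 / Q))
          = 2 * (w' * m') / \<psi> + b * (w' * y) / \<psi>\<^sup>2 - c * ((w' * m') * m') / Q" for w' m' b y :: real
        by (simp add: algebra_simps power2_eq_square)
      then show ?thesis .
    qed
    also have "\<dots> = 2 / \<psi> + (2 + 8 / c) * (w k * (a k)\<^sup>2) / \<psi>\<^sup>2 - c * m k / Q"
      by (simp only: wp(2) mult_1_left mult_1_right)
    finally show ?thesis by (simp add: ac_simps)
  qed
  have sum: "c * ((\<Sum>k\<in>UNIV. w k * Pk k) / P + (\<Sum>k\<in>UNIV. w k * T k) / Q)
      \<le> 2 * real CARD('k) / \<psi> + (2 + 8 / c) * (\<Sum>k\<in>UNIV. w k * (a k)\<^sup>2) / \<psi>\<^sup>2 - c * (\<Sum>k\<in>UNIV. m k) / Q"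
  proof -
    have "c * ((\<Sum>k\<in>UNIV. w k * Pk k) / P + (\<Sum>k\<in>UNIV. w k * T k) / Q)
        = (\<Sum>k\<in>UNIV. w k * (Pk k / P + T k / Q) * c)"
      by (simp add: sum_divide_distrib sum_distrib_left sum.distrib algebra_simps)
    also have "\<dots> \<le> (\<Sum>k\<in>UNIV. 2 / \<psi> + (2 + 8 / c) * (w k * (a k)\<^sup>2) / \<psi>\<^sup>2 - c * m k / Q)"
      by (intro sum_mono k1)
    also have "\<dots> = 2 * real CARD('k) / \<psi> + (2 + 8 / c) * (\<Sum>k\<in>UNIV. w k * (a k)\<^sup>2) / \<psi>\<^sup>2 - c * (\<Sum>k\<in>UNIV. m k) / Q"
      by (simp add: sum.distrib sum_subtractf sum_distrib_left sum_divide_distrib)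
    finally show ?thesis .
  qed
  define S1 where "S1 = (\<Sum>k\<in>UNIV. w k * Pk k)"
  define S2 where "S2 = (\<Sum>k\<in>UNIV. w k * T k)"
  define R where "R = 2 * real CARD('k) / \<psi> + (2 + 8 / c) * (\<Sum>k\<in>UNIV. w k * (a k)\<^sup>2) / \<psi>\<^sup>2 - c * (\<Sum>k\<in>UNIV. m k) / Q"
  have "\<alpha> * P * (c * (S1 / P + S2 / Q)) \<le> \<alpha> * P * R"
    using sum pos by (intro mult_left_mono) (auto simp: S1_def S2_def R_def)
  moreover have "\<alpha> * P * (c * (S1 / P + S2 / Q)) = c * (\<alpha> * S1 + P * (\<alpha> * S2) / Q)"
    using pos by (simp add: field_simps)
  moreover have "\<alpha> * S1 = Pt / P - 2 * \<beta> * qP / v2" using pdet by (simp add: S1_def)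
  moreover have "\<alpha> * S2 = qP / P - 2 * \<beta> * qHq / v2" using pdeq by (simp add: S2_def)
  ultimately have 1: "c * (Pt / P - 2 * \<beta> * qP / v2 + P * (qP / P - 2 * \<beta> * qHq / v2) / Q) \<le> \<alpha> * P * R"
    by simp
  \<comment> \<open>The gradient terms of the equation, all carrying \<beta>, combine to the first
    order condition in the direction of Du, which \<open>gradq\<close> evaluates.\<close>
  have "c * (Pt / P - 2 * \<beta> * qP / v2 + P * (qP / P - 2 * \<beta> * qHq / v2) / Q)
      = c * (Pt / P + qP / Q) - 2 * \<beta> * P / v2 * (c * (qP / P + qHq / Q))"
    using pos(1,2,7) by (simp add: field_simps)
  also have "c * (qP / P + qHq / Q) = 2 * q2 / \<psi>" using gradq by simp
  finally have "c * (Pt / P + qP / Q) \<le> \<alpha> * P * R + 4 * \<beta> * P * q2 / (v2 * \<psi>)"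
    using 1 by simp
  then have "0 \<le> eta - 2 * P / \<psi> + (\<alpha> * P * R + 4 * \<beta> * P * q2 / (v2 * \<psi>))"
    using time by simp
  also have "\<alpha> * P * R = 2 * real CARD('k) * \<alpha> * P / \<psi>
    + (2 * \<alpha> + 8 * \<alpha> / c) * P * (\<Sum>k\<in>UNIV. w k * (a k)\<^sup>2) / \<psi>\<^sup>2 - c * \<alpha> * P * (\<Sum>k\<in>UNIV. m k) / Q"
    by (simp add: R_def algebra_simps)
  finally show ?thesis by simp
qed

context proper_gcf_flow begin

section \<open>Derivatives at positive times, where time and space directions commute\<close>

lemma has_derivative_dd_at:
  assumes f: "\<And>k. Ck_on k spacetime f" and z: "z \<in> interior_times"
  shows "(f has_derivative (\<lambda>v. dd v f z)) (at z)"
proof -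
  have "(f has_derivative (\<lambda>v. dd v f z)) (at z within interior_times)"
    using has_derivative_subset[OF has_derivative_dd[OF f] interior_times_subset] z interior_times_subset by blast
  then show ?thesis using at_within_open[OF z open_interior_times] by simp
qed

lemma dd_eqI: "z \<in> interior_times \<Longrightarrow> (f has_derivative f') (at z) \<Longrightarrow> dd v f z = f' v"
  using pder_eq[OF thick_spacetime _ has_derivative_at_withinI] interior_times_subset by blast

text \<open>Although \<open>dd\<close> is taken within all of \<open>spacetime\<close>, agreement on
  the open set of positive times is enough to transfer it.\<close>

lemma dd_cong:
  assumes f: "\<And>k. Ck_on k spacetime f" and z: "z \<in> interior_times" and eq: "\<And>y. y \<in> interior_times \<Longrightarrow> f y = g y"
  shows "dd v g z = dd v f z"
proof (rule dd_eqI[OF z])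
  show "(g has_derivative (\<lambda>v. dd v f z)) (at z)"
    by (rule has_derivative_transform_within_open[OF has_derivative_dd_at[OF f z] open_interior_times z eq])
qed

lemma dd_commute:
  fixes f :: "(real^'n) \<times> real \<Rightarrow> real"
  assumes f: "\<And>k. Ck_on k spacetime f" and z: "z \<in> interior_times"
  shows "dd v (dd w f) z = dd w (dd v f) z"
proof -
  have *: "pder interior_times v (pder interior_times w f) z = dd v (dd w f) z" for v w
  proof -
    have "dd v (pder interior_times w f) z = dd v (dd w f) z"
      by (rule dd_cong[OF Ck_dd[OF f] z]) (simp add: pder_interior_times)
    then show ?thesis by (simp add: pder_interior_times[OF z])
  qed
  show ?thesis
    using pder_commute[OF open_interior_times Ck_on_subset[OF f interior_times_subset] z, of v w] unfolding * .
qed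

lemma dd_inner_const:
  assumes f: "\<And>k. Ck_on k spacetime f" and z: "z \<in> interior_times"
  shows "dd v (\<lambda>z. f z \<bullet> x) z = dd v f z \<bullet> x"
  by (rule dd_eqI[OF z]) (intro has_derivative_inner_left has_derivative_dd_at f z)

section \<open>The equation in logarithmic form and its linearization\<close>

definition speed :: "(real^'n) \<times> real \<Rightarrow> real" where "speed = dd (0, 1) hgt"

lemma Ck_speed: "Ck_on k spacetime speed" unfolding speed_def by (rule Ck_dd[OF Ck_hgt])

lemma speed_pos: "z \<in> spacetime \<Longrightarrow> speed z > 0" by (simp add: speed_def time_derivative_pos)

text \<open>With s = 1 + |Du|^2 the vertical part of the normal is s^(-1/2), so K = s^(-(n+2)/2) det
  D^2u and u_t = K^\<alpha> s^(1/2). This is the origin of the coefficient (1 - \<alpha>(n + 2)) /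
  2.\<close>

lemma log_speed:
  assumes z: "z \<in> spacetime"
  shows "ln (speed z) = \<alpha> * ln (det (hess z)) + (1 - \<alpha> * real (CARD('n) + 2)) / 2 * ln (1 + grad z \<bullet> grad z)"
proof -
  define s where "s = 1 + grad z \<bullet> grad z"
  have s: "s > 0" by (simp add: s_def add_pos_nonneg)
  have n: "vnormal z = 1 / sqrt s" using vnormal_explicit[OF z] by (simp add: s_def power2_norm_eq_inner)
  have ln_n: "ln (vnormal z) = - ln s / 2" using s by (simp add: n ln_div ln_sqrt)
  have K: "curv z = vnormal z ^ CARD('n) * det (hess z) / s"
    using curv_eq[OF z] by (simp add: s_def power2_norm_eq_inner)
  have lnK: "ln (curv z) = real CARD('n) * ln (vnormal z) + ln (det (hess z)) - ln s"
    unfolding K using vnormal_pos[OF z] det_hess_pos[OF z] s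
    by (simp add: ln_div ln_mult ln_realpow)
  have lnP: "ln (speed z) = \<alpha> * ln (curv z) - ln (vnormal z)"
    using curv_pos[OF z] vnormal_pos[OF z] by (simp add: speed_def evolution[OF z] ln_div ln_powr)
  show ?thesis unfolding s_def[symmetric] lnP lnK ln_n by (simp add: field_simps)
qed

lemma interior_times_line:
  assumes "z \<in> interior_times" "open S" "z \<in> S"
  obtains \<delta> where "\<delta> > 0" "\<And>r. \<bar>r\<bar> < \<delta> \<Longrightarrow> z + r *\<^sub>R V \<in> interior_times \<inter> S"
proof -
  have "open (interior_times \<inter> S)" using open_interior_times assms(2) by blast
  then obtain e where e: "e > 0" "ball z e \<subseteq> interior_times \<inter> S" using assms open_contains_ball by blast
  define \<delta> where "\<delta> = e / (norm V + 1)"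
  have n: "norm V + 1 > 0" by (simp add: add_nonneg_pos)
  have d: "\<delta> > 0" using e n by (simp add: \<delta>_def)
  have "z + r *\<^sub>R V \<in> interior_times \<inter> S" if "\<bar>r\<bar> < \<delta>" for r
  proof -
    have "\<bar>r\<bar> * norm V \<le> \<bar>r\<bar> * (norm V + 1)" by (simp add: mult_left_mono)
    also have "\<dots> < \<delta> * (norm V + 1)" using that n by (rule mult_strict_right_mono)
    also have "\<dots> = e" using n by (simp add: \<delta>_def)
    finally have "z + r *\<^sub>R V \<in> ball z e" by (simp add: dist_norm)
    then show ?thesis using e by blast
  qed
  then show thesis using that d by blast
qed

lemma line_deriv_dd0:
  fixes f :: "(real^'n) \<times> real \<Rightarrow> real"
  assumes f: "\<And>k. Ck_on k spacetime f" and z: "z \<in> interior_times"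
  shows "((\<lambda>r. f (z + r *\<^sub>R v)) has_real_derivative dd v f z) (at 0)"
  using line_deriv_dd[OF f, of z 0 v] z by simp

lemma Ck_grad_sq: "Ck_on k spacetime (\<lambda>z. grad z \<bullet> grad z)"
  by (intro Ck_on_inner Ck_grad)

lemma dd_grad_sq: "z \<in> interior_times \<Longrightarrow> dd V (\<lambda>z. grad z \<bullet> grad z) z = 2 * (grad z \<bullet> dd V grad z)"
proof (subst dd_eqI)
  assume z: "z \<in> interior_times"
  show "((\<lambda>z. grad z \<bullet> grad z) has_derivative (\<lambda>V. grad z \<bullet> dd V grad z + dd V grad z \<bullet> grad z)) (at z)"
    by (intro has_derivative_inner has_derivative_dd_at Ck_grad z)
qed (auto simp: inner_commute)

lemma hessian_quadratic:
  assumes "z \<in> interior_times" shows "dd (e, 0) (dd (e, 0) hgt) z = e \<bullet> (hess z *v e)"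
proof -
  have zD: "z \<in> spacetime" using assms interior_times_subset by blast
  have "dd (e, 0) (dd (e, 0) hgt) z = dd (e, 0) (\<lambda>y. grad y \<bullet> e) z"
    using dd_cong[OF Ck_dd[OF Ck_hgt] assms, of "(e, 0)" "\<lambda>y. grad y \<bullet> e"] dd_hgt interior_times_subset by force
  also have "\<dots> = dd (e, 0) grad z \<bullet> e" by (rule dd_inner_const[OF Ck_grad assms])
  finally show ?thesis using dd_grad[OF zD] by (simp add: inner_commute)
qed

text \<open>The eigenbasis belongs to the Hessian at z and stays fixed while the point moves along
  V, so the derivative of ln det D^2u is a trace of third derivatives weighted by 1 / m i. As V may
  be temporal or spatial, u_t and Du lead to the same linear operator.\<close>

lemma log_speed_derivative:
  fixes e :: "'n \<Rightarrow> real^'n"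
  assumes z: "z \<in> interior_times"
    and e: "\<And>i j. e i \<bullet> e j = (if i = j then 1 else 0)"
    and m: "\<And>i. hess z *v e i = m i *\<^sub>R e i" "\<And>i. m i > 0"
  shows "dd V speed z / speed z = \<alpha> * (\<Sum>i\<in>UNIV. 1 / m i * dd V (dd (e i, 0) (dd (e i, 0) hgt)) z)
    + 2 * ((1 - \<alpha> * real (CARD('n) + 2)) / 2) * (grad z \<bullet> dd V grad z) / (1 + grad z \<bullet> grad z)"
proof -
  define \<beta> where "\<beta> = (1 - \<alpha> * real (CARD('n) + 2)) / 2"
  define A' where "A' = (\<chi> i j. dd V (\<lambda>y. hess y $ i $ j) z)"
  have zD: "z \<in> spacetime" using z interior_times_subset by blast
  have A: "((\<lambda>r. hess (z + r *\<^sub>R V) $ i $ j) has_real_derivative A' $ i $ j) (at 0)" for i j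
    using line_deriv_dd0[OF Ck_hess_nth z] by (simp add: A'_def)
  have quad: "e i \<bullet> (A' *v e i) = dd V (dd (e i, 0) (dd (e i, 0) hgt)) z" for i
  proof (rule DERIV_unique)
    show "((\<lambda>r. e i \<bullet> (hess (z + r *\<^sub>R V) *v e i)) has_real_derivative e i \<bullet> (A' *v e i)) (at 0)"
      unfolding inner_vec_def matrix_vector_mult_def
      by (auto intro!: derivative_eq_intros A sum.cong simp: ac_simps)
    obtain \<delta> where \<delta>: "\<delta> > 0" "\<And>r. \<bar>r\<bar> < \<delta> \<Longrightarrow> z + r *\<^sub>R V \<in> interior_times \<inter> UNIV"
      using interior_times_line[OF z open_UNIV] by blast
    show "((\<lambda>r. e i \<bullet> (hess (z + r *\<^sub>R V) *v e i)) has_real_derivative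
        dd V (dd (e i, 0) (dd (e i, 0) hgt)) z) (at 0)"
    proof (rule has_field_derivative_transform_within_open)
      show "((\<lambda>r. dd (e i, 0) (dd (e i, 0) hgt) (z + r *\<^sub>R V)) has_real_derivative
          dd V (dd (e i, 0) (dd (e i, 0) hgt)) z) (at 0)"
        by (rule line_deriv_dd0[OF Ck_dd[OF Ck_dd[OF Ck_hgt]] z])
      show "open (ball 0 \<delta>)" "0 \<in> ball 0 \<delta>" using \<delta> by auto
      show "dd (e i, 0) (dd (e i, 0) hgt) (z + r *\<^sub>R V) = e i \<bullet> (hess (z + r *\<^sub>R V) *v e i)"
        if "r \<in> ball 0 \<delta>" for r
        using hessian_quadratic \<delta>(2)[of r] that by (simp add: dist_norm)
    qed
  qed
  have HV: "hess (z + 0 *\<^sub>R V) *v e i = m i *\<^sub>R e i" for i using m(1) by simp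
  have "((\<lambda>r. det (hess (z + r *\<^sub>R V))) has_real_derivative
      det (hess z) * (\<Sum>i\<in>UNIV. (e i \<bullet> (A' *v e i)) / m i)) (at 0)"
    using has_real_derivative_det[of "\<lambda>r. hess (z + r *\<^sub>R V)" A' 0 e m, OF A e HV] m(2)
    by (simp add: less_imp_neq[symmetric])
  then have 1: "((\<lambda>r. ln (det (hess (z + r *\<^sub>R V)))) has_real_derivative
      (\<Sum>i\<in>UNIV. (e i \<bullet> (A' *v e i)) / m i)) (at 0)"
    using det_hess_pos[OF zD] by (auto intro!: derivative_eq_intros)
  have s: "1 + grad z \<bullet> grad z > 0" by (simp add: add_pos_nonneg)
  have 2: "((\<lambda>r. ln (1 + grad (z + r *\<^sub>R V) \<bullet> grad (z + r *\<^sub>R V))) has_real_derivative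
      2 * (grad z \<bullet> dd V grad z) / (1 + grad z \<bullet> grad z)) (at 0)"
    using line_deriv_dd0[OF Ck_grad_sq z, of V] s dd_grad_sq[OF z, of V]
    by (auto intro!: derivative_eq_intros)
  have rhs: "((\<lambda>r. \<alpha> * ln (det (hess (z + r *\<^sub>R V))) + \<beta> * ln (1 + grad (z + r *\<^sub>R V) \<bullet> grad (z + r *\<^sub>R V)))
      has_real_derivative \<alpha> * (\<Sum>i\<in>UNIV. (e i \<bullet> (A' *v e i)) / m i)
        + \<beta> * (2 * (grad z \<bullet> dd V grad z) / (1 + grad z \<bullet> grad z))) (at 0)"
    by (intro DERIV_add DERIV_cmult 1 2)
  obtain \<delta> where \<delta>: "\<delta> > 0" "\<And>r. \<bar>r\<bar> < \<delta> \<Longrightarrow> z + r *\<^sub>R V \<in> interior_times \<inter> UNIV"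
    using interior_times_line[OF z open_UNIV] by blast
  have "((\<lambda>r. ln (speed (z + r *\<^sub>R V))) has_real_derivative \<alpha> * (\<Sum>i\<in>UNIV. (e i \<bullet> (A' *v e i)) / m i)
        + \<beta> * (2 * (grad z \<bullet> dd V grad z) / (1 + grad z \<bullet> grad z))) (at 0)"
  proof (rule has_field_derivative_transform_within_open[OF rhs])
    show "open (ball 0 \<delta>)" "0 \<in> ball 0 \<delta>" using \<delta> by auto
    fix r :: real assume "r \<in> ball 0 \<delta>"
    then have "z + r *\<^sub>R V \<in> spacetime" using \<delta>(2)[of r] interior_times_subset by (auto simp: dist_norm)
    from log_speed[OF this] show "\<alpha> * ln (det (hess (z + r *\<^sub>R V)))
        + \<beta> * ln (1 + grad (z + r *\<^sub>R V) \<bullet> grad (z + r *\<^sub>R V)) = ln (speed (z + r *\<^sub>R V))"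
      by (simp add: \<beta>_def)
  qed
  moreover have "((\<lambda>r. ln (speed (z + r *\<^sub>R V))) has_real_derivative dd V speed z / speed z) (at 0)"
    using line_deriv_dd0[OF Ck_speed z, of V] speed_pos[OF zD] by (auto intro!: derivative_eq_intros)
  ultimately have "dd V speed z / speed z = \<alpha> * (\<Sum>i\<in>UNIV. (e i \<bullet> (A' *v e i)) / m i)
        + \<beta> * (2 * (grad z \<bullet> dd V grad z) / (1 + grad z \<bullet> grad z))"
    by (rule DERIV_unique[rotated])
  then show ?thesis unfolding \<beta>_def[symmetric] quad by (simp add: ac_simps)
qed

text \<open>Moves the differentiation along V inside, so that third derivatives of u become second
  derivatives of its derivative along V.\<close>

lemma dd_third_commute:
  assumes z: "z \<in> interior_times"
  shows "dd V (dd e (dd e hgt)) z = dd e (dd e (dd V hgt)) z"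
proof -
  have "dd V (dd e (dd e hgt)) z = dd e (dd V (dd e hgt)) z"
    by (rule dd_commute[OF Ck_dd[OF Ck_hgt] z])
  also have "\<dots> = dd e (dd e (dd V hgt)) z"
    by (rule dd_cong[OF Ck_dd[OF Ck_dd[OF Ck_hgt]] z]) (rule dd_commute[OF Ck_hgt])
  finally show ?thesis .
qed

lemma dd_hgt_interior_times: "y \<in> interior_times \<Longrightarrow> dd (v, 0) hgt y = grad y \<bullet> v"
  using dd_hgt interior_times_subset by blast

lemma dd_dd_hgt:
  assumes z: "z \<in> interior_times" shows "dd V (dd (v, 0) hgt) z = dd V grad z \<bullet> v"
proof -
  have "dd V (\<lambda>y. grad y \<bullet> v) z = dd V (dd (v, 0) hgt) z"
    by (rule dd_cong[OF Ck_dd[OF Ck_hgt] z]) (rule dd_hgt_interior_times)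
  then show ?thesis using dd_inner_const[OF Ck_grad z] by simp
qed

lemma dd_dd_dd_hgt:
  assumes z: "z \<in> interior_times" shows "dd W (dd V (dd (v, 0) hgt)) z = dd W (dd V grad) z \<bullet> v"
proof -
  have "dd W (\<lambda>y. dd V grad y \<bullet> v) z = dd W (dd V (dd (v, 0) hgt)) z"
    by (rule dd_cong[OF Ck_dd[OF Ck_dd[OF Ck_hgt]] z]) (rule dd_dd_hgt)
  then show ?thesis using dd_inner_const[OF Ck_dd[OF Ck_grad] z] by simp
qed

section \<open>The test function, with \<open>gap\<close> standing for 2\<theta> - \<upsilon>^2, at
  an interior maximum\<close>

definition gap :: "real \<Rightarrow> (real^'n) \<times> real \<Rightarrow> real" where
  "gap \<theta> z = 2 * \<theta> - 1 - grad z \<bullet> grad z"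

text \<open>The logarithm of the test function, with \<open>c = 1 / (n \<alpha>)\<close>.\<close>

definition log_test :: "real \<Rightarrow> real \<Rightarrow> real \<Rightarrow> (real^'n) \<times> real \<Rightarrow> real" where
  "log_test \<theta> M c z = ln (snd z / (1 + snd z)) + 2 * ln (M - hgt z) + c * (ln (speed z) - ln (gap \<theta> z) / 2)"

lemma Ck_gap: "Ck_on k spacetime (gap \<theta>)"
proof -
  have "Ck_on k spacetime (\<lambda>z. (2 * \<theta> - 1) + (-1) * (grad z \<bullet> grad z))"
    by (intro Ck_on_add Ck_on_const Ck_on_mult Ck_grad_sq)
  then show ?thesis by (simp add: gap_def[abs_def])
qed

lemma dd_gap: "z \<in> interior_times \<Longrightarrow> dd V (gap \<theta>) z = - 2 * (grad z \<bullet> dd V grad z)"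
  unfolding gap_def[abs_def]
proof (subst dd_eqI)
  assume z: "z \<in> interior_times"
  show "((\<lambda>z. 2 * \<theta> - 1 - grad z \<bullet> grad z) has_derivative
      (\<lambda>V. 0 - (grad z \<bullet> dd V grad z + dd V grad z \<bullet> grad z))) (at z)"
    by (intro has_derivative_diff has_derivative_const has_derivative_inner has_derivative_dd_at Ck_grad z)
qed (auto simp: inner_commute)

lemma dd_dd_gap:
  assumes z: "z \<in> interior_times"
  shows "dd V (dd V (gap \<theta>)) z = - 2 * (dd V grad z \<bullet> dd V grad z + grad z \<bullet> dd V (dd V grad) z)"
proof -
  have "dd V (\<lambda>y. - 2 * (grad y \<bullet> dd V grad y)) z = dd V (dd V (gap \<theta>)) z"
    by (rule dd_cong[OF Ck_dd[OF Ck_gap] z]) (rule dd_gap)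
  moreover have "((\<lambda>y. - 2 * (grad y \<bullet> dd V grad y)) has_derivative
      (\<lambda>W. - 2 * (grad z \<bullet> dd W (dd V grad) z + dd W grad z \<bullet> dd V grad z))) (at z)"
    by (intro has_derivative_mult_right has_derivative_inner has_derivative_dd_at Ck_dd Ck_grad z)
  from dd_eqI[OF z this, of V]
  have "dd V (\<lambda>y. - 2 * (grad y \<bullet> dd V grad y)) z
      = - 2 * (grad z \<bullet> dd V (dd V grad) z + dd V grad z \<bullet> dd V grad z)" .
  ultimately show ?thesis by simp
qed

lemma log_combination_derivs:
  fixes a a' p p' q q' :: "real \<Rightarrow> real"
  assumes "a r > 0" "p r > 0" "q r > 0"
    and "(a has_real_derivative a' r) (at r)" "(p has_real_derivative p' r) (at r)"
      "(q has_real_derivative q' r) (at r)"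
  shows "((\<lambda>r. 2 * ln (a r) + c * (ln (p r) - ln (q r) / 2)) has_real_derivative
      2 * a' r / a r + c * (p' r / p r - q' r / (2 * q r))) (at r)"
    and "(a' has_real_derivative a'') (at r) \<Longrightarrow> (p' has_real_derivative p'') (at r) \<Longrightarrow>
      (q' has_real_derivative q'') (at r) \<Longrightarrow>
      ((\<lambda>r. 2 * a' r / a r + c * (p' r / p r - q' r / (2 * q r))) has_real_derivative
       2 * a'' / a r - 2 * (a' r)\<^sup>2 / (a r)\<^sup>2 +
       c * (p'' / p r - (p' r)\<^sup>2 / (p r)\<^sup>2 - q'' / (2 * q r) + (q' r)\<^sup>2 / (2 * (q r)\<^sup>2))) (at r)"
proof -
  show "((\<lambda>r. 2 * ln (a r) + c * (ln (p r) - ln (q r) / 2)) has_real_derivative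
      2 * a' r / a r + c * (p' r / p r - q' r / (2 * q r))) (at r)"
    using assms by (auto intro!: derivative_eq_intros simp: field_simps)
  assume d: "(a' has_real_derivative a'') (at r)" "(p' has_real_derivative p'') (at r)"
    "(q' has_real_derivative q'') (at r)"
  have quot: "((\<lambda>r. f r / g r) has_real_derivative f' / g r - f r * g' / (g r)\<^sup>2) (at r)"
    if "(f has_real_derivative f') (at r)" "(g has_real_derivative g') (at r)" "g r > 0"
    for f g :: "real \<Rightarrow> real" and f' g'
    using DERIV_divide[OF that(1,2)] that(3) by (simp add: diff_divide_distrib power2_eq_square)
  have "((\<lambda>r. 2 * (a' r / a r) + c * (p' r / p r - (q' r / q r) / 2)) has_real_derivative
      2 * (a'' / a r - a' r * a' r / (a r)\<^sup>2) + c * ((p'' / p r - p' r * p' r / (p r)\<^sup>2)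
        - (q'' / q r - q' r * q' r / (q r)\<^sup>2) / 2)) (at r)"
    by (intro DERIV_add DERIV_cmult DERIV_diff DERIV_cdivide quot d assms)
  then have "((\<lambda>r. 2 * a' r / a r + c * (p' r / p r - q' r / (2 * q r))) has_real_derivative
      2 * (a'' / a r - a' r * a' r / (a r)\<^sup>2) + c * ((p'' / p r - p' r * p' r / (p r)\<^sup>2)
        - (q'' / q r - q' r * q' r / (q r)\<^sup>2) / 2)) (at r)"
    by (simp add: mult.commute)
  then show "((\<lambda>r. 2 * a' r / a r + c * (p' r / p r - q' r / (2 * q r))) has_real_derivative
       2 * a'' / a r - 2 * (a' r)\<^sup>2 / (a r)\<^sup>2 +
       c * (p'' / p r - (p' r)\<^sup>2 / (p r)\<^sup>2 - q'' / (2 * q r) + (q' r)\<^sup>2 / (2 * (q r)\<^sup>2))) (at r)"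
    by (rule DERIV_cong) (simp add: power2_eq_square diff_divide_distrib algebra_simps)
qed

text \<open>Maximality is required only nearby and against earlier times, which suffices because
  time enters with a single derivative. The eigenbasis is part of the conclusion, since the sums
  over m and 1/m have still to be compared with K and \<open>lam\<close>.\<close>

lemma interior_maximum:
  assumes z: "z \<in> interior_times" and c: "c > 0" and uM: "hgt z < M" and Qz: "gap \<theta> z > 0" and \<epsilon>: "\<epsilon> > 0"
    and max: "\<And>y. y \<in> interior_times \<Longrightarrow> dist y z < \<epsilon> \<Longrightarrow> snd y \<le> snd z \<Longrightarrow> hgt y < M \<Longrightarrow> gap \<theta> y > 0 \<Longrightarrow>
      log_test \<theta> M c y \<le> log_test \<theta> M c z"
  obtains e :: "'n \<Rightarrow> real^'n" and m where "\<And>i j. e i \<bullet> e j = (if i = j then 1 else 0)"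
    "\<And>i. hess z *v e i = m i *\<^sub>R e i" "\<And>i. m i > 0" "det (hess z) = (\<Prod>i\<in>UNIV. m i)"
    "0 \<le> 1 / (snd z * (1 + snd z)) - 2 * speed z / (M - hgt z)
      + 2 * real CARD('n) * \<alpha> * speed z / (M - hgt z)
      + 4 * ((1 - \<alpha> * real (CARD('n) + 2)) / 2) * speed z * (grad z \<bullet> grad z) / ((1 + grad z \<bullet> grad z) * (M - hgt z))
      + (2 * \<alpha> + 8 * \<alpha> / c) * speed z * (\<Sum>k\<in>UNIV. 1 / m k * (grad z \<bullet> e k)\<^sup>2) / (M - hgt z)\<^sup>2
      - c * \<alpha> * speed z * (\<Sum>k\<in>UNIV. m k) / gap \<theta> z"
proof -
  have zD: "z \<in> spacetime" using z interior_times_subset by blast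
  have z00: "z + (0, 0) = z" by (simp flip: zero_prod_def)
  obtain e :: "'n \<Rightarrow> real^'n" and m where e: "\<And>i j. e i \<bullet> e j = (if i = j then 1 else 0)"
    "\<And>i. hess z *v e i = m i *\<^sub>R e i" "\<And>i. m i > 0" "det (hess z) = (\<Prod>i\<in>UNIV. m i)"
    using positive_definite_det_pos[OF hess_sym[OF zD] hess_pos[OF zD]] by metis
  \<comment> \<open>An open neighbourhood in which all logarithms of the test function have positive
    arguments.\<close>
  define NB where "NB = (interior_times \<inter> hgt -` {..<M}) \<inter> (interior_times \<inter> gap \<theta> -` {0<..}) \<inter> ball z \<epsilon>"
  have co: "continuous_on interior_times hgt" "continuous_on interior_times (gap \<theta>)"
    using continuous_on_subset[OF continuous_dd interior_times_subset] Ck_hgt Ck_gap by blast+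
  have openNB: "open NB"
    unfolding NB_def by (intro open_Int continuous_open_preimage co open_interior_times) auto
  have zNB: "z \<in> NB" using z uM Qz \<epsilon> by (simp add: NB_def)
  have NBmax: "log_test \<theta> M c y \<le> log_test \<theta> M c z" if "y \<in> NB" "snd y \<le> snd z" for y
    using that by (intro max) (auto simp: NB_def dist_commute)
  have line: "\<exists>\<delta>>0. \<forall>r. \<bar>r\<bar> < \<delta> \<longrightarrow> z + r *\<^sub>R V \<in> NB" for V
  proof -
    obtain \<delta> where "\<delta> > 0" "\<And>r. \<bar>r\<bar> < \<delta> \<Longrightarrow> z + r *\<^sub>R V \<in> interior_times \<inter> NB"
      using interior_times_line[OF z openNB zNB] by blast
    then show ?thesis by auto
  qed
  let ?N1 = "\<lambda>V y. 2 * (- dd V hgt y) / (M - hgt y) + c * (dd V speed y / speed y - dd V (gap \<theta>) y / (2 * gap \<theta> y))"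
  let ?N2 = "\<lambda>V. 2 * (- dd V (dd V hgt) z) / (M - hgt z) - 2 * (- dd V hgt z)\<^sup>2 / (M - hgt z)\<^sup>2
    + c * (dd V (dd V speed) z / speed z - (dd V speed z)\<^sup>2 / (speed z)\<^sup>2 - dd V (dd V (gap \<theta>)) z / (2 * gap \<theta> z)
      + (dd V (gap \<theta>) z)\<^sup>2 / (2 * (gap \<theta> z)\<^sup>2))"
  have pos: "M - hgt y > 0" "speed y > 0" "gap \<theta> y > 0" "y \<in> interior_times" if "y \<in> NB" for y
    using that speed_pos[OF subsetD[OF interior_times_subset, of y]] by (auto simp: NB_def)
  have dU: "((\<lambda>r. M - hgt (z + r *\<^sub>R V)) has_real_derivative - dd V hgt (z + r *\<^sub>R V)) (at r)"
    "((\<lambda>r. speed (z + r *\<^sub>R V)) has_real_derivative dd V speed (z + r *\<^sub>R V)) (at r)"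
    "((\<lambda>r. gap \<theta> (z + r *\<^sub>R V)) has_real_derivative dd V (gap \<theta>) (z + r *\<^sub>R V)) (at r)"
    if "z + r *\<^sub>R V \<in> NB" for V r
    using line_deriv_dd[OF Ck_hgt pos(4)[OF that]] line_deriv_dd[OF Ck_speed pos(4)[OF that]]
      line_deriv_dd[OF Ck_gap pos(4)[OF that]]
    by (auto intro!: derivative_eq_intros)
  have d1: "((\<lambda>r. 2 * ln (M - hgt (z + r *\<^sub>R V)) + c * (ln (speed (z + r *\<^sub>R V)) - ln (gap \<theta> (z + r *\<^sub>R V)) / 2))
      has_real_derivative ?N1 V (z + r *\<^sub>R V)) (at r)" if "z + r *\<^sub>R V \<in> NB" for V r
    using log_combination_derivs(1)[where a = "\<lambda>r. M - hgt (z + r *\<^sub>R V)" and p = "\<lambda>r. speed (z + r *\<^sub>R V)"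
        and q = "\<lambda>r. gap \<theta> (z + r *\<^sub>R V)" and a' = "\<lambda>r. - dd V hgt (z + r *\<^sub>R V)"
        and p' = "\<lambda>r. dd V speed (z + r *\<^sub>R V)" and q' = "\<lambda>r. dd V (gap \<theta>) (z + r *\<^sub>R V)"]
      pos[OF that] dU[OF that] by blast
  have d2: "((\<lambda>r. ?N1 V (z + r *\<^sub>R V)) has_real_derivative ?N2 V) (at 0)" for V
  proof -
    have "z + 0 *\<^sub>R V \<in> NB" using zNB by simp
    note log_combination_derivs(2)[where a = "\<lambda>r. M - hgt (z + r *\<^sub>R V)" and p = "\<lambda>r. speed (z + r *\<^sub>R V)"
        and q = "\<lambda>r. gap \<theta> (z + r *\<^sub>R V)" and a' = "\<lambda>r. - dd V hgt (z + r *\<^sub>R V)"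
        and p' = "\<lambda>r. dd V speed (z + r *\<^sub>R V)" and q' = "\<lambda>r. dd V (gap \<theta>) (z + r *\<^sub>R V)" and r = 0,
        OF pos(1-3)[OF this] dU[OF this] DERIV_minus[OF line_deriv_dd0[OF Ck_dd[OF Ck_hgt] z]]
        line_deriv_dd0[OF Ck_dd[OF Ck_speed] z] line_deriv_dd0[OF Ck_dd[OF Ck_gap] z], where c = c]
    then show ?thesis by simp
  qed
  have spatial: "?N1 (v, 0) z = 0" "?N2 (v, 0) \<le> 0" for v
  proof -
    obtain \<delta> where \<delta>: "\<delta> > 0" "\<And>r. \<bar>r\<bar> < \<delta> \<Longrightarrow> z + r *\<^sub>R (v, 0) \<in> NB" using line by blast
    let ?f = "\<lambda>r. 2 * ln (M - hgt (z + r *\<^sub>R (v, 0)))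
      + c * (ln (speed (z + r *\<^sub>R (v, 0))) - ln (gap \<theta> (z + r *\<^sub>R (v, 0))) / 2)"
    have le: "?f r \<le> ?f 0" if "\<bar>r\<bar> < \<delta>" for r
      using NBmax[OF \<delta>(2)[OF that]] by (simp add: log_test_def flip: zero_prod_def)
    have "?N1 (v, 0) (z + 0 *\<^sub>R (v, 0)) = 0"
      by (rule second_derivative_test_max(1)[OF \<delta>(1), of ?f, OF d1 d2 le]) (use \<delta>(2) in auto)
    then show "?N1 (v, 0) z = 0" by (simp flip: zero_prod_def)
    show "?N2 (v, 0) \<le> 0"
      by (rule second_derivative_test_max(2)[OF \<delta>(1), of ?f, OF d1 d2 le]) (use \<delta>(2) in auto)
  qed
  have sz: "snd z > 0" using z by (simp add: interior_times_def)
  have time: "0 \<le> 1 / (snd z * (1 + snd z)) + ?N1 (0, 1) z"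
  proof -
    obtain \<delta> where \<delta>: "\<delta> > 0" "\<And>r. \<bar>r\<bar> < \<delta> \<Longrightarrow> z + r *\<^sub>R (0, 1) \<in> NB" using line by blast
    have l: "((\<lambda>r. ln ((snd z + r) / (1 + (snd z + r)))) has_real_derivative 1 / (snd z * (1 + snd z))) (at 0)"
    proof -
      define s where "s = snd z"
      have s: "s > 0" using sz by (simp add: s_def)
      have g: "((\<lambda>r. (s + r) / (1 + (s + r))) has_real_derivative 1 / (1 + s)\<^sup>2) (at 0)"
        using s by (auto intro!: derivative_eq_intros simp: power2_eq_square)
      have "(s + 0) / (1 + (s + 0)) > 0" using s by simp
      from DERIV_chain2[OF DERIV_ln[OF this] g] show ?thesis
        unfolding s_def[symmetric]
      proof (rule DERIV_cong)
        have "k / s * (1 / k\<^sup>2) = 1 / (s * k)" if "k > 0" for k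
          using s that by (simp add: field_simps power2_eq_square)
        from this[of "1 + s"] show "inverse ((s + 0) / (1 + (s + 0))) * (1 / (1 + s)\<^sup>2) = 1 / (s * (1 + s))"
          using s by simp
      qed
    qed
    have z0: "z + 0 *\<^sub>R (0, 1) \<in> NB" using zNB by (simp flip: zero_prod_def)
    have "((\<lambda>r. log_test \<theta> M c (z + r *\<^sub>R (0, 1))) has_real_derivative
        1 / (snd z * (1 + snd z)) + ?N1 (0, 1) z) (at 0)"
      using DERIV_add[OF l d1[OF z0]] by (simp add: log_test_def add.assoc z00)
    then show ?thesis
      by (rule derivative_at_left_max[OF \<delta>(1)]) (use NBmax \<delta>(2) in \<open>auto simp: z00\<close>)
  qed
  define q where "q = grad z"
  define T where "T k = q \<bullet> dd (e k, 0) (dd (e k, 0) grad) z" for k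
  have qV: "dd (v, 0) grad z = hess z *v v" for v by (rule dd_grad[OF zD])
  have uV: "dd (v, 0) hgt z = q \<bullet> v" for v by (simp add: q_def dd_hgt[OF zD])
  have QV: "dd (v, 0) (gap \<theta>) z = - 2 * (q \<bullet> (hess z *v v))" for v
    by (simp add: dd_gap[OF z] qV q_def)
  \<comment> \<open>The time derivative of |Du|^2 is twice the derivative of u_t along Du, so the
    equation differentiated in the direction of Du applies to it.\<close>
  have qt: "q \<bullet> dd (0, 1) grad z = dd (q, 0) speed z"
    using dd_commute[OF Ck_hgt z, of "(0, 1)" "(q, 0)"] dd_dd_hgt[OF z, of "(0, 1)" q]
    by (simp add: speed_def inner_commute)
  have eHe: "e k \<bullet> e k = 1" for k by (simp add: e(1))
  have "0 \<le> 1 / (snd z * (1 + snd z)) - 2 * speed z / (M - hgt z)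
      + 2 * real CARD('n) * \<alpha> * speed z / (M - hgt z)
      + 4 * ((1 - \<alpha> * real (CARD('n) + 2)) / 2) * speed z * (q \<bullet> q) / ((1 + q \<bullet> q) * (M - hgt z))
      + (2 * \<alpha> + 8 * \<alpha> / c) * speed z * (\<Sum>k\<in>UNIV. 1 / m k * (q \<bullet> e k)\<^sup>2) / (M - hgt z)\<^sup>2
      - c * \<alpha> * speed z * (\<Sum>k\<in>UNIV. m k) / gap \<theta> z"
  proof (rule maximum_point_algebra[where w = "\<lambda>k. 1 / m k" and a = "\<lambda>k. q \<bullet> e k" and T = T
        and p = "\<lambda>k. dd (e k, 0) speed z" and Pk = "\<lambda>k. dd (e k, 0) (dd (e k, 0) speed) z"
        and Pt = "dd (0, 1) speed z" and qP = "dd (q, 0) speed z" and qHq = "q \<bullet> (hess z *v q)"])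
    show "speed z > 0" "gap \<theta> z > 0" "M - hgt z > 0" using pos[OF zNB] by auto
    show "1 + q \<bullet> q > 0" by (simp add: add_pos_nonneg)
    show "0 \<le> 1 / (snd z * (1 + snd z)) - 2 * speed z / (M - hgt z)
        + c * (dd (0, 1) speed z / speed z + dd (q, 0) speed z / gap \<theta> z)"
    proof -
      have "dd (0, 1) (gap \<theta>) z = - 2 * dd (q, 0) speed z"
        using dd_gap[OF z, of "(0, 1)" \<theta>] qt by (simp add: q_def)
      moreover have "dd (0, 1) hgt z = speed z" by (simp add: speed_def)
      ultimately show ?thesis using time by simp
    qed
    show "- 2 * m k / (M - hgt z) - 2 * (q \<bullet> e k)\<^sup>2 / (M - hgt z)\<^sup>2 +
        c * (dd (e k, 0) (dd (e k, 0) speed) z / speed z - (dd (e k, 0) speed z)\<^sup>2 / (speed z)\<^sup>2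
          + ((m k)\<^sup>2 + T k) / gap \<theta> z + 2 * (m k * (q \<bullet> e k))\<^sup>2 / (gap \<theta> z)\<^sup>2) \<le> 0" for k
    proof -
      define S where "S = (m k)\<^sup>2 + T k"
      have "dd (e k, 0) (dd (e k, 0) hgt) z = m k"
        by (simp add: hessian_quadratic[OF z] e(2) eHe)
      moreover have "dd (e k, 0) (dd (e k, 0) (gap \<theta>)) z = - 2 * S"
        by (simp add: S_def dd_dd_gap[OF z] qV e(2) eHe T_def q_def power2_eq_square)
      moreover have "dd (e k, 0) (gap \<theta>) z = - 2 * (m k * (q \<bullet> e k))"
        by (simp add: QV e(2))
      ultimately show ?thesis
        using spatial(2)[of "e k"] unfolding S_def[symmetric] by (simp add: uV power_mult_distrib)
    qed
    show "- 2 * (q \<bullet> e k) / (M - hgt z) + c * (dd (e k, 0) speed z / speed z + m k * (q \<bullet> e k) / gap \<theta> z) = 0" for k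
      using spatial(1)[of "e k"] by (simp add: uV QV e(2))
    show "- 2 * (q \<bullet> q) / (M - hgt z) + c * (dd (q, 0) speed z / speed z + q \<bullet> (hess z *v q) / gap \<theta> z) = 0"
      using spatial(1)[of q] by (simp add: uV QV)
    have "dd (0, 1) (dd (e k, 0) (dd (e k, 0) hgt)) z = dd (e k, 0) (dd (e k, 0) speed) z" for k
      unfolding speed_def by (rule dd_third_commute[OF z])
    then show "dd (0, 1) speed z / speed z = \<alpha> * (\<Sum>k\<in>UNIV. 1 / m k * dd (e k, 0) (dd (e k, 0) speed) z)
        + 2 * ((1 - \<alpha> * real (CARD('n) + 2)) / 2) * dd (q, 0) speed z / (1 + q \<bullet> q)"
      using log_speed_derivative[OF z e(1-3), of "(0, 1)"] qt by (simp add: q_def)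
    have "dd (q, 0) (dd (e k, 0) (dd (e k, 0) hgt)) z = T k" for k
      using dd_third_commute[OF z, of "(q, 0)" "(e k, 0)"] dd_dd_dd_hgt[OF z, of "(e k, 0)" "(e k, 0)" q]
      by (simp only: T_def inner_commute)
    then show "dd (q, 0) speed z / speed z = \<alpha> * (\<Sum>k\<in>UNIV. 1 / m k * T k)
        + 2 * ((1 - \<alpha> * real (CARD('n) + 2)) / 2) * (q \<bullet> (hess z *v q)) / (1 + q \<bullet> q)"
      using log_speed_derivative[OF z e(1-3), of "(q, 0)"] by (simp add: qV q_def)
  qed (use c \<alpha>_pos e(3) in auto)
  then show thesis using that[OF e] by (simp add: q_def)
qed

end

subsection \<open>The speed estimate\<close>

text \<open>The variables stand for \<kappa> = |Du|^2, m = the inverse Hessian evaluated on Du, S =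
  the trace of the Hessian and P = u_t. The good term is at least K^\<alpha> K^(1/n) / (2\<theta>),
  and every other term is at most K^\<alpha> times a quantity free of K, so K^\<alpha>
  cancels.\<close>

lemma maximum_point_bound:
  fixes s K \<upsilon> \<psi> M \<theta> \<Lambda> \<alpha> n m S \<kappa> :: real
  assumes pos: "s > 0" "K > 0" "\<upsilon> \<ge> 1" "\<psi> > 0" "\<psi> \<le> M" "\<alpha> > 0" "n > 0" "\<Lambda> > 0" "M \<ge> 1"
    and \<upsilon>: "\<upsilon>\<^sup>2 = 1 + \<kappa>" "\<upsilon>\<^sup>2 \<le> \<theta>" and Q: "Q = 2 * \<theta> - \<upsilon>\<^sup>2" and \<kappa>: "\<kappa> \<ge> 0"
    and m: "m \<le> \<Lambda> / \<upsilon>" and S: "S \<ge> n * (K powr (1 / n) * \<upsilon>)" and P: "P = \<upsilon> * K powr \<alpha>"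
    and J: "0 \<le> 1 / (s * (1 + s)) - 2 * P / \<psi> + 2 * n * \<alpha> * P / \<psi>
      + 4 * ((1 - \<alpha> * (n + 2)) / 2) * P * \<kappa> / ((1 + \<kappa>) * \<psi>)
      + (2 * \<alpha> + 8 * \<alpha> * (n * \<alpha>)) * P * m / \<psi>\<^sup>2 - 1 / n * P * S / Q"
  shows "s / (1 + s) * \<psi>\<^sup>2 * K powr (1 / n) \<le> 2 * \<theta> * (M\<^sup>2 * (1 + 2 * n * \<alpha>) + 2 * \<alpha> * (1 + 4 * n * \<alpha>) * \<Lambda>)"
proof -
  define k where "k = K powr (1 / n)"
  define L where "L = K powr \<alpha>"
  define \<eta> where "\<eta> = s / (1 + s)"
  have k: "k > 0" and L: "L > 0" using pos by (auto simp: k_def L_def)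
  have \<eta>: "0 < \<eta>" "\<eta> \<le> 1" using pos by (auto simp: \<eta>_def)
  have u1: "\<upsilon>\<^sup>2 \<ge> 1" using \<upsilon> \<kappa> by simp
  have \<theta>: "\<theta> \<ge> 1" using \<upsilon>(2) u1 by simp
  have Qp: "Q > 0" "Q \<le> 2 * \<theta>" using Q \<upsilon>(2) u1 \<theta> by auto
  have P0: "P > 0" using pos L by (simp add: P L_def[symmetric])
  have psi2: "\<psi>\<^sup>2 \<le> M\<^sup>2" using pos by (intro power_mono) auto
  have MM: "M \<le> M\<^sup>2" using pos by (simp add: power2_eq_square)
  let ?B = "M\<^sup>2 * (1 + 2 * n * \<alpha>) + 2 * \<alpha> * (1 + 4 * n * \<alpha>) * \<Lambda>"
  have B: "?B \<ge> M\<^sup>2"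
  proof -
    have "0 \<le> M\<^sup>2 * (2 * n * \<alpha>)" "0 \<le> 2 * \<alpha> * (1 + 4 * n * \<alpha>) * \<Lambda>" using pos by auto
    then show ?thesis by (simp add: algebra_simps)
  qed
  have "\<eta> * \<psi>\<^sup>2 * k \<le> 2 * \<theta> * ?B"
  \<comment> \<open>For K \<le> 1 the claim is trivial. Otherwise K^\<alpha> \<ge> 1, which lets the
    term 1 / (s (1 + s)) from the time cutoff carry the factor K^\<alpha> as well.\<close>
  proof (cases "K \<le> 1")
    case True
    have "k \<le> 1" unfolding k_def using True pos by (intro powr_le1) auto
    then have "\<eta> * \<psi>\<^sup>2 * k \<le> 1 * M\<^sup>2 * 1" using \<eta> k psi2 by (intro mult_mono) auto
    also have "\<dots> \<le> ?B" using B by simp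
    also have "\<dots> \<le> 2 * \<theta> * ?B"
    proof -
      have "0 \<le> ?B" using B zero_le_power2[of M] by linarith
      then show ?thesis using \<theta> mult_right_mono[of 1 "2 * \<theta>" ?B] by simp
    qed
    finally show ?thesis .
  next
    case False
    then have L1: "L \<ge> 1" unfolding L_def using pos by (intro ge_one_powr_ge_zero) auto
    \<comment> \<open>Over the common denominator 1 + \<kappa> the bracket is 2n\<alpha> - 2 -
      4\<alpha>\<kappa>, of which only the first summand is kept; as 1 + \<kappa> = \<upsilon>^2,
      the quotient of P by it is K^\<alpha> / \<upsilon>.\<close>
    have first: "- 2 * P / \<psi> + 2 * n * \<alpha> * P / \<psi>
        + 4 * ((1 - \<alpha> * (n + 2)) / 2) * P * \<kappa> / ((1 + \<kappa>) * \<psi>) \<le> 2 * n * \<alpha> * L / \<psi>"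
    proof -
      have q1: "1 + \<kappa> > 0" using \<kappa> by simp
      have "- 2 * P / \<psi> + 2 * n * \<alpha> * P / \<psi> + 4 * ((1 - \<alpha> * (n + 2)) / 2) * P * \<kappa> / ((1 + \<kappa>) * \<psi>)
          = P / ((1 + \<kappa>) * \<psi>) * (2 * n * \<alpha> - 2 - 4 * \<alpha> * \<kappa>)"
      proof -
        have scale: "P / (R * \<psi>) * (x * R) = x * P / \<psi>" if "R > 0" for R x
          using that by simp
        have "- 2 * P / \<psi> = P / ((1 + \<kappa>) * \<psi>) * (- 2 * (1 + \<kappa>))"
          "2 * n * \<alpha> * P / \<psi> = P / ((1 + \<kappa>) * \<psi>) * (2 * n * \<alpha> * (1 + \<kappa>))"
          using scale[OF q1, of "- 2"] scale[OF q1, of "2 * n * \<alpha>"] by simp_all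
        moreover have "4 * ((1 - \<alpha> * (n + 2)) / 2) * P * \<kappa> / ((1 + \<kappa>) * \<psi>)
            = P / ((1 + \<kappa>) * \<psi>) * (2 * (1 - \<alpha> * (n + 2)) * \<kappa>)"
        proof -
          have "4 * (b / 2) * P * \<kappa> / D = P / D * (2 * b * \<kappa>)" for b D by simp
          then show ?thesis .
        qed
        ultimately have "- 2 * P / \<psi> + 2 * n * \<alpha> * P / \<psi> + 4 * ((1 - \<alpha> * (n + 2)) / 2) * P * \<kappa> / ((1 + \<kappa>) * \<psi>)
          = P / ((1 + \<kappa>) * \<psi>) * (- 2 * (1 + \<kappa>) + 2 * n * \<alpha> * (1 + \<kappa>) + 2 * (1 - \<alpha> * (n + 2)) * \<kappa>)"
          by (simp only: distrib_left)
        then show ?thesis by (simp add: algebra_simps)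
      qed
      also have "\<dots> \<le> P / ((1 + \<kappa>) * \<psi>) * (2 * n * \<alpha>)"
      proof (rule mult_left_mono)
        have "0 \<le> \<alpha> * \<kappa>" using pos \<kappa> by simp
        then show "2 * n * \<alpha> - 2 - 4 * \<alpha> * \<kappa> \<le> 2 * n * \<alpha>" by simp
      qed (use P0 q1 pos in auto)
      also have "\<dots> = (L / \<upsilon>) * (2 * n * \<alpha> / \<psi>)"
        using pos by (simp add: P L_def[symmetric] \<upsilon>(1)[symmetric] power2_eq_square)
      also have "\<dots> \<le> L * (2 * n * \<alpha> / \<psi>)"
        using pos L by (intro mult_right_mono) (auto simp: divide_le_eq mult_left_mono)
      finally show ?thesis by (simp add: ac_simps)
    qed
    \<comment> \<open>The factor 1/\<upsilon> in the bound for m cancels the \<upsilon> in P, so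
      \<Lambda> enters without \<theta>.\<close>
    have second: "(2 * \<alpha> + 8 * \<alpha> * (n * \<alpha>)) * P * m / \<psi>\<^sup>2 \<le> (2 * \<alpha> + 8 * \<alpha> * (n * \<alpha>)) * L * \<Lambda> / \<psi>\<^sup>2"
    proof -
      have "P * m \<le> P * (\<Lambda> / \<upsilon>)" using m P0 by (intro mult_left_mono) auto
      also have "\<dots> = L * \<Lambda>" using pos by (simp add: P L_def[symmetric])
      finally have "(2 * \<alpha> + 8 * \<alpha> * (n * \<alpha>)) * (P * m) / \<psi>\<^sup>2 \<le> (2 * \<alpha> + 8 * \<alpha> * (n * \<alpha>)) * (L * \<Lambda>) / \<psi>\<^sup>2"
        using pos by (intro divide_right_mono mult_left_mono) auto
      then show ?thesis by (simp only: mult.assoc)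
    qed
    \<comment> \<open>The lower bound for S and P = \<upsilon> K^\<alpha> together produce
      \<upsilon>^2, which is at least 1, while Q is at most 2\<theta>.\<close>
    have third: "L * k / (2 * \<theta>) \<le> 1 / n * P * S / Q"
    proof -
      have "L * k / (2 * \<theta>) \<le> L * k / Q"
        using L k Qp by (intro divide_left_mono) auto
      also have "L * k * 1 \<le> L * k * \<upsilon>\<^sup>2" using u1 L k by (intro mult_left_mono) auto
      then have "L * k / Q \<le> L * k * \<upsilon>\<^sup>2 / Q" using Qp by (intro divide_right_mono) auto
      also have "L * k * \<upsilon>\<^sup>2 = 1 / n * P * (n * (k * \<upsilon>))"
        using pos by (simp add: P L_def[symmetric] power2_eq_square)
      also have "1 / n * P * (n * (k * \<upsilon>)) / Q \<le> 1 / n * P * S / Q"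
        using S P0 pos Qp by (intro divide_right_mono mult_left_mono) (auto simp: k_def)
      finally show ?thesis .
    qed
    have "L * k / (2 * \<theta>) \<le> 1 / (s * (1 + s)) + 2 * n * \<alpha> * L / \<psi> + (2 * \<alpha> + 8 * \<alpha> * (n * \<alpha>)) * L * \<Lambda> / \<psi>\<^sup>2"
      using J first second third by linarith
    also have "1 / (s * (1 + s)) \<le> L * (1 / (s * (1 + s)))"
      using L1 pos mult_right_mono[of 1 L "1 / (s * (1 + s))"] by simp
    finally have "L * (k / (2 * \<theta>)) \<le> L * (1 / (s * (1 + s)) + 2 * n * \<alpha> / \<psi> + (2 * \<alpha> + 8 * \<alpha> * (n * \<alpha>)) * \<Lambda> / \<psi>\<^sup>2)"
      by (simp add: algebra_simps)
    then have "k / (2 * \<theta>) \<le> 1 / (s * (1 + s)) + 2 * n * \<alpha> / \<psi> + (2 * \<alpha> + 8 * \<alpha> * (n * \<alpha>)) * \<Lambda> / \<psi>\<^sup>2"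
      using L by (simp only: mult_le_cancel_left_pos)
    \<comment> \<open>The weight \<eta> \<psi>^2 removes the denominators on the right: \<eta> / (s
      (1 + s)) = 1 / (1 + s)^2 \<le> 1, \<eta> \<le> 1 and \<psi> \<le> M \<le> M^2.\<close>
    then have "(\<eta> * \<psi>\<^sup>2) * (k / (2 * \<theta>))
        \<le> (\<eta> * \<psi>\<^sup>2) * (1 / (s * (1 + s)) + 2 * n * \<alpha> / \<psi> + (2 * \<alpha> + 8 * \<alpha> * (n * \<alpha>)) * \<Lambda> / \<psi>\<^sup>2)"
      using \<eta> by (intro mult_left_mono) auto
    also have "\<dots> = \<psi>\<^sup>2 * (\<eta> * (1 / (s * (1 + s)))) + \<eta> * (2 * n * \<alpha> * \<psi>) + \<eta> * ((2 * \<alpha> + 8 * \<alpha> * (n * \<alpha>)) * \<Lambda>)"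
      using pos by (simp add: distrib_left power2_eq_square)
    also have "\<dots> \<le> M\<^sup>2 * 1 + 1 * (2 * n * \<alpha> * M\<^sup>2) + 1 * ((2 * \<alpha> + 8 * \<alpha> * (n * \<alpha>)) * \<Lambda>)"
    proof (intro add_mono mult_mono psi2)
      have "\<eta> * (1 / (s * (1 + s))) = 1 / (1 + s)\<^sup>2"
        using pos by (simp add: \<eta>_def power2_eq_square)
      also have "\<dots> \<le> 1" using pos by (simp add: power2_eq_square mult_ge1_I)
      finally show "\<eta> * (1 / (s * (1 + s))) \<le> 1" .
    qed (use \<eta> pos MM in auto)
    also have "\<dots> = ?B" by (simp add: algebra_simps)
    finally show ?thesis using \<theta> by (simp add: divide_le_eq mult.commute)
  qed
  then show ?thesis by (simp add: k_def \<eta>_def)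
qed

context proper_gcf_flow begin

text \<open>The left-hand side is \<open>q \<bullet> H^(-1) q\<close>; test the Rayleigh bound with \<open>w = H^(-1) q\<close>.\<close>

lemma inverse_hessian_bound:
  fixes e :: "'n \<Rightarrow> real^'n"
  assumes z: "z \<in> spacetime" and e: "\<And>i j. e i \<bullet> e j = (if i = j then 1 else 0)"
    "\<And>i. hess z *v e i = m i *\<^sub>R e i" "\<And>i. m i > 0"
  shows "(\<Sum>k\<in>UNIV. 1 / m k * (grad z \<bullet> e k)\<^sup>2) \<le> vnormal z * inverse (lam z)"
proof -
  define w where "w = (\<Sum>k\<in>UNIV. (grad z \<bullet> e k / m k) *\<^sub>R e k)"
  define r where "r = (\<Sum>k\<in>UNIV. 1 / m k * (grad z \<bullet> e k)\<^sup>2)"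
  have qw: "grad z \<bullet> w = r"
    by (simp add: w_def r_def inner_sum_right power2_eq_square)
  have "hess z *v w = (\<Sum>k\<in>UNIV. (grad z \<bullet> e k) *\<^sub>R e k)"
    unfolding w_def using e(3)
    by (simp add: linear_sum[OF matrix_vector_mul_linear] matrix_vector_mult_scaleR e(2) less_imp_neq[symmetric])
  also have "\<dots> = grad z" using orthonormal_vec_expand[OF e(1), of "grad z"] by (simp add: inner_commute)
  finally have Hw: "hess z *v w = grad z" .
  have r0: "r \<ge> 0" unfolding r_def using e(3) by (intro sum_nonneg) (simp add: less_imp_le)
  have "lam z * ((norm w)\<^sup>2 + r\<^sup>2) \<le> vnormal z * r"
    using lam_props(2)[OF z, of w] by (simp add: Hw qw inner_commute[of w])
  moreover have "lam z * r\<^sup>2 \<le> lam z * ((norm w)\<^sup>2 + r\<^sup>2)"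
    using lam_props(1)[OF z] by (intro mult_left_mono) auto
  ultimately have le: "(lam z * r) * r \<le> vnormal z * r" by (simp add: power2_eq_square)
  have "lam z * r \<le> vnormal z"
  proof (cases "r = 0")
    case True
    then show ?thesis using vnormal_pos[OF z] by simp
  next
    case False
    then show ?thesis using le r0 by (simp add: mult_le_cancel_right)
  qed
  then show ?thesis
    unfolding r_def[symmetric] using lam_props(1)[OF z] by (simp add: field_simps)
qed

text \<open>The arithmetic-geometric mean inequality for the eigenvalues, whose product is det D^2u
  = K \<upsilon>^(n+2) \<ge> K \<upsilon>^n.\<close>

lemma hessian_trace_bound:
  assumes z: "z \<in> spacetime" and m: "\<And>i. m i > 0" "det (hess z) = (\<Prod>i\<in>UNIV. m (i::'n))"
  shows "real CARD('n) * (curv z powr (1 / real CARD('n)) * (1 / vnormal z)) \<le> (\<Sum>i\<in>UNIV. m i)"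
proof -
  let ?n = "real CARD('n)"
  have np: "vnormal z > 0" "?n > 0" using vnormal_pos[OF z] by auto
  have nle: "vnormal z \<le> 1"
    unfolding vnormal_explicit[OF z] by (simp add: divide_le_eq_1 add_pos_nonneg)
  have g: "1 + (norm (grad z))\<^sup>2 = 1 / (vnormal z)\<^sup>2" using vnormal_sq[OF z] np by (simp add: field_simps)
  have "curv z = vnormal z ^ CARD('n) * det (hess z) * (vnormal z)\<^sup>2"
    unfolding curv_eq[OF z] g by simp
  also have "\<dots> \<le> vnormal z ^ CARD('n) * det (hess z) * 1"
    using np nle det_hess_pos[OF z] by (intro mult_left_mono) (auto simp: power_le_one)
  finally have "curv z * (1 / vnormal z) ^ CARD('n) \<le> det (hess z)"
    using np by (simp add: power_divide field_simps)
  then have "(curv z * (1 / vnormal z) ^ CARD('n)) powr (1 / ?n) \<le> det (hess z) powr (1 / ?n)"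
    using curv_pos[OF z] np by (intro powr_mono2) auto
  also have "\<dots> \<le> (\<Sum>i\<in>UNIV. m i / ?n)"
    unfolding m(2) using m(1) by (intro arith_geom_mean) (auto intro: less_imp_le)
  also have "\<dots> = (\<Sum>i\<in>UNIV. m i) / ?n" by (simp add: sum_divide_distrib)
  also have "(curv z * (1 / vnormal z) ^ CARD('n)) powr (1 / ?n) = curv z powr (1 / ?n) * (1 / vnormal z)"
  proof -
    have "((1 / vnormal z) ^ CARD('n)) powr (1 / ?n) = 1 / vnormal z"
      using np by (subst powr_realpow[symmetric]) (auto simp: powr_powr)
    then show ?thesis using curv_pos[OF z] np by (simp add: powr_mult)
  qed
  finally show ?thesis using np by (simp add: field_simps)
qed

text \<open>Stated for arbitrary bounds \<theta> and \<Lambda>, so that suprema do not enter. The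
  function \<open>W\<close> vanishes at time 0 and where the height reaches M; being positive at the
  given point, it attains its maximum over the compact sublevel set at a positive time and below
  height M.\<close>

lemma speed_estimate:
  assumes init_nonneg: "\<And>x. x \<in> dom_at 0 \<Longrightarrow> hgt (x, 0) \<ge> 0" and M: "M \<ge> 1"
    and zt: "zt \<in> spacetime" "snd zt = t" "t > 0" "hgt zt < M"
    and \<theta>: "\<And>z. z \<in> spacetime \<Longrightarrow> snd z \<le> t \<Longrightarrow> hgt z < M \<Longrightarrow> 1 + (norm (grad z))\<^sup>2 \<le> \<theta>"
    and \<Lambda>: "\<And>z. z \<in> spacetime \<Longrightarrow> snd z \<le> t \<Longrightarrow> hgt z < M \<Longrightarrow> inverse (lam z) \<le> \<Lambda>"
  shows "t / (1 + t) * ((M - hgt zt)\<^sup>2 * curv zt powr (1 / real CARD('n)))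
    \<le> (4 * real CARD('n) * \<alpha> + 1)\<^sup>2 * (2 * \<theta>) powr (1 + 1 / (2 * real CARD('n) * \<alpha>)) * (\<theta> * \<Lambda> + M\<^sup>2)"
proof -
  let ?n = "real CARD('n)"
  define n where "n = real CARD('n)"
  have n: "n \<ge> 1" unfolding n_def using zero_less_card_finite[where 'a='n] by linarith
  \<comment> \<open>With this exponent the factor K^\<alpha> in u_t becomes K^(1/n).\<close>
  define c where "c = 1 / (n * \<alpha>)"
  have c: "c > 0" using n \<alpha>_pos by (simp add: c_def)
  have tT: "t < T" using zt by (auto simp: spacetime_def)
  have \<theta>1: "\<theta> \<ge> 1" using \<theta>[OF zt(1) _ zt(4)] zt(2) zero_le_power2[of "norm (grad zt)"] by linarith
  have \<Lambda>0: "\<Lambda> > 0"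
    using \<Lambda>[OF zt(1) _ zt(4)] lam_props(1)[OF zt(1)] zt(2) by (meson less_le_trans order_refl positive_imp_inverse_positive)
  (* Truncating at \<theta> changes nothing where hgt z < M, but keeps the test function continuous on
     the compact set hgt z <= M. *)
  define G where "G z = c * (ln (speed z) - ln (max (gap \<theta> z) \<theta>) / 2)" for z
  define W where "W z = snd z / (1 + snd z) * (max (M - hgt z) 0)\<^sup>2 * exp (G z)" for z
  have gap_ge: "gap \<theta> z \<ge> \<theta>" if "z \<in> spacetime" "snd z \<le> t" "hgt z < M" for z
    using \<theta>[OF that] by (simp add: gap_def power2_norm_eq_inner)
  have contDD: "continuous_on spacetime W"
    unfolding W_def G_def
  proof (intro continuous_intros continuous_dd Ck_hgt Ck_speed Ck_gap)
    show "\<forall>z\<in>spacetime. 1 + snd z \<noteq> 0" by (auto simp: spacetime_def)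
    show "\<forall>z\<in>spacetime. speed z \<noteq> 0" using speed_pos by force
    show "\<forall>z\<in>spacetime. max (gap \<theta> z) \<theta> \<noteq> 0" using \<theta>1 by (auto simp: max_def)
  qed auto
  have ztS: "zt \<in> sublevel M t" using zt by (simp add: sublevel_def)
  obtain z where z: "z \<in> sublevel M t" "\<And>y. y \<in> sublevel M t \<Longrightarrow> W y \<le> W z"
    using continuous_attains_sup[OF compact_sublevel[OF tT], of M W] ztS
      continuous_on_subset[OF contDD sublevel_subset] by blast
  have Wzt: "W zt > 0" using zt by (simp add: W_def)
  then have Wz: "W z > 0" using z(2)[OF ztS] by simp
  have zD: "z \<in> spacetime" "snd z \<le> t" "snd z \<ge> 0" using z(1) by (auto simp: sublevel_def spacetime_def)
  have uM: "hgt z < M" using Wz by (auto simp: W_def max_def split: if_splits)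
  have sz: "snd z > 0" using Wz zD(3) by (cases "snd z = 0") (auto simp: W_def)
  have zDO: "z \<in> interior_times" using zD sz by (simp add: interior_times_def)
  have Wexp: "W y = exp (log_test \<theta> M c y)" if "y \<in> interior_times" "snd y \<le> t" "hgt y < M" for y
  proof -
    have yD: "y \<in> spacetime" "snd y > 0" using that by (auto simp: interior_times_def)
    have mx: "max (gap \<theta> y) \<theta> = gap \<theta> y" using gap_ge[OF yD(1) that(2,3)] by simp
    have "exp (2 * ln (M - hgt y)) = (M - hgt y)\<^sup>2"
      using that(3) by (simp add: exp_double)
    then show ?thesis
      using that yD by (simp add: W_def log_test_def G_def mx exp_add)
  qed
  obtain e :: "'n \<Rightarrow> real^'n" and m where e: "\<And>i j. e i \<bullet> e j = (if i = j then 1 else 0)"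
    "\<And>i. hess z *v e i = m i *\<^sub>R e i" "\<And>i. m i > 0" "det (hess z) = (\<Prod>i\<in>UNIV. m i)"
    and J: "0 \<le> 1 / (snd z * (1 + snd z)) - 2 * speed z / (M - hgt z)
      + 2 * real CARD('n) * \<alpha> * speed z / (M - hgt z)
      + 4 * ((1 - \<alpha> * real (CARD('n) + 2)) / 2) * speed z * (grad z \<bullet> grad z) / ((1 + grad z \<bullet> grad z) * (M - hgt z))
      + (2 * \<alpha> + 8 * \<alpha> / c) * speed z * (\<Sum>k\<in>UNIV. 1 / m k * (grad z \<bullet> e k)\<^sup>2) / (M - hgt z)\<^sup>2
      - c * \<alpha> * speed z * (\<Sum>k\<in>UNIV. m k) / gap \<theta> z"
  proof (rule interior_maximum[OF zDO c uM, of \<theta> 1])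
    show "gap \<theta> z > 0" using gap_ge[OF zD(1,2) uM] \<theta>1 by simp
    fix y assume y: "y \<in> interior_times" "snd y \<le> snd z" "hgt y < M"
    then have "W y \<le> W z" using zD(2) interior_times_subset by (intro z(2)) (auto simp: sublevel_def)
    then show "log_test \<theta> M c y \<le> log_test \<theta> M c z"
      using Wexp[OF zDO zD(2) uM] Wexp[OF y(1) _ y(3)] y(2) zD(2) by simp
  qed auto
  define \<upsilon> where "\<upsilon> y = 1 / vnormal y" for y
  have \<upsilon>: "(\<upsilon> y)\<^sup>2 = 1 + grad y \<bullet> grad y" "\<upsilon> y \<ge> 1" "speed y = \<upsilon> y * curv y powr \<alpha>" if "y \<in> spacetime" for y
  proof -
    show 1: "(\<upsilon> y)\<^sup>2 = 1 + grad y \<bullet> grad y"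
      using vnormal_sq[OF that] vnormal_pos[OF that] by (simp add: \<upsilon>_def power2_norm_eq_inner field_simps)
    have "1\<^sup>2 \<le> (\<upsilon> y)\<^sup>2" unfolding 1 by simp
    then show "\<upsilon> y \<ge> 1"
      using vnormal_pos[OF that] by (intro power2_le_imp_le[of 1]) (simp_all add: \<upsilon>_def)
    show "speed y = \<upsilon> y * curv y powr \<alpha>" by (simp add: speed_def evolution[OF that] \<upsilon>_def)
  qed
  \<comment> \<open>Heights increase from nonnegative initial values, so M - u is at most M.\<close>
  have uz: "hgt z \<ge> 0"
    using height_mono[of "fst z" "snd z" 0] init_nonneg[of "fst z"] zD by (auto simp: spacetime_def)
  have X: "snd z / (1 + snd z) * (M - hgt z)\<^sup>2 * curv z powr (1 / n)
      \<le> 2 * \<theta> * (M\<^sup>2 * (1 + 2 * n * \<alpha>) + 2 * \<alpha> * (1 + 4 * n * \<alpha>) * \<Lambda>)"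
  proof (rule maximum_point_bound[where \<upsilon> = "\<upsilon> z" and \<kappa> = "grad z \<bullet> grad z" and Q = "gap \<theta> z" and P = "speed z"
        and m = "\<Sum>k\<in>UNIV. 1 / m k * (grad z \<bullet> e k)\<^sup>2" and S = "\<Sum>k\<in>UNIV. m k"])
    show "0 < curv z" by (rule curv_pos[OF zD(1)])
    show "(\<upsilon> z)\<^sup>2 = 1 + grad z \<bullet> grad z" "\<upsilon> z \<ge> 1" "speed z = \<upsilon> z * curv z powr \<alpha>" using \<upsilon>[OF zD(1)] by auto
    show "(\<upsilon> z)\<^sup>2 \<le> \<theta>" using \<upsilon>(1)[OF zD(1)] \<theta>[OF zD(1,2) uM] by (simp add: power2_norm_eq_inner)
    show "gap \<theta> z = 2 * \<theta> - (\<upsilon> z)\<^sup>2" unfolding \<upsilon>(1)[OF zD(1)] by (simp add: gap_def)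
    have "vnormal z * inverse (lam z) \<le> vnormal z * \<Lambda>"
      using \<Lambda>[OF zD(1,2) uM] vnormal_pos[OF zD(1)] by (intro mult_left_mono) auto
    then show "(\<Sum>k\<in>UNIV. 1 / m k * (grad z \<bullet> e k)\<^sup>2) \<le> \<Lambda> / \<upsilon> z"
      using inverse_hessian_bound[OF zD(1) e(1-3)] by (simp add: \<upsilon>_def mult.commute)
    show "n * (curv z powr (1 / n) * \<upsilon> z) \<le> (\<Sum>k\<in>UNIV. m k)"
      using hessian_trace_bound[OF zD(1) e(3,4)] by (simp add: n_def \<upsilon>_def)
    have "8 * \<alpha> / c = 8 * \<alpha> * (n * \<alpha>)" "c * \<alpha> = 1 / n" using \<alpha>_pos by (auto simp: c_def)
    then show "0 \<le> 1 / (snd z * (1 + snd z)) - 2 * speed z / (M - hgt z) + 2 * n * \<alpha> * speed z / (M - hgt z)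
      + 4 * ((1 - \<alpha> * (n + 2)) / 2) * speed z * (grad z \<bullet> grad z) / ((1 + grad z \<bullet> grad z) * (M - hgt z))
      + (2 * \<alpha> + 8 * \<alpha> * (n * \<alpha>)) * speed z * (\<Sum>k\<in>UNIV. 1 / m k * (grad z \<bullet> e k)\<^sup>2) / (M - hgt z)\<^sup>2
      - 1 / n * speed z * (\<Sum>k\<in>UNIV. m k) / gap \<theta> z"
      using J unfolding of_nat_add n_def[symmetric] by simp
  qed (use sz uM uz \<alpha>_pos n \<Lambda>0 M in auto)
  have expG: "exp (G y) = curv y powr (1 / n) * exp (c * (ln (\<upsilon> y) - ln (gap \<theta> y) / 2))"
    if "y \<in> spacetime" "snd y \<le> t" "hgt y < M" for y
  proof -
    have mx: "max (gap \<theta> y) \<theta> = gap \<theta> y" using gap_ge[OF that] by simp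
    have K: "curv y > 0" by (rule curv_pos[OF that(1)])
    have "ln (speed y) = ln (\<upsilon> y) + \<alpha> * ln (curv y)"
      using \<upsilon>(2)[OF that(1)] K by (simp add: \<upsilon>(3)[OF that(1)] ln_mult ln_powr)
    then have "G y = c * \<alpha> * ln (curv y) + c * (ln (\<upsilon> y) - ln (gap \<theta> y) / 2)"
      by (simp add: G_def mx algebra_simps)
    moreover have "c * \<alpha> = 1 / n" using \<alpha>_pos by (simp add: c_def)
    ultimately show ?thesis using K by (simp add: exp_add powr_def)
  qed
  have lnQ: "2 * ln (\<upsilon> y) \<le> ln (gap \<theta> y)" "ln (gap \<theta> y) \<le> ln (2 * \<theta>)" "ln (\<upsilon> y) \<ge> 0"
    if "y \<in> spacetime" "snd y \<le> t" "hgt y < M" for y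
  proof -
    have Q: "gap \<theta> y \<ge> \<theta>" by (rule gap_ge[OF that])
    have u: "(\<upsilon> y)\<^sup>2 \<le> \<theta>" using \<upsilon>(1)[OF that(1)] \<theta>[OF that] by (simp add: power2_norm_eq_inner)
    have "2 * ln (\<upsilon> y) = ln ((\<upsilon> y)\<^sup>2)" using \<upsilon>(2)[OF that(1)] by (simp add: ln_realpow)
    also have "\<dots> \<le> ln (gap \<theta> y)" using u Q \<upsilon>(2)[OF that(1)] \<theta>1 by (subst ln_le_cancel_iff) auto
    finally show "2 * ln (\<upsilon> y) \<le> ln (gap \<theta> y)" .
    have "gap \<theta> y \<le> 2 * \<theta>" using inner_ge_zero[of "grad y"] unfolding gap_def by linarith
    then show "ln (gap \<theta> y) \<le> ln (2 * \<theta>)" using Q \<theta>1 by (subst ln_le_cancel_iff) auto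
    show "ln (\<upsilon> y) \<ge> 0" using \<upsilon>(2)[OF that(1)] by simp
  qed
  let ?X = "t / (1 + t) * ((M - hgt zt)\<^sup>2 * curv zt powr (1 / n))"
  have X0: "?X \<ge> 0" using zt(3) by simp
  \<comment> \<open>At the given point \<phi> \<ge> 1/(2\<theta>), since \<upsilon> \<ge> 1 and
    \<open>gap\<close> is at most 2\<theta>.\<close>
  have "exp (c * (ln (\<upsilon> zt) - ln (gap \<theta> zt) / 2)) \<ge> exp (- (c / 2) * ln (2 * \<theta>))"
  proof -
    have "- (ln (2 * \<theta>)) / 2 \<le> ln (\<upsilon> zt) - ln (gap \<theta> zt) / 2" using lnQ[OF zt(1) _ zt(4)] zt(2) by simp
    then have "c * (- (ln (2 * \<theta>)) / 2) \<le> c * (ln (\<upsilon> zt) - ln (gap \<theta> zt) / 2)"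
      using c by (intro mult_left_mono) auto
    then show ?thesis by simp
  qed
  then have "?X * exp (- (c / 2) * ln (2 * \<theta>)) \<le> ?X * exp (c * (ln (\<upsilon> zt) - ln (gap \<theta> zt) / 2))"
    using X0 by (intro mult_left_mono)
  also have "\<dots> = W zt"
    using expG[OF zt(1) _ zt(4)] zt by (simp add: W_def max_def)
  also have "\<dots> \<le> W z" by (rule z(2)[OF ztS])
  also have "\<dots> = (snd z / (1 + snd z) * (M - hgt z)\<^sup>2 * curv z powr (1 / n)) * exp (c * (ln (\<upsilon> z) - ln (gap \<theta> z) / 2))"
    using expG[OF zD(1,2) uM] uM by (simp add: W_def max_def)
  also have "\<dots> \<le> (snd z / (1 + snd z) * (M - hgt z)\<^sup>2 * curv z powr (1 / n)) * 1"
  proof (rule mult_left_mono)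
    \<comment> \<open>At the maximum \<phi> \<le> 1, since \<upsilon>^2 \<le> \<theta> and
      \<open>gap\<close> is at least \<theta>.\<close>
    have "c * (ln (\<upsilon> z) - ln (gap \<theta> z) / 2) \<le> 0"
      using c lnQ(1)[OF zD(1,2) uM] by (intro mult_nonneg_nonpos) auto
    then show "exp (c * (ln (\<upsilon> z) - ln (gap \<theta> z) / 2)) \<le> 1" by simp
  qed (use sz in auto)
  also have "\<dots> \<le> 2 * \<theta> * (M\<^sup>2 * (1 + 2 * n * \<alpha>) + 2 * \<alpha> * (1 + 4 * n * \<alpha>) * \<Lambda>)" using X by simp
  also have "\<dots> \<le> 2 * \<theta> * ((4 * n * \<alpha> + 1)\<^sup>2 * (\<theta> * \<Lambda> + M\<^sup>2))"
  proof (rule mult_left_mono)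
    \<comment> \<open>The bound \<alpha> \<le> n\<alpha> lets both coefficients be absorbed into
      (4n\<alpha> + 1)^2; the factor \<theta> in front of \<Lambda> may be inserted because \<theta>
      \<ge> 1.\<close>
    have na: "n * \<alpha> > 0" "\<alpha> \<le> n * \<alpha>" using n \<alpha>_pos by auto
    have a1: "1 + 2 * n * \<alpha> \<le> (4 * n * \<alpha> + 1)\<^sup>2"
    proof -
      have ge: "1 \<le> 4 * n * \<alpha> + 1" using na(1) by linarith
      have "1 + 2 * n * \<alpha> \<le> 4 * n * \<alpha> + 1" using na(1) by linarith
      also have "\<dots> \<le> (4 * n * \<alpha> + 1)\<^sup>2" using ge by (intro self_le_power) auto
      finally show ?thesis .
    qed
    have a2: "2 * \<alpha> * (1 + 4 * n * \<alpha>) \<le> (4 * n * \<alpha> + 1)\<^sup>2"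
    proof -
      have "2 * \<alpha> \<le> 4 * n * \<alpha> + 1" using na by simp
      then have "2 * \<alpha> * (1 + 4 * n * \<alpha>) \<le> (4 * n * \<alpha> + 1) * (1 + 4 * n * \<alpha>)"
        using na by (intro mult_right_mono) auto
      then show ?thesis by (simp add: power2_eq_square add.commute)
    qed
    have "M\<^sup>2 * (1 + 2 * n * \<alpha>) + 2 * \<alpha> * (1 + 4 * n * \<alpha>) * \<Lambda>
        \<le> M\<^sup>2 * (4 * n * \<alpha> + 1)\<^sup>2 + (4 * n * \<alpha> + 1)\<^sup>2 * (\<theta> * \<Lambda>)"
      using a1 a2 \<theta>1 \<Lambda>0 by (intro add_mono mult_left_mono mult_mono) auto
    then show "M\<^sup>2 * (1 + 2 * n * \<alpha>) + 2 * \<alpha> * (1 + 4 * n * \<alpha>) * \<Lambda> \<le> (4 * n * \<alpha> + 1)\<^sup>2 * (\<theta> * \<Lambda> + M\<^sup>2)"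
      by (simp add: algebra_simps)
  qed (use \<theta>1 in auto)
  finally have fin: "?X * exp (- (c / 2) * ln (2 * \<theta>)) \<le> 2 * \<theta> * ((4 * n * \<alpha> + 1)\<^sup>2 * (\<theta> * \<Lambda> + M\<^sup>2))" .
  have pw: "(2 * \<theta>) powr (1 + 1 / (2 * n * \<alpha>)) = 2 * \<theta> * exp ((c / 2) * ln (2 * \<theta>))"
    using \<theta>1 by (simp add: powr_add powr_def c_def exp_add distrib_right)
  have "?X = ?X * exp (- (c / 2) * ln (2 * \<theta>)) * exp ((c / 2) * ln (2 * \<theta>))"
    by (simp add: mult.assoc flip: exp_add)
  also have "\<dots> \<le> 2 * \<theta> * ((4 * n * \<alpha> + 1)\<^sup>2 * (\<theta> * \<Lambda> + M\<^sup>2)) * exp ((c / 2) * ln (2 * \<theta>))"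
    using fin by (intro mult_right_mono) auto
  also have "\<dots> = (4 * n * \<alpha> + 1)\<^sup>2 * (2 * \<theta>) powr (1 + 1 / (2 * n * \<alpha>)) * (\<theta> * \<Lambda> + M\<^sup>2)"
    unfolding pw by (simp only: ac_simps)
  finally show ?thesis by (simp add: n_def)
qed

end

theorem theorem4p1:
  fixes \<alpha> T M :: real
    and \<Omega> :: "(real ^ 'n::finite) set"
    and u0 :: "real ^ 'n \<Rightarrow> real"
    and A :: "('m::{second_countable_topology, t2_space}, 'n) chart set"
    and F :: "'m \<Rightarrow> real \<Rightarrow> 'n space"
    and p :: 'm
    and t :: real
  assumes "0 < \<alpha>" and "0 < T"
    and "convex \<Omega>" and "open \<Omega>"
    and "locally_uniformly_convex (graph_over \<Omega> u0)"
    and "\<exists>x\<in>\<Omega>. \<forall>y\<in>\<Omega>. u0 x \<le> u0 y"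
    and "0 \<le> (INF x\<in>\<Omega>. u0 x)"
    and "\<Omega> \<noteq> UNIV \<Longrightarrow> \<forall>x0\<in>frontier \<Omega>. filterlim u0 at_top (at x0 within \<Omega>)"
    and "\<not> bounded \<Omega> \<Longrightarrow> filterlim (\<lambda>R. INF x\<in>\<Omega> - ball 0 R. u0 x) at_top at_top"
    and "smooth_atlas A"
    and "gcf_graph_solution A \<alpha> T (graph_over \<Omega> u0) F"
    and "1 \<le> M"
    and "0 \<le> t" and "t < T"
  shows "t / (1 + t) *
           ((cutoff M F p t)\<^sup>2 * gauss_curvature (slice F t) (F p t) powr (1 / real CARD('n)))
         \<le> (4 * real CARD('n) * \<alpha> + 1)\<^sup>2 *
           (2 * theta_const M F t) powr (1 + 1 / (2 * real CARD('n) * \<alpha>)) *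
           (theta_const M F t * Lambda_const M F t + M\<^sup>2)"
proof -
  interpret G: gcf_flow A \<alpha> T "graph_over \<Omega> u0" F
    using assms by unfold_locales
  have s0: "0 \<in> {0..<T}" and st: "t \<in> {0..<T}" using assms by auto
  have slice0: "slice F 0 = graph_over \<Omega> u0"
    using assms(11) by (simp add: gcf_graph_solution_def)
  have dom0: "G.dom_at 0 = \<Omega>"
    unfolding G.dom_at_def slice0 by (force simp: graph_over_def)
  have uu0: "G.hgt (x, 0) = u0 x" if "x \<in> \<Omega>" for x
    unfolding G.hgt_def using that by (auto simp: slice0 graph_over_def)
  obtain x0 where x0: "x0 \<in> \<Omega>" "\<And>y. y \<in> \<Omega> \<Longrightarrow> u0 x0 \<le> u0 y" using assms(6) by blast
  have bdd: "bdd_below (u0 ` \<Omega>)" using x0(2) by (auto intro!: bdd_belowI[of _ "u0 x0"])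
  have u0_nonneg: "u0 x \<ge> 0" if "x \<in> \<Omega>" for x
    using cINF_lower[OF bdd that] assms(7) by simp
  \<comment> \<open>The assumptions of this locale are phrased with \<open>dom_at\<close> and
    \<open>hgt\<close>; at time 0 these have been identified with \<Omega> and
    \<open>u0\<close>.\<close>
  interpret G: proper_gcf_flow A \<alpha> T "graph_over \<Omega> u0" F
  proof
    show "\<exists>x\<in>G.dom_at 0. \<forall>y\<in>G.dom_at 0. G.hgt (x, 0) \<le> G.hgt (y, 0)"
      using x0 by (auto simp: dom0 uu0)
    show "bounded {x \<in> G.dom_at 0. G.hgt (x, 0) \<le> C}" for C
    \<comment> \<open>For bounded \<Omega> sublevel sets are trivially bounded; otherwise condition
      (iii) makes \<open>u0\<close> exceed C outside a ball.\<close>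
    proof (cases "bounded \<Omega>")
      case True
      then show ?thesis by (rule bounded_subset) (auto simp: dom0)
    next
      case False
      from assms(9)[OF False] have "\<forall>\<^sub>F R in at_top. C < (INF x\<in>\<Omega> - ball 0 R. u0 x)"
        by (simp add: filterlim_at_top_dense)
      then obtain R where R: "C < (INF x\<in>\<Omega> - ball 0 R. u0 x)"
        using eventually_happens by fastforce
      have "{x \<in> G.dom_at 0. G.hgt (x, 0) \<le> C} \<subseteq> ball 0 R"
      proof
        fix x assume "x \<in> {x \<in> G.dom_at 0. G.hgt (x, 0) \<le> C}"
        then have x: "x \<in> \<Omega>" "u0 x \<le> C" by (auto simp: dom0 uu0)
        show "x \<in> ball 0 R"
        proof (rule ccontr)
          assume "x \<notin> ball 0 R"
          then have "(INF x\<in>\<Omega> - ball 0 R. u0 x) \<le> u0 x"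
            using x(1) by (intro cINF_lower bdd_below_mono[OF bdd]) auto
          then show False using R x(2) by simp
        qed
      qed
      then show ?thesis using bounded_ball bounded_subset by blast
    qed
  qed (use assms in auto)
  let ?Th = "{(gradient_fn F q s)\<^sup>2 | q s. height F q s < M \<and> s \<in> {0..t}}"
  let ?La = "{inverse (lambda_min (slice F s) (F q s)) | q s. height F q s < M \<and> s \<in> {0..t}}"
  have height: "height F q s = G.hgt (fst (F q s), s)" if "s \<in> {0..<T}" for q s
    using G.F_graph(2)[OF that, of q] by (simp add: height_def e_vert_def inner_prod_def prod_eq_iff)
  have normal: "(gradient_fn F q s)\<^sup>2 = 1 + (norm (G.grad (fst (F q s), s)))\<^sup>2"
    "lambda_min (slice F s) (F q s) = G.lam (fst (F q s), s)"
    "gauss_curvature (slice F s) (F q s) = G.curv (fst (F q s), s)" if "s \<in> {0..<T}" for q s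
  proof -
    let ?z = "(fst (F q s), s)"
    have z: "?z \<in> G.spacetime" using G.F_graph(1)[OF that] that by simp
    have F: "F q s = (fst ?z, G.hgt ?z)" using G.F_graph(2)[OF that, of q] by simp
    have "gradient_fn F q s = inverse (G.vnormal ?z)"
      using F G.interior_normal_eq[OF z] by (simp add: gradient_fn_def e_vert_def inner_prod_def)
    then show "(gradient_fn F q s)\<^sup>2 = 1 + (norm (G.grad ?z))\<^sup>2"
      using inverse_unique[OF G.vnormal_sq[OF z]] by (simp add: power_inverse)
    show "lambda_min (slice F s) (F q s) = G.lam ?z" "gauss_curvature (slice F s) (F q s) = G.curv ?z"
      using F by (auto simp: G.lam_def G.curv_def)
  qed
  have sub: "(fst (F q s), s) \<in> G.sublevel M t" if "height F q s < M" "s \<in> {0..t}" for q s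
  proof -
    have s: "s \<in> {0..<T}" using that(2) assms(14) by auto
    show ?thesis using that G.F_graph(1)[OF s, of q] height[OF s, of q] s by (auto simp: G.sublevel_def)
  qed
  obtain B1 where B1: "\<And>z. z \<in> G.sublevel M t \<Longrightarrow> 1 + (norm (G.grad z))\<^sup>2 \<le> B1"
    using G.gradient_bounded[OF assms(14)] by metis
  obtain B2 where B2: "\<And>z. z \<in> G.sublevel M t \<Longrightarrow> inverse (G.lam z) \<le> B2"
    using G.curvature_bounded[OF assms(14)] by metis
  \<comment> \<open>A real supremum is known to be an upper bound only for a set bounded above;
    compactness of the sublevel set provides such a bound for all times in [0,t] at once.\<close>
  have bddTh: "bdd_above ?Th"
    using B1[OF sub] normal(1) assms(14) by (intro bdd_aboveI[of _ B1]) auto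
  have bddLa: "bdd_above ?La"
    using B2[OF sub] normal(2) assms(14) by (intro bdd_aboveI[of _ B2]) auto
  have pt: "\<exists>q. F q (snd z) = (fst z, G.hgt z) \<and> snd z \<in> {0..<T}" if "z \<in> G.spacetime" for z
    using G.slice_point[of "snd z" "fst z"] that by (auto simp: G.spacetime_def)
  have theta: "1 + (norm (G.grad z))\<^sup>2 \<le> theta_const M F t"
    and Lambda: "inverse (G.lam z) \<le> Lambda_const M F t"
    if z: "z \<in> G.spacetime" "snd z \<le> t" "G.hgt z < M" for z
  proof -
    obtain q where q: "F q (snd z) = (fst z, G.hgt z)" "snd z \<in> {0..<T}" using pt[OF z(1)] by blast
    have h: "height F q (snd z) < M" "snd z \<in> {0..t}" using height[OF q(2), of q] q z by auto
    have "(gradient_fn F q (snd z))\<^sup>2 \<in> ?Th" using h by blast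
    then have "(gradient_fn F q (snd z))\<^sup>2 \<le> theta_const M F t"
      unfolding theta_const_def using bddTh by (intro cSup_upper)
    then show "1 + (norm (G.grad z))\<^sup>2 \<le> theta_const M F t" using normal(1)[OF q(2), of q] q(1) by simp
    have "inverse (lambda_min (slice F (snd z)) (F q (snd z))) \<in> ?La" using h by blast
    then have "inverse (lambda_min (slice F (snd z)) (F q (snd z))) \<le> Lambda_const M F t"
      unfolding Lambda_const_def using bddLa by (intro cSup_upper)
    then show "inverse (G.lam z) \<le> Lambda_const M F t" using normal(2)[OF q(2), of q] q(1) by simp
  qed
  let ?z = "(fst (F p t), t)"
  have z: "?z \<in> G.spacetime" using G.F_graph(1)[OF st] st by simp
  show ?thesis
  proof (cases "t > 0 \<and> height F p t < M")
    case True
    then have "cutoff M F p t = M - G.hgt ?z" using height[OF st, of p] by (simp add: cutoff_def)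
    moreover have "gauss_curvature (slice F t) (F p t) = G.curv ?z" by (rule normal(3)[OF st])
    moreover have "G.hgt ?z < M" using True height[OF st, of p] by simp
    ultimately show ?thesis
      using G.speed_estimate[OF _ assms(12) z _ _ _ theta Lambda] True u0_nonneg uu0
      by (simp add: dom0)
  next
    \<comment> \<open>The left-hand side is zero, because t = 0 or the height is at least M. The
      sign of the right-hand side still needs an argument, as \<theta> and \<Lambda> are suprema of
      possibly empty sets.\<close>
    case False
    then have "t / (1 + t) * ((cutoff M F p t)\<^sup>2 * gauss_curvature (slice F t) (F p t) powr (1 / real CARD('n))) = 0"
      using assms(13) by (auto simp: cutoff_def)
    moreover have "theta_const M F t * Lambda_const M F t \<ge> 0"
    proof (cases "\<exists>q s. height F q s < M \<and> s \<in> {0..t}")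
      case True
      then obtain q s where qs: "height F q s < M" "s \<in> {0..t}" by blast
      let ?y = "(fst (F q s), s)"
      have y: "?y \<in> G.spacetime" "snd ?y \<le> t" using sub[OF qs] by (auto simp: G.sublevel_def)
      have "G.hgt ?y < M" using qs height[of s q] assms(14) by auto
      note th = theta[OF y this] and la = Lambda[OF y this]
      have "0 \<le> theta_const M F t" using th zero_le_power2[of "norm (G.grad ?y)"] by linarith
      moreover have "0 \<le> Lambda_const M F t" using la G.lam_props(1)[OF y(1)]
        by (meson less_imp_le order_trans positive_imp_inverse_positive)
      ultimately show ?thesis by simp
    next
      case False
      (* Both constants are then the unspecified supremum of the empty set, hence equal. *)
      then have "?Th = {}" "?La = {}" by auto
      then have "theta_const M F t = Lambda_const M F t"
        by (simp only: theta_const_def Lambda_const_def)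
      then show ?thesis by simp
    qed
    then have "theta_const M F t * Lambda_const M F t + M\<^sup>2 \<ge> 0" by simp
    then have "0 \<le> (4 * real CARD('n) * \<alpha> + 1)\<^sup>2 *
           (2 * theta_const M F t) powr (1 + 1 / (2 * real CARD('n) * \<alpha>)) *
           (theta_const M F t * Lambda_const M F t + M\<^sup>2)"
      by (intro mult_nonneg_nonneg) auto
    ultimately show ?thesis by linarith
  qed
qed

end
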